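(* Let $\{\mathcal{P}_m\}_{m\in\mathbb{N}}$ be a nested family of submodels of $\mathcal{F}\subset l_2(\nu)$, with $\mathcal{P}_\infty:=\mathcal{F}$. For each $m$ let $D_m\ge1$ satisfy $D_m\ge\mathrm{pdim}(F(\underline X^n;\mathcal{P}_m))$ almost surely (and $D_\infty:=\infty$). Let the errors be i.i.d. sub-Gaussian with parameter $\sigma^2$. Let $\ast\in\{up,un\}$; when $\ast=up$ assume that $\inf_{g\in\mathcal{P}_m}l_\nu^2(f_0,g)\le\mathfrak{e}(f_0,\Omega)\mathfrak{G}(m)$ for all $m\in\mathbb{N}$. For the norm $\#\in\{c,d\}$ considered, let $\mathfrak{M}_n^{\ast,\#}$, $\hat m^{\ast,\#}$, $\mathfrak{t}^{\#}$, $\mathfrak{Bias}^\ast$, $\mathfrak{e}^\ast$ be as defined in the context, and assume $\mathfrak{M}_n^{\ast,\#}\le n$ and $\mathfrak{M}_n^{\ast,\#}\to\infty$ as $n\to\infty$. [Continuous norm.] Assume $\mathcal{F}$, all $\mathcal{P}_m$ and $f_0$ are uniformly bounded by $\Gamma$. For $f_0\in\mathcal{P}_{m_0}$ ($1\le m_0\le\infty$), $$\mathbb{E}\big[l_\nu^2(\hat f_{\hat m^{\ast,c}},f_0)\big]\le\min\Big\{2(\mathfrak{t}^c+\bar{\mathfrak{k}}^c+44)\frac{(\sigma^2\vee\Gamma^2)\kappa D_{m_0}\log n}{n},\;2(\bar{\mathfrak{c}}^c\mathfrak{e}^\ast+\bar{\mathfrak{k}}^c+\mathfrak{t}^c)\inf_{m\in\mathbb{N}}\Big(\mathfrak{Bias}^\ast(m)+\frac{(\sigma^2\vee\Gamma^2)\kappa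 D_m\log n}{n}\Big)\Big\}$$ holds for $n\ge\big(\mathbf{1}_{m_0<\infty}\inf\{n:\mathfrak{M}_n^{\ast,c}\ge m_0\}\big)\vee7$. [Discrete norm.] Suppose $f_0\in\mathcal{P}_{m_0}$ ($1\le m_0\le\infty$) and $f_0$ is uniformly bounded. Then $$\mathbb{E}\big[l_{\underline X^n}^2(\hat f_{\hat m^{\ast,d}},f_0)\big]\le\min\Big\{2(\mathfrak{t}^d+\bar{\mathfrak{k}}^d+84)\frac{(\sigma^2\vee\|f_0\|_\infty^2)\kappa D_{m_0}\log n}{n},\;2(\bar{\mathfrak{c}}^d\mathfrak{e}^\ast+\bar{\mathfrak{k}}^d+\mathfrak{t}^d)\inf_{m\in\mathbb{N}}\Big(\mathfrak{Bias}^\ast(m)+\frac{\sigma^2\kappa D_m\log n}{n}\Big)\Big\}$$ holds for $n\ge\big(\mathbf{1}_{m_0<\infty}\inf\{n:\mathfrak{M}_n^{\ast,d}\ge m_0\}\big)\vee7$.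
   Context: Regression model with random design: $X_1,\dots,X_n$ i.i.d. from a probability measure $\nu$ on $\Omega\subset\mathbb{R}^d$, $Y_i=f_0(X_i)+\epsilon_i$, errors independent of the $X_i$'s; sub-Gaussian with parameter $\sigma^2$ means $\mathbb{E}\exp(t\epsilon_1)\le\exp(\sigma^2t^2/2)$ for all $t\in\mathbb{R}$. $l_2(\nu)$ is the set of $\nu$-square-integrable functions. Write $l_c^2(f,g):=l_\nu^2(f,g):=\int(f-g)^2\,d\nu$ and $l_d^2(f,g):=l_{\underline X^n}^2(f,g):=\frac1n\sum_{i=1}^n(f(X_i)-g(X_i))^2$. For each $m$, $\hat f_m\in\arg\min_{f\in\mathcal{P}_m}\frac1n\sum_{i=1}^n(Y_i-f(X_i))^2$, assumed to exist. $F(\underline X^n;\mathcal{P}_m):=\{(g(X_1),\dots,g(X_n)):g\in\mathcal{P}_m\}\subset\mathbb{R}^n$. A set $V\subset\mathbb{R}^n$ has pseudo-dimension $\mathrm{pdim}(V)$ at most $t$ if for every set $I\subset\{1,\dots,n\}$ of $t+1$ distinct indices and every $x\in\mathbb{R}^I$ there is $J\subset I$ such that no $v\in V$ satisfies both $v_i>x_i$ for all $i\in J$ and $v_i<x_i$ for all $i\in I\setminus J$; $\mathrm{pdim}(V)$ is the smallest such $t$. $\kappa\ge1$ is an absolute constant (it exists, by Mendelson and Vershynin) such that for all $n$, every $V\subset\mathbb{R}^n$ with $\sup_{v\in V}\|v\|_\infty\le B$ and pseudo-dimension at most $t$, and every $\epsilon>0$, the minimal number of Euclidean $\epsilon$-balls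 covering $V$ is at most $(4+2B\sqrt n/\epsilon)^{\kappa t}$. Numerical constants: $\mathfrak{k}^c=7.56\times10^6$, $\mathfrak{d}^c=3.35\times10^5$, $\mathfrak{k}^d=819200$, $\mathfrak{d}^d=8$, $\bar{\mathfrak{c}}^c=144$, $\bar{\mathfrak{k}}^c=4.5\times10^7$, $\bar{\mathfrak{c}}^d=18$, $\bar{\mathfrak{k}}^d=5.62\times10^6$, $\mathfrak{v}=73728$, and $\mathfrak{t}^{\#}:=2(\mathfrak{k}^{\#}+4(\mathfrak{v}\vee1)\mathfrak{d}^{\#})$ for $\#\in\{c,d\}$. Let $\mathfrak{L}^c:=\sigma^2\vee\Gamma^2$ and $\mathfrak{L}^d:=\sigma^2$. The functions $\mathfrak{e}(f_0,\Omega)$ (not depending on $m$) and $\mathfrak{G}(m)$ (not depending on $f_0$) are given nonnegative quantities. Put $\mathfrak{Bias}^{up}(m):=\mathfrak{G}(m)$, $\mathfrak{e}^{up}:=\mathfrak{e}(f_0,\Omega)$, $\mathfrak{Bias}^{un}(m):=\sup_{f\in\mathcal{F}}\inf_{g\in\mathcal{P}_m}l_\nu^2(f,g)$, $\mathfrak{e}^{un}:=1$. Let $$\mathfrak{M}_n^{\ast,\#}:=\arg\min_{m\in\mathbb{N}}\Big\{\mathfrak{Bias}^\ast(m)+\frac{\mathfrak{L}^{\#}\kappa D_m\log n}{n}\Big\},$$ $$\hat m^{\ast,\#}:=\min\Big\{1\le m\le\mathfrak{M}_n^{\ast,\#}:\;l_{\#}^2(\hat f_m,\hat f_{m'})\le\mathfrak{t}^{\#}\frac{\mathfrak{L}^{\#}\kappa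 D_{m'}\log n}{n}\ \text{ for all }m'\in\{m,\dots,\mathfrak{M}_n^{\ast,\#}\}\Big\}.$$ Probabilities and expectations are understood as outer ones where measurability is an issue.
   Formalization: The least squares estimators are assumed jointly measurable in data and argument (false for arbitrary minimizers), and inf{n : M_n ≥ m_0} is read as the sample size from which M_n ≥ m_0 holds for good (same for nondecreasing M_n; the literal infimum fails otherwise). *)

theory Defs
  imports "HOL-Probability.Probability"
begin

section \<open>Square-integrable functions and the two squared distances\<close>

definition l2_fun :: "'a measure \<Rightarrow> ('a \<Rightarrow> real) set" where
  "l2_fun \<nu> = {f \<in> borel_measurable \<nu>. integrable \<nu> (\<lambda>x. (f x)\<^sup>2)}"

text \<open>The superscript \<open>#\<close>: the continuous and the discrete norm.\<close>
datatype norm_kind = Cont | Disc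

fun sqdist :: "norm_kind \<Rightarrow> 'a measure \<Rightarrow> nat \<Rightarrow> (nat \<Rightarrow> 'a) \<Rightarrow> ('a \<Rightarrow> real) \<Rightarrow> ('a \<Rightarrow> real) \<Rightarrow> real" where
  "sqdist Cont \<nu> n x f g = (\<integral>z. (f z - g z)\<^sup>2 \<partial>\<nu>)"
| "sqdist Disc \<nu> n x f g = (1 / real n) * (\<Sum>i=1..n. (f (x i) - g (x i))\<^sup>2)"

section \<open>Pseudo-dimension and the entropy constant\<close>

text \<open>
  A vector of \<open>\<real>\<^sup>n\<close> is an element of \<open>{1..n} \<rightarrow>\<^sub>E UNIV\<close>, that is, a function on \<open>nat\<close>
  fixed to be \<open>undefined\<close> outside \<open>{1..n}\<close>.
\<close>

definition pdim_le :: "nat \<Rightarrow> (nat \<Rightarrow> real) set \<Rightarrow> nat \<Rightarrow> bool" where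
  "pdim_le n V t \<longleftrightarrow>
     (\<forall>I x. I \<subseteq> {1..n} \<and> card I = t + 1 \<longrightarrow>
        (\<exists>J\<subseteq>I. \<not> (\<exists>v\<in>V. (\<forall>i\<in>J. v i > x i) \<and> (\<forall>i\<in>I - J. v i < x i))))"

definition pdim :: "nat \<Rightarrow> (nat \<Rightarrow> real) set \<Rightarrow> nat" where
  "pdim n V = (LEAST t. pdim_le n V t)"

definition trace_set :: "nat \<Rightarrow> (nat \<Rightarrow> 'a) \<Rightarrow> ('a \<Rightarrow> real) set \<Rightarrow> (nat \<Rightarrow> real) set" where
  "trace_set n x G = (\<lambda>g. \<lambda>i\<in>{1..n}. g (x i)) ` G"

text \<open>The property of \<open>\<kappa>\<close> provided by the theorem of Mendelson and Vershynin.\<close>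
definition entropy_constant :: "real \<Rightarrow> bool" where
  "entropy_constant \<kappa> \<longleftrightarrow> 1 \<le> \<kappa> \<and>
     (\<forall>n\<ge>1. \<forall>V \<subseteq> {1..n} \<rightarrow>\<^sub>E UNIV. \<forall>B\<ge>0. \<forall>t::nat. \<forall>\<epsilon>>0.
        (\<forall>v\<in>V. \<forall>i\<in>{1..n}. \<bar>v i\<bar> \<le> B) \<and> pdim n V \<le> t \<longrightarrow>
        (\<exists>C \<subseteq> {1..n} \<rightarrow>\<^sub>E UNIV. finite C \<and>
           real (card C) \<le> (4 + 2 * B * sqrt (real n) / \<epsilon>) powr (\<kappa> * real t) \<and>
           (\<forall>v\<in>V. \<exists>c\<in>C. L2_set (\<lambda>i. v i - c i) {1..n} \<le> \<epsilon>)))"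

section \<open>Numerical constants\<close>

fun k_const :: "norm_kind \<Rightarrow> real" where
  "k_const Cont = 7.56 * 10 ^ 6"
| "k_const Disc = 819200"

fun d_const :: "norm_kind \<Rightarrow> real" where
  "d_const Cont = 3.35 * 10 ^ 5"
| "d_const Disc = 8"

fun c_bar :: "norm_kind \<Rightarrow> real" where
  "c_bar Cont = 144"
| "c_bar Disc = 18"

fun k_bar :: "norm_kind \<Rightarrow> real" where
  "k_bar Cont = 4.5 * 10 ^ 7"
| "k_bar Disc = 5.62 * 10 ^ 6"

definition v_const :: real where
  "v_const = 73728"

definition t_const :: "norm_kind \<Rightarrow> real" where
  "t_const h = 2 * (k_const h + 4 * max v_const 1 * d_const h)"

section \<open>Models, bias terms and penalties\<close>

text \<open>Index sets \<open>\<nat>\<close> of models start at 1; \<open>\<P>\<^sub>\<infinity>\<close> is \<open>F\<close>.\<close>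
definition submodel :: "(nat \<Rightarrow> 'b set) \<Rightarrow> 'b set \<Rightarrow> enat \<Rightarrow> 'b set" where
  "submodel P F m0 = (case m0 of enat m \<Rightarrow> P m | \<infinity> \<Rightarrow> F)"

text \<open>
  Approximation errors are extended nonnegative reals: \<open>F\<close> need not be bounded in
  \<open>L\<^sup>2\<close>, and then the supremum in the case \<open>Bias_un\<close> below may be infinite.
\<close>
definition approx_error ::
  "'a measure \<Rightarrow> ('a \<Rightarrow> real) \<Rightarrow> ('a \<Rightarrow> real) set \<Rightarrow> ennreal" where
  "approx_error \<nu> f G = (INF g\<in>G. ennreal (\<integral>z. (f z - g z)\<^sup>2 \<partial>\<nu>))"

text \<open>The superscript \<open>*\<close>: the cases up and un.\<close>
datatype bias_kind = Bias_up | Bias_un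

fun bias ::
  "bias_kind \<Rightarrow> 'a measure \<Rightarrow> ('a \<Rightarrow> real) set \<Rightarrow> (nat \<Rightarrow> ('a \<Rightarrow> real) set) \<Rightarrow>
   (nat \<Rightarrow> real) \<Rightarrow> nat \<Rightarrow> ennreal" where
  "bias Bias_up \<nu> F P \<GG> m = ennreal (\<GG> m)"
| "bias Bias_un \<nu> F P \<GG> m = (SUP f\<in>F. approx_error \<nu> f (P m))"

fun bias_factor :: "bias_kind \<Rightarrow> real \<Rightarrow> real" where
  "bias_factor Bias_up e = e"
| "bias_factor Bias_un e = 1"

definition penalty :: "real \<Rightarrow> real \<Rightarrow> (nat \<Rightarrow> real) \<Rightarrow> nat \<Rightarrow> nat \<Rightarrow> real" where
  "penalty L \<kappa> D n m = L * \<kappa> * D m * ln (real n) / real n"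

text \<open>\<open>D\<^sub>\<infinity> = \<infinity>\<close>; the value is \<open>\<top>\<close> even when \<open>L = 0\<close>.\<close>
definition penalty_ext ::
  "real \<Rightarrow> real \<Rightarrow> (nat \<Rightarrow> real) \<Rightarrow> nat \<Rightarrow> enat \<Rightarrow> ennreal" where
  "penalty_ext L \<kappa> D n m0 =
     (case m0 of enat m \<Rightarrow> ennreal (penalty L \<kappa> D n m) | \<infinity> \<Rightarrow> \<top>)"

fun noise_level :: "norm_kind \<Rightarrow> real \<Rightarrow> real \<Rightarrow> real" where
  "noise_level Cont \<sigma> \<Gamma> = max (\<sigma>\<^sup>2) (\<Gamma>\<^sup>2)"
| "noise_level Disc \<sigma> \<Gamma> = \<sigma>\<^sup>2"

definition criterion ::
  "(nat \<Rightarrow> ennreal) \<Rightarrow> real \<Rightarrow> real \<Rightarrow> (nat \<Rightarrow> real) \<Rightarrow> nat \<Rightarrow> nat \<Rightarrow> ennreal" where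
  "criterion b L \<kappa> D n m = b m + ennreal (penalty L \<kappa> D n m)"

text \<open>
  \<open>\<MM> n\<close> is some minimiser of the criterion over the indices \<open>m \<ge> 1\<close>, with no
  restriction on how ties are broken. The sample size 1 is left out: there \<open>ln n / n = 0\<close>,
  nothing is penalised, and a minimiser generally does not exist.
\<close>
definition oracle_index ::
  "(nat \<Rightarrow> ennreal) \<Rightarrow> real \<Rightarrow> real \<Rightarrow> (nat \<Rightarrow> real) \<Rightarrow> (nat \<Rightarrow> nat) \<Rightarrow> bool" where
  "oracle_index b L \<kappa> D \<MM> \<longleftrightarrow>
     (\<forall>n\<ge>2. is_arg_min (criterion b L \<kappa> D n) (\<lambda>m. 1 \<le> m) (\<MM> n))"

text \<open>
  The threshold \<open>1\<^bsub>m0<\<infinity>\<^esub> inf {n. \<MM> n \<ge> m0}\<close>, with the infimum read as the sample size from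
  which on \<open>\<MM> n \<ge> m0\<close>. It is finite because \<open>\<MM>\<close> tends to infinity. For a nondecreasing
  \<open>\<MM>\<close> it is the infimum of the set itself, see the lemma below; without
  monotonicity an isolated early \<open>n\<close> with \<open>\<MM> n \<ge> m0\<close> says nothing about later sample sizes.
\<close>
definition sample_threshold :: "(nat \<Rightarrow> nat) \<Rightarrow> enat \<Rightarrow> nat" where
  "sample_threshold \<MM> m0 =
     (case m0 of enat m \<Rightarrow> Inf {N. \<forall>n\<ge>N. m \<le> \<MM> n} | \<infinity> \<Rightarrow> 0)"

lemma sample_threshold_mono:
  assumes "mono \<MM>"
  shows "sample_threshold \<MM> (enat m) = Inf {n. m \<le> \<MM> n}"
proof -
  have "{N. \<forall>n\<ge>N. m \<le> \<MM> n} = {n. m \<le> \<MM> n}"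
    using monoD[OF assms] le_trans by blast
  then show ?thesis
    by (simp add: sample_threshold_def)
qed

section \<open>Least squares and the adaptive estimator\<close>

text \<open>
  An estimator is a function of the data \<open>(x, y) \<in> \<Omega>\<^sup>n \<times> \<real>\<^sup>n\<close> with values in the functions
  on \<open>\<Omega>\<close>, measurable jointly in the data and the argument. Measurability cannot be dropped
  here even if expectations are outer ones. Take noiseless data with \<open>f\<^sub>0 = 1\<close> and a model
  consisting of \<open>1\<close> and the indicators of a chain of \<open>\<nu>\<close>-null sets such that any \<open>n\<close> points
  lie in a member of the chain. The model has pseudo-dimension at most 1, but a least squares
  fit may always be chosen at \<open>L\<^sup>2\<close> distance 1 from \<open>f\<^sub>0\<close>.
\<close>
definition least_squares_estimator ::
  "'a measure \<Rightarrow> nat \<Rightarrow> ('a \<Rightarrow> real) set \<Rightarrow>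
   ((nat \<Rightarrow> 'a) \<Rightarrow> (nat \<Rightarrow> real) \<Rightarrow> 'a \<Rightarrow> real) \<Rightarrow> bool" where
  "least_squares_estimator \<nu> n G fh \<longleftrightarrow>
     (\<forall>x \<in> {1..n} \<rightarrow>\<^sub>E space \<nu>. \<forall>y \<in> {1..n} \<rightarrow>\<^sub>E UNIV.
        is_arg_min (\<lambda>f. (1 / real n) * (\<Sum>i=1..n. (y i - f (x i))\<^sup>2)) (\<lambda>f. f \<in> G) (fh x y)) \<and>
     (\<lambda>((x, y), z). fh x y z) \<in> borel_measurable
        ((PiM {1..n} (\<lambda>_. \<nu>) \<Otimes>\<^sub>M PiM {1..n} (\<lambda>_. borel)) \<Otimes>\<^sub>M \<nu>)"

text \<open>\<open>d2\<close> is the squared distance, \<open>pen\<close> the penalty, \<open>N\<close> the largest admissible index.\<close>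
definition adaptive_index ::
  "('b \<Rightarrow> 'b \<Rightarrow> real) \<Rightarrow> (nat \<Rightarrow> real) \<Rightarrow> real \<Rightarrow> nat \<Rightarrow> (nat \<Rightarrow> 'b) \<Rightarrow> nat" where
  "adaptive_index d2 pen t N fh =
     Min {m \<in> {1..N}. \<forall>m'\<in>{m..N}. d2 (fh m) (fh m') \<le> t * pen m'}"

text \<open>
  The loss of the adaptive estimator, distance and calibration both taken in the norm \<open>h\<close>, as a
  function of the data; \<open>L\<close> is the noise level and \<open>N\<close> the value of \<open>\<MM>\<close> at \<open>n\<close>.
\<close>
definition adaptive_loss ::
  "norm_kind \<Rightarrow> 'a measure \<Rightarrow> nat \<Rightarrow> real \<Rightarrow> real \<Rightarrow> (nat \<Rightarrow> real) \<Rightarrow> nat \<Rightarrow>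
   (nat \<Rightarrow> (nat \<Rightarrow> 'a) \<Rightarrow> (nat \<Rightarrow> real) \<Rightarrow> 'a \<Rightarrow> real) \<Rightarrow> ('a \<Rightarrow> real) \<Rightarrow>
   (nat \<Rightarrow> 'a) \<Rightarrow> (nat \<Rightarrow> real) \<Rightarrow> real" where
  "adaptive_loss h \<nu> n L \<kappa> D N fhat f0 x y =
     (let mhat = adaptive_index (sqdist h \<nu> n x) (penalty L \<kappa> D n) (t_const h) N
                   (\<lambda>m. fhat m x y)
      in sqdist h \<nu> n x (fhat mhat x y) f0)"

section \<open>Random design regression\<close>

text \<open>
  The integral \<open>\<integral>\<^sup>+\<close> is an inner one for functions that are not measurable, hence the following
  definition; both agree on measurable functions.
\<close>
definition outer_expectation :: "'w measure \<Rightarrow> ('w \<Rightarrow> ennreal) \<Rightarrow> ennreal" where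
  "outer_expectation M Z =
     (INF U \<in> {U \<in> borel_measurable M. \<forall>\<omega>\<in>space M. Z \<omega> \<le> U \<omega>}. \<integral>\<^sup>+\<omega>. U \<omega> \<partial>M)"

definition sample :: "nat \<Rightarrow> (nat \<Rightarrow> 'w \<Rightarrow> 'b) \<Rightarrow> 'w \<Rightarrow> nat \<Rightarrow> 'b" where
  "sample n Z \<omega> = (\<lambda>i\<in>{1..n}. Z i \<omega>)"

definition iid_sample :: "'w measure \<Rightarrow> 'b measure \<Rightarrow> 'b measure \<Rightarrow> nat \<Rightarrow> (nat \<Rightarrow> 'w \<Rightarrow> 'b) \<Rightarrow> bool" where
  "iid_sample M S \<mu> n Z \<longleftrightarrow>
     prob_space.indep_vars M (\<lambda>_. S) Z {1..n} \<and> (\<forall>i\<in>{1..n}. distr M S (Z i) = \<mu>)"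

text \<open>The library constant \<open>indep_var\<close> needs both random variables to have values in one type.\<close>
definition independent_rv ::
  "'w measure \<Rightarrow> 'b measure \<Rightarrow> ('w \<Rightarrow> 'b) \<Rightarrow> 'c measure \<Rightarrow> ('w \<Rightarrow> 'c) \<Rightarrow> bool" where
  "independent_rv M S U T V \<longleftrightarrow> U \<in> measurable M S \<and> V \<in> measurable M T \<and>
     prob_space.indep_set M {U -` A \<inter> space M |A. A \<in> sets S} {V -` B \<inter> space M |B. B \<in> sets T}"

definition sub_gaussian :: "'w measure \<Rightarrow> real \<Rightarrow> ('w \<Rightarrow> real) \<Rightarrow> bool" where
  "sub_gaussian M \<sigma>2 Z \<longleftrightarrow>
     (\<forall>t::real. (\<integral>\<^sup>+\<omega>. ennreal (exp (t * Z \<omega>)) \<partial>M) \<le> ennreal (exp (\<sigma>2 * t\<^sup>2 / 2)))"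

end

theory Submission
  imports Defs
begin

text \<open>
  Everything reduces to one exponential moment bound for a single model. Conditionally on the
  design, the least squares inequality bounds the empirical loss by a linear functional of the
  noise, which is controlled by covering each dyadic shell around a competitor in the model.
  For the norm of \<open>L\<^sup>2(\<nu>)\<close> a second, independent design sample is swapped coordinatewise with the first
  one. The exponential moment is at most a power of \<open>n\<close> with exponent proportional to \<open>\<kappa> D\<close>; taking logarithms it
  gives the risk bound, and Markov's inequality gives tails of order \<open>n\<^sup>-\<^sup>4\<close>.

  The selection rule compares the selected estimator with those of all larger indices up to \<open>N\<close>, so the
  comparison with index \<open>N\<close> yields the bound by the best trade-off between bias and penalty. If \<open>f\<^sub>0\<close> lies in the model \<open>m\<^sub>0\<close>, an
  index above \<open>m\<^sub>0\<close> is selected only if some estimator with index between \<open>m\<^sub>0\<close> and \<open>N\<close> has a loss far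
  above its penalty, an event so unlikely that a crude bound of the loss suffices there.
\<close>

section \<open>Pseudo-dimension and covers\<close>

text \<open>No supremum over a model is integrated, since it need not be measurable. Once the design
  is fixed, a sum of exponentials over cover centres dominates the fit pointwise, whichever element
  was chosen, and such a sum is measurable in the noise. The factor \<open>ln n\<close> in the
  penalty pays for this: one cover per shell is enough and no chaining over scales is needed.

  The numerical constants come from a moment bound at scale \<open>8192 * L / n\<close> with value
  \<open>n powr (7 * \<kappa> * D)\<close>. Hence the expected loss exceeds the bias term by at most
  \<open>7 * 8192 = 57344\<close> penalties, which is below \<open>k_bar\<close>, and a loss above
  \<open>11 * 8192 = 90112\<close> penalties has the stated small probability because
  \<open>11 - 7 = 4\<close>. Two fits are compared through \<open>f0\<close>, which doubles each of
  their losses, so the selection threshold must hold four such multiples; \<open>t_const\<close>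
  does.

  Division by the noise level makes level zero a separate matter: expectations get there by a limit,
  and the exceptional event is then a null set.\<close>

lemma pdim_le_pdim: "pdim_le n V (pdim n V)"
proof -
  \<comment> \<open>There is no set of \<open>n + 1\<close> indices in \<open>{1..n}\<close>, so
    \<open>n\<close> always qualifies and the least value is attained.\<close>
  have "pdim_le n V n"
    unfolding pdim_le_def
  proof (intro allI impI, goal_cases)
    case (1 I x)
    then have "card I \<le> n"
      using card_mono[of "{1..n}" I] by simp
    with 1 show ?case by simp
  qed
  then show ?thesis
    unfolding pdim_def by (rule LeastI)
qed

lemma pdim_least: "pdim_le n V t \<Longrightarrow> pdim n V \<le> t"
  unfolding pdim_def by (rule Least_le)

lemma pdim_mono:
  assumes "V \<subseteq> W"
  shows "pdim n V \<le> pdim n W"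
proof (rule pdim_least)
  have *: "pdim_le n W (pdim n W)" by (rule pdim_le_pdim)
  show "pdim_le n V (pdim n W)"
    unfolding pdim_le_def
  proof (intro allI impI, goal_cases)
    case (1 I x)
    then obtain J where "J \<subseteq> I" "\<not> (\<exists>v\<in>W. (\<forall>i\<in>J. v i > x i) \<and> (\<forall>i\<in>I - J. v i < x i))"
      using *[unfolded pdim_le_def, rule_format, of I x] by blast
    with assms show ?case by blast
  qed
qed

text \<open>Shattering \<open>V - c\<close> at level \<open>x\<close> is shattering \<open>V\<close>
  at level \<open>x + c\<close>. This is needed because the shells below are centred at a competitor
  \<open>v0\<close>.\<close>

lemma pdim_translate:
  "pdim n ((\<lambda>v. \<lambda>i\<in>{1..n}. v i - c i) ` V) \<le> pdim n V"
proof (rule pdim_least)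
  have *: "pdim_le n V (pdim n V)" by (rule pdim_le_pdim)
  show "pdim_le n ((\<lambda>v. \<lambda>i\<in>{1..n}. v i - c i) ` V) (pdim n V)"
    unfolding pdim_le_def
  proof (intro allI impI, goal_cases)
    case (1 I x)
    then obtain J where J: "J \<subseteq> I"
      "\<not> (\<exists>v\<in>V. (\<forall>i\<in>J. v i > x i + c i) \<and> (\<forall>i\<in>I - J. v i < x i + c i))"
      using *[unfolded pdim_le_def, rule_format, of I "\<lambda>i. x i + c i"] by blast
    have "I \<subseteq> {1..n}" using 1 by blast
    with J show ?case
      by (intro exI[of _ J] conjI) (auto simp: less_diff_eq diff_less_eq subset_iff)
  qed
qed

section \<open>Covers obtained from the entropy constant\<close>

lemma entropy_constant_ge_1: "entropy_constant \<kappa> \<Longrightarrow> 1 \<le> \<kappa>"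
  by (simp add: entropy_constant_def)

text \<open>Each ball of radius \<open>\<delta> / 2\<close> that meets \<open>V\<close> is replaced
  by one of its points in \<open>V\<close>, which doubles the radius. Centres inside
  \<open>V\<close> inherit whatever bounds hold on \<open>V\<close>, such as the radius of a shell
  or the sup norm of a model.\<close>

lemma entropy_constant_internal_cover:
  assumes \<kappa>: "entropy_constant \<kappa>" and n: "1 \<le> n"
    and V: "V \<subseteq> {1..n} \<rightarrow>\<^sub>E UNIV" and B: "0 \<le> B" "\<forall>v\<in>V. \<forall>i\<in>{1..n}. \<bar>v i\<bar> \<le> B"
    and D: "real (pdim n V) \<le> D" and \<delta>: "0 < \<delta>"
  shows "\<exists>C\<subseteq>V. finite C \<and> real (card C) \<le> (4 + 4 * B * sqrt (real n) / \<delta>) powr (\<kappa> * D) \<and>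
           (\<forall>v\<in>V. \<exists>c\<in>C. L2_set (\<lambda>i. v i - c i) {1..n} \<le> \<delta>)"
proof -
  have *: "\<forall>\<epsilon>>0. (\<forall>v\<in>V. \<forall>i\<in>{1..n}. \<bar>v i\<bar> \<le> B) \<and> pdim n V \<le> t \<longrightarrow>
        (\<exists>C \<subseteq> {1..n} \<rightarrow>\<^sub>E UNIV. finite C \<and>
           real (card C) \<le> (4 + 2 * B * sqrt (real n) / \<epsilon>) powr (\<kappa> * real t) \<and>
           (\<forall>v\<in>V. \<exists>c\<in>C. L2_set (\<lambda>i. v i - c i) {1..n} \<le> \<epsilon>))" for t
    using \<kappa> n V B(1) unfolding entropy_constant_def by blast
  obtain C0 where C0: "finite C0"
      "real (card C0) \<le> (4 + 2 * B * sqrt (real n) / (\<delta> / 2)) powr (\<kappa> * real (pdim n V))"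
      "\<forall>v\<in>V. \<exists>c\<in>C0. L2_set (\<lambda>i. v i - c i) {1..n} \<le> \<delta> / 2"
    using *[rule_format, of "\<delta> / 2" "pdim n V"] \<delta> B(2) by auto
  define near where "near c = {v \<in> V. L2_set (\<lambda>i. v i - c i) {1..n} \<le> \<delta> / 2}" for c
  define C where "C = (\<lambda>c. SOME v. v \<in> near c) ` {c \<in> C0. near c \<noteq> {}}"
  have pick: "(SOME v. v \<in> near c) \<in> near c" if "near c \<noteq> {}" for c
    using that by (simp add: some_in_eq)
  show ?thesis
  proof (intro exI[of _ C] conjI ballI)
    show "C \<subseteq> V" using pick by (auto simp: C_def near_def)
    show "finite C" using C0(1) by (simp add: C_def)
    have "card C \<le> card {c \<in> C0. near c \<noteq> {}}"
      unfolding C_def using C0(1) by (intro card_image_le) simp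
    also have "\<dots> \<le> card C0"
      using C0(1) by (intro card_mono) auto
    finally have "card C \<le> card C0" .
    then have "real (card C) \<le> (4 + 2 * B * sqrt (real n) / (\<delta> / 2)) powr (\<kappa> * real (pdim n V))"
      using C0(2) by linarith
    also have "\<dots> = (4 + 4 * B * sqrt (real n) / \<delta>) powr (\<kappa> * real (pdim n V))"
      by (simp add: mult.assoc)
    also have "\<dots> \<le> (4 + 4 * B * sqrt (real n) / \<delta>) powr (\<kappa> * D)"
    proof (rule powr_mono)
      show "\<kappa> * real (pdim n V) \<le> \<kappa> * D"
        using D entropy_constant_ge_1[OF \<kappa>] by (intro mult_left_mono) auto
      have "0 \<le> 4 * B * sqrt (real n) / \<delta>" using B(1) \<delta> by simp
      then show "1 \<le> 4 + 4 * B * sqrt (real n) / \<delta>" by linarith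
    qed
    finally show "real (card C) \<le> (4 + 4 * B * sqrt (real n) / \<delta>) powr (\<kappa> * D)" .
  next
    fix v assume v: "v \<in> V"
    then obtain c where c: "c \<in> C0" "L2_set (\<lambda>i. v i - c i) {1..n} \<le> \<delta> / 2"
      using C0(3) by blast
    define w where "w = (SOME v. v \<in> near c)"
    have "near c \<noteq> {}" using c v by (auto simp: near_def)
    then have w: "w \<in> C" "L2_set (\<lambda>i. w i - c i) {1..n} \<le> \<delta> / 2"
      using c(1) pick[of c] by (auto simp: C_def w_def near_def)
    have "L2_set (\<lambda>i. v i - w i) {1..n} = L2_set (\<lambda>i. (v i - c i) + - (w i - c i)) {1..n}"
      by simp
    also have "\<dots> \<le> L2_set (\<lambda>i. v i - c i) {1..n} + L2_set (\<lambda>i. - (w i - c i)) {1..n}"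
      by (rule L2_set_triangle_ineq)
    also have "L2_set (\<lambda>i. - (w i - c i)) {1..n} = L2_set (\<lambda>i. w i - c i) {1..n}"
      unfolding L2_set_def power2_minus ..
    finally show "\<exists>c\<in>C. L2_set (\<lambda>i. v i - c i) {1..n} \<le> \<delta>"
      using w c(2) by (intro bexI[of _ w]) auto
  qed
qed

lemma L2_set_le_iff: "0 \<le> r \<Longrightarrow> L2_set f A \<le> r \<longleftrightarrow> (\<Sum>i\<in>A. (f i)\<^sup>2) \<le> r\<^sup>2"
  unfolding L2_set_def by (metis real_sqrt_le_iff real_sqrt_unique)

lemma sub_gaussian_mgf_linear:
  fixes \<mu> :: "real measure"
  assumes "prob_space \<mu>" and sets: "sets \<mu> = sets borel"
    and sg: "sub_gaussian \<mu> (s\<^sup>2) (\<lambda>z. z)" and fin: "finite I"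
  shows "(\<integral>\<^sup>+e. ennreal (exp (\<Sum>i\<in>I. a i * e i)) \<partial>PiM I (\<lambda>_. \<mu>))
           \<le> ennreal (exp (s\<^sup>2 * (\<Sum>i\<in>I. (a i)\<^sup>2) / 2))"
proof -
  interpret prob_space \<mu> by fact
  interpret product_sigma_finite "\<lambda>_. \<mu>" ..
  have [measurable_cong]: "sets \<mu> = sets borel" by (rule sets)
  have "(\<integral>\<^sup>+e. ennreal (exp (\<Sum>i\<in>I. a i * e i)) \<partial>PiM I (\<lambda>_. \<mu>))
      = (\<integral>\<^sup>+e. (\<Prod>i\<in>I. ennreal (exp (a i * e i))) \<partial>PiM I (\<lambda>_. \<mu>))"
    using fin by (simp add: exp_sum prod_ennreal)
  also have "\<dots> = (\<Prod>i\<in>I. \<integral>\<^sup>+z. ennreal (exp (a i * z)) \<partial>\<mu>)"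
    by (rule product_nn_integral_prod[OF fin]) measurable
  also have "\<dots> \<le> (\<Prod>i\<in>I. ennreal (exp (s\<^sup>2 * (a i)\<^sup>2 / 2)))"
    using sg by (intro prod_mono_ennreal) (auto simp: sub_gaussian_def)
  also have "\<dots> = ennreal (exp (s\<^sup>2 * (\<Sum>i\<in>I. (a i)\<^sup>2) / 2))"
    using fin by (simp add: prod_ennreal exp_sum sum_distrib_left sum_divide_distrib)
  finally show ?thesis .
qed

section \<open>Exponential moments for a fixed design\<close>

text \<open>Stands in for the Cauchy-Schwarz inequality: the two summands may be dependent, and each
  exponential can then be integrated separately at twice the exponent.\<close>

lemma exp_add_le: "exp (a + b) \<le> exp (2 * a) + exp (2 * b)" for a b :: real
proof -
  have "a + b \<le> max (2 * a) (2 * b)" by simp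
  then have "exp (a + b) \<le> exp (max (2 * a) (2 * b))" by simp
  also have "\<dots> \<le> exp (2 * a) + exp (2 * b)" by (simp add: max_def)
  finally show ?thesis .
qed

text \<open>The average of the absolute values is at most the largest one, and the exponential of
  that occurs, for one of the two signs, among the terms on the right. It controls the error of
  replacing a fit by a cover centre.\<close>

lemma exp_sum_abs_le:
  fixes e :: "nat \<Rightarrow> real"
  assumes n: "1 \<le> n" and b: "0 \<le> b"
  shows "exp (b / real n * (\<Sum>i=1..n. \<bar>e i\<bar>)) \<le> (\<Sum>i=1..n. exp (b * e i) + exp (- b * e i))"
proof -
  obtain k where k: "k \<in> {1..n}" "\<And>i. i \<in> {1..n} \<Longrightarrow> \<bar>e i\<bar> \<le> \<bar>e k\<bar>"
  proof -
    have "Max ((\<lambda>i. \<bar>e i\<bar>) ` {1..n}) \<in> (\<lambda>i. \<bar>e i\<bar>) ` {1..n}"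
      using n by (intro Max_in) auto
    then obtain k where "k \<in> {1..n}" "Max ((\<lambda>i. \<bar>e i\<bar>) ` {1..n}) = \<bar>e k\<bar>" by auto
    then show thesis using that[of k] by (metis Max_ge finite_atLeastAtMost finite_imageI imageI)
  qed
  have "(\<Sum>i=1..n. \<bar>e i\<bar>) \<le> real n * \<bar>e k\<bar>"
    using sum_bounded_above[of "{1..n}" "\<lambda>i. \<bar>e i\<bar>" "\<bar>e k\<bar>"] k(2) by simp
  then have "b / real n * (\<Sum>i=1..n. \<bar>e i\<bar>) \<le> b / real n * (real n * \<bar>e k\<bar>)"
    using b by (intro mult_left_mono) auto
  also have "\<dots> = b * \<bar>e k\<bar>" using n by simp
  finally have "exp (b / real n * (\<Sum>i=1..n. \<bar>e i\<bar>)) \<le> exp (b * \<bar>e k\<bar>)" by simp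
  also have "\<dots> \<le> exp (b * e k) + exp (- b * e k)" by (simp add: abs_if)
  also have "\<dots> \<le> (\<Sum>i=1..n. exp (b * e i) + exp (- b * e i))"
    using k(1) by (intro member_le_sum) (auto intro: add_nonneg_nonneg)
  finally show ?thesis .
qed

lemma sub_gaussian_mgf_coordinate:
  fixes \<mu> :: "real measure"
  assumes "prob_space \<mu>" "sets \<mu> = sets borel" "sub_gaussian \<mu> (s\<^sup>2) (\<lambda>z. z)" "finite I" "i \<in> I"
  shows "(\<integral>\<^sup>+e. ennreal (exp (a * e i)) \<partial>PiM I (\<lambda>_. \<mu>)) \<le> ennreal (exp (s\<^sup>2 * a\<^sup>2 / 2))"
  using sub_gaussian_mgf_linear[OF assms(1-4), of "\<lambda>k. if k = i then a else 0"] assms(4,5)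
  by (simp add: if_distrib[of "\<lambda>t. t * _"] if_distrib[of "\<lambda>t. t\<^sup>2"] sum.delta cong: if_cong)

text \<open>This is the weight of shell \<open>j\<close> after integration; a geometric majorant
  makes the sum over all shells finite. Bernoulli's inequality \<open>1 + 3 * j \<le> 4 ^ j\<close>
  makes the exponent linear in \<open>j\<close>.\<close>

lemma exp_1_minus_le: "exp (1 - 4 ^ j / 2) \<le> 3 * (1 / 2 :: real) ^ j"
proof -
  have "1 + real j * 3 \<le> (1 + 3) ^ j"
    by (rule Bernoulli_inequality) simp
  then have "exp (1 - 4 ^ j / 2) \<le> exp (1 + real j * (- 1) :: real)"
    by simp
  also have "\<dots> = exp 1 * exp (- 1) ^ j"
    by (simp add: exp_diff exp_minus exp_of_nat_mult[of j 1, simplified] field_simps power_inverse)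
  also have "\<dots> \<le> 3 * (1 / 2) ^ j"
  proof (intro mult_mono power_mono)
    show "exp (- 1) \<le> (1 / 2 :: real)"
      using exp_ge_add_one_self[of 1] by (simp add: exp_minus field_simps)
  qed (use exp_le in auto)
  finally show ?thesis .
qed

text \<open>A ball of radius \<open>R\<close> covered at radius \<open>R / n\<close> gives this
  base, free of \<open>R\<close>; the cubic bound turns cover sizes into powers of
  \<open>n\<close>.\<close>

lemma cover_size_le:
  assumes "7 \<le> n" shows "4 + 4 * sqrt (real n) * real n \<le> real n ^ 3"
proof -
  have "sqrt (real n) \<le> real n" using assms by (intro real_le_lsqrt) (auto simp: power2_eq_square)
  then have "4 * sqrt (real n) * real n \<le> 4 * (real n * real n)"
    using assms by (simp add: mult_right_mono)
  moreover have "7 * (real n * real n) \<le> real n ^ 3"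
    using assms by (simp add: power3_eq_cube mult_right_mono)
  moreover have "49 \<le> real n * real n" using assms mult_mono[of 7 "real n" 7 "real n"] by simp
  ultimately show ?thesis by linarith
qed

text \<open>
  Peeling over the dyadic shells \<open>64 s 2\<^sup>j\<^sup>-\<^sup>1 < |w| \<le> 64 s 2\<^sup>j\<close>, each of which is covered at
  \<open>1 / n\<close> times its radius.
\<close>
lemma noise_process_mgf:
  fixes \<mu> :: "real measure" and w :: "(nat \<Rightarrow> real) \<Rightarrow> nat \<Rightarrow> real"
  assumes \<kappa>: "entropy_constant \<kappa>" and n: "7 \<le> n"
    and \<mu>: "prob_space \<mu>" "sets \<mu> = sets borel" "sub_gaussian \<mu> (s\<^sup>2) (\<lambda>z. z)" and s: "0 < s"
    and V: "V \<subseteq> {1..n} \<rightarrow>\<^sub>E UNIV" and D: "real (pdim n V) \<le> D" "1 \<le> D"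
    and w: "\<And>e. e \<in> space (PiM {1..n} (\<lambda>_. \<mu>)) \<Longrightarrow> w e \<in> V"
  shows "(\<integral>\<^sup>+e. ennreal (exp (1 / (256 * s\<^sup>2) *
            (2 * (\<Sum>i=1..n. e i * (w e i - v0 i)) - (\<Sum>i=1..n. (w e i - v0 i)\<^sup>2) / 4)))
          \<partial>PiM {1..n} (\<lambda>_. \<mu>)) \<le> ennreal (real n powr (6 * \<kappa> * D))"
proof -
  \<comment> \<open>With \<open>m = 1 / (256 * s^2)\<close> this radius gives
    \<open>4 * m * R j = 2 ^ j / s\<close>. A shell then contributes \<open>exp (4 ^ j / 2)\<close>
    from the noise and \<open>exp (1 - 4 ^ j)\<close> from the quadratic term, and the product is
    summable.\<close>
  define R :: "nat \<Rightarrow> real" where "R j = 64 * s * 2 ^ j" for j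
  define m where "m = 1 / (256 * s\<^sup>2)"
  \<comment> \<open>Whole balls are covered; that a point lies outside the previous ball is used
    only for the size of the quadratic term.\<close>
  define W where "W j = (\<lambda>v. \<lambda>i\<in>{1..n}. v i - v0 i) ` {v \<in> V. (\<Sum>i=1..n. (v i - v0 i)\<^sup>2) \<le> (R j)\<^sup>2}" for j
  have R: "0 < R j" for j using s by (simp add: R_def)
  have R2: "(R j)\<^sup>2 = 4096 * s\<^sup>2 * 4 ^ j" for j
    by (simp add: R_def power_mult_distrib power_even_eq[symmetric] power_mult)
  have m: "0 < m" using s by (simp add: m_def)
  have W_norm: "(\<Sum>i=1..n. (c i)\<^sup>2) \<le> (R j)\<^sup>2" if "c \<in> W j" for c j
    using that by (auto simp: W_def)
  have "\<exists>C. C \<subseteq> W j \<and> finite C \<and> real (card C) \<le> real n powr (3 * \<kappa> * D) \<and>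
          (\<forall>v\<in>W j. \<exists>c\<in>C. L2_set (\<lambda>i. v i - c i) {1..n} \<le> R j / real n)" for j
  proof -
    have bound: "\<forall>v\<in>W j. \<forall>i\<in>{1..n}. \<bar>v i\<bar> \<le> R j"
    proof (intro ballI)
      fix v i assume that: "v \<in> W j" "i \<in> {1..n}"
      have "(v i)\<^sup>2 \<le> (\<Sum>i=1..n. (v i)\<^sup>2)"
        using that(2) by (intro member_le_sum) auto
      also note W_norm[OF that(1)]
      finally show "\<bar>v i\<bar> \<le> R j" using R[of j] abs_le_square_iff[of "v i" "R j"] by simp
    qed
    have pd: "real (pdim n (W j)) \<le> D"
    proof -
      have "pdim n (W j) \<le> pdim n V"
        unfolding W_def by (rule order_trans[OF pdim_translate pdim_mono]) auto
      with D(1) show ?thesis by linarith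
    qed
    have ext: "W j \<subseteq> {1..n} \<rightarrow>\<^sub>E UNIV" by (auto simp: W_def)
    have pos: "1 \<le> n" "0 \<le> R j" "0 < R j / real n" using n R[of j] by auto
    obtain C where C: "C \<subseteq> W j" "finite C"
      "real (card C) \<le> (4 + 4 * R j * sqrt (real n) / (R j / real n)) powr (\<kappa> * D)"
      "\<And>v. v \<in> W j \<Longrightarrow> \<exists>c\<in>C. L2_set (\<lambda>i. v i - c i) {1..n} \<le> R j / real n"
      using entropy_constant_internal_cover[OF \<kappa> pos(1) ext pos(2) bound pd pos(3)] by blast
    have "4 + 4 * R j * sqrt (real n) / (R j / real n) = 4 + 4 * sqrt (real n) * real n"
      using R[of j] by simp
    with C(3) have "real (card C) \<le> (4 + 4 * sqrt (real n) * real n) powr (\<kappa> * D)" by simp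
    also have "\<dots> \<le> (real n ^ 3) powr (\<kappa> * D)"
      using cover_size_le[OF n] D(2) entropy_constant_ge_1[OF \<kappa>] by (intro powr_mono2) auto
    also have "\<dots> = real n powr (3 * \<kappa> * D)"
      using n by (simp add: powr_powr powr_numeral[symmetric] mult.assoc del: powr_numeral)
    finally show ?thesis using C by blast
  qed
  then have "\<forall>j. \<exists>C. C \<subseteq> W j \<and> finite C \<and> real (card C) \<le> real n powr (3 * \<kappa> * D) \<and>
          (\<forall>v\<in>W j. \<exists>c\<in>C. L2_set (\<lambda>i. v i - c i) {1..n} \<le> R j / real n)" by blast
  from choice[OF this] obtain C where "\<forall>j. C j \<subseteq> W j \<and> finite (C j) \<and>
      real (card (C j)) \<le> real n powr (3 * \<kappa> * D) \<and>
      (\<forall>v\<in>W j. \<exists>c\<in>C j. L2_set (\<lambda>i. v i - c i) {1..n} \<le> R j / real n)" ..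
  then have C: "\<And>j. C j \<subseteq> W j" "\<And>j. finite (C j)"
      "\<And>j. real (card (C j)) \<le> real n powr (3 * \<kappa> * D)"
      "\<And>j v. v \<in> W j \<Longrightarrow> \<exists>c\<in>C j. L2_set (\<lambda>i. v i - c i) {1..n} \<le> R j / real n"
    by blast+
  \<comment> \<open>The linear part at a centre and the approximation error are already separated by
    \<open>exp_add_le\<close>, hence the factor 4 where the exponent itself has 2.\<close>
  define h where "h j c e = exp (\<Sum>i=1..n. (4 * m * c i) * e i)
      + (\<Sum>i=1..n. exp (4 * m * R j * e i) + exp (- (4 * m * R j) * e i))" for j c and e :: "nat \<Rightarrow> real"
  \<comment> \<open>Subtracting \<open>(R 0)^2\<close> gives weight 1 to the innermost ball, where
    the squared norm has no lower bound but 0.\<close>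
  define q where "q j = exp (- m * ((R j)\<^sup>2 - (R 0)\<^sup>2) / 16)" for j
  have h_nonneg: "0 \<le> h j c e" for j c e
    unfolding h_def by (intro add_nonneg_nonneg sum_nonneg) auto
  have pointwise: "ennreal (exp (m * (2 * (\<Sum>i=1..n. e i * (w e i - v0 i)) - (\<Sum>i=1..n. (w e i - v0 i)\<^sup>2) / 4)))
      \<le> (\<Sum>j. \<Sum>c\<in>C j. ennreal (q j * h j c e))"
    if e: "e \<in> space (PiM {1..n} (\<lambda>_. \<mu>))" for e
  proof -
    define u where "u i = w e i - v0 i" for i
    define U where "U = (\<Sum>i=1..n. (u i)\<^sup>2)"
    have ex: "\<exists>j. U \<le> (R j)\<^sup>2"
    proof -
      obtain j where "U / (4096 * s\<^sup>2) < 4 ^ j" using real_arch_pow[of 4 "U / (4096 * s\<^sup>2)"] by auto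
      then show ?thesis using s by (intro exI[of _ j]) (simp add: R2 field_simps)
    qed
    define j where "j = (LEAST j. U \<le> (R j)\<^sup>2)"
    have j: "U \<le> (R j)\<^sup>2" "\<And>i. i < j \<Longrightarrow> \<not> U \<le> (R i)\<^sup>2"
      unfolding j_def by (rule LeastI_ex[OF ex], rule not_less_Least)
    have lin: "2 * a - U / 4 \<le> 2 * (b + c) - y / 4" if "a \<le> b + c" "y \<le> U" for a b c y U :: real
      using that by simp
    \<comment> \<open>By minimality of \<open>j\<close> the point lies outside ball
      \<open>j - 1\<close>, whose squared radius is a quarter of that of ball
      \<open>j\<close>.\<close>
    have lower: "((R j)\<^sup>2 - (R 0)\<^sup>2) / 4 \<le> U"
    proof (cases j)
      case 0 then show ?thesis by (simp add: U_def sum_nonneg)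
    next
      case (Suc i)
      then have "(R i)\<^sup>2 < U" using j(2)[of i] by linarith
      moreover have "(R j)\<^sup>2 = 4 * (R i)\<^sup>2" unfolding R2 Suc by simp
      ultimately show ?thesis by (simp add: field_simps) (smt (verit) zero_le_power2)
    qed
    have "(\<lambda>i\<in>{1..n}. u i) \<in> W j"
      using w[OF e] j(1) by (auto simp: W_def U_def u_def)
    then obtain c where c: "c \<in> C j" "L2_set (\<lambda>i. (\<lambda>i\<in>{1..n}. u i) i - c i) {1..n} \<le> R j / real n"
      using C(4) by blast
    have "L2_set (\<lambda>i. u i - c i) {1..n} = L2_set (\<lambda>i. (\<lambda>i\<in>{1..n}. u i) i - c i) {1..n}"
      by (intro L2_set_cong) auto
    with c(2) have c2: "L2_set (\<lambda>i. u i - c i) {1..n} \<le> R j / real n" by simp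
    have dev: "\<bar>u i - c i\<bar> \<le> R j / real n" if "i \<in> {1..n}" for i
    proof -
      have "\<bar>u i - c i\<bar> \<le> L2_set (\<lambda>i. u i - c i) {1..n}"
        using member_le_L2_set[of "{1..n}" i "\<lambda>i. \<bar>u i - c i\<bar>"] that
        by (simp add: L2_set_def)
      with c2 show ?thesis by linarith
    qed
    \<comment> \<open>Only the sup norm of \<open>u - c\<close> enters, so that the noise appears as
      the average of its absolute values, with factor \<open>R j\<close>.\<close>
    have "(\<Sum>i=1..n. e i * (u i - c i)) \<le> (\<Sum>i=1..n. \<bar>e i\<bar> * (R j / real n))"
    proof (intro sum_mono)
      fix i assume i: "i \<in> {1..n}"
      have "e i * (u i - c i) \<le> \<bar>e i\<bar> * \<bar>u i - c i\<bar>" by (metis abs_ge_self abs_mult)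
      also have "\<dots> \<le> \<bar>e i\<bar> * (R j / real n)" using dev[OF i] by (intro mult_left_mono) auto
      finally show "e i * (u i - c i) \<le> \<bar>e i\<bar> * (R j / real n)" .
    qed
    then have "(\<Sum>i=1..n. e i * u i) \<le> (\<Sum>i=1..n. e i * c i) + R j / real n * (\<Sum>i=1..n. \<bar>e i\<bar>)"
      by (simp add: right_diff_distrib sum_subtractf sum_distrib_left sum_divide_distrib mult_ac)
    then have "2 * (\<Sum>i=1..n. e i * u i) - U / 4
        \<le> 2 * ((\<Sum>i=1..n. e i * c i) + R j / real n * (\<Sum>i=1..n. \<bar>e i\<bar>)) - ((R j)\<^sup>2 - (R 0)\<^sup>2) / 4 / 4"
      by (rule lin[OF _ lower])
    then have "m * (2 * (\<Sum>i=1..n. e i * u i) - U / 4)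
        \<le> m * (2 * ((\<Sum>i=1..n. e i * c i) + R j / real n * (\<Sum>i=1..n. \<bar>e i\<bar>)) - ((R j)\<^sup>2 - (R 0)\<^sup>2) / 4 / 4)"
      using m by (intro mult_left_mono) auto
    also have "\<dots> = (2 * m * (\<Sum>i=1..n. e i * c i) + 2 * m * R j / real n * (\<Sum>i=1..n. \<bar>e i\<bar>))
         + (- m * ((R j)\<^sup>2 - (R 0)\<^sup>2) / 16)"
      by (simp add: field_simps)
    finally have "exp (m * (2 * (\<Sum>i=1..n. e i * u i) - U / 4))
       \<le> exp (2 * m * (\<Sum>i=1..n. e i * c i) + 2 * m * R j / real n * (\<Sum>i=1..n. \<bar>e i\<bar>)) * q j"
      by (simp add: q_def flip: exp_add)
    also have "\<dots> \<le> h j c e * q j"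
    proof (rule mult_right_mono)
      have "exp (2 * m * (\<Sum>i=1..n. e i * c i) + 2 * m * R j / real n * (\<Sum>i=1..n. \<bar>e i\<bar>))
         \<le> exp (2 * (2 * m * (\<Sum>i=1..n. e i * c i)))
           + exp (2 * (2 * m * R j / real n * (\<Sum>i=1..n. \<bar>e i\<bar>)))"
        by (rule exp_add_le)
      also have "2 * (2 * m * (\<Sum>i=1..n. e i * c i)) = (\<Sum>i=1..n. (4 * m * c i) * e i)"
        by (simp add: sum_distrib_left mult_ac)
      also have "2 * (2 * m * R j / real n * (\<Sum>i=1..n. \<bar>e i\<bar>)) = (4 * m * R j) / real n * (\<Sum>i=1..n. \<bar>e i\<bar>)"
        by simp
      also have "exp \<dots> \<le> (\<Sum>i=1..n. exp (4 * m * R j * e i) + exp (- (4 * m * R j) * e i))"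
        using n m R[of j] by (intro exp_sum_abs_le) auto
      finally show "exp (2 * m * (\<Sum>i=1..n. e i * c i) + 2 * m * R j / real n * (\<Sum>i=1..n. \<bar>e i\<bar>)) \<le> h j c e"
        by (simp add: h_def)
    qed (simp add: q_def)
    finally have "ennreal (exp (m * (2 * (\<Sum>i=1..n. e i * u i) - U / 4))) \<le> ennreal (q j * h j c e)"
      by (simp add: mult.commute ennreal_leI)
    also have "\<dots> \<le> (\<Sum>c\<in>C j. ennreal (q j * h j c e))"
      using c(1) C(2) by (intro member_le_sum) auto
    also have "\<dots> \<le> (\<Sum>j. \<Sum>c\<in>C j. ennreal (q j * h j c e))"
      using sum_le_suminf[OF summableI, of "{j}" "\<lambda>j. \<Sum>c\<in>C j. ennreal (q j * h j c e)"] by simp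
    finally show ?thesis by (simp add: u_def U_def)
  qed
  have [measurable_cong]: "sets \<mu> = sets borel" by (rule \<mu>(2))
  have [measurable]: "h j c \<in> borel_measurable (PiM {1..n} (\<lambda>_. \<mu>))" for j c
    unfolding h_def by measurable
  let ?E = "\<lambda>j. exp (s\<^sup>2 * (4 * m * R j)\<^sup>2 / 2)"
  have int_h: "(\<integral>\<^sup>+e. ennreal (h j c e) \<partial>PiM {1..n} (\<lambda>_. \<mu>)) \<le> ennreal ((2 * real n + 1) * ?E j)"
    if "c \<in> C j" for j c
  proof -
    have "(\<integral>\<^sup>+e. ennreal (h j c e) \<partial>PiM {1..n} (\<lambda>_. \<mu>))
       = (\<integral>\<^sup>+e. ennreal (exp (\<Sum>i=1..n. (4 * m * c i) * e i))
          + (\<Sum>i=1..n. ennreal (exp (4 * m * R j * e i)) + ennreal (exp (- (4 * m * R j) * e i)))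
          \<partial>PiM {1..n} (\<lambda>_. \<mu>))"
      by (simp add: h_def ennreal_plus sum_nonneg add_nonneg_nonneg flip: sum_ennreal)
    also have "\<dots> = (\<integral>\<^sup>+e. ennreal (exp (\<Sum>i=1..n. (4 * m * c i) * e i)) \<partial>PiM {1..n} (\<lambda>_. \<mu>))
          + (\<Sum>i=1..n. (\<integral>\<^sup>+e. ennreal (exp (4 * m * R j * e i)) \<partial>PiM {1..n} (\<lambda>_. \<mu>))
             + (\<integral>\<^sup>+e. ennreal (exp (- (4 * m * R j) * e i)) \<partial>PiM {1..n} (\<lambda>_. \<mu>)))"
      by (subst nn_integral_add, measurable) (simp_all add: nn_integral_sum nn_integral_add)
    also have "\<dots> \<le> ennreal (?E j) + (\<Sum>i=1..n. ennreal (?E j) + ennreal (?E j))"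
    proof (intro add_mono sum_mono)
      have "(\<Sum>i=1..n. (4 * m * c i)\<^sup>2) = (4 * m)\<^sup>2 * (\<Sum>i=1..n. (c i)\<^sup>2)"
        by (simp only: power_mult_distrib[of "4 * m"] sum_distrib_left)
      also have "\<dots> \<le> (4 * m)\<^sup>2 * (R j)\<^sup>2"
        using W_norm[of c j] that C(1)[of j] by (intro mult_left_mono) auto
      also have "\<dots> = (4 * m * R j)\<^sup>2" by (simp only: power_mult_distrib[of "4 * m"])
      finally have "s\<^sup>2 * (\<Sum>i=1..n. (4 * m * c i)\<^sup>2) / 2 \<le> s\<^sup>2 * (4 * m * R j)\<^sup>2 / 2"
        by (intro divide_right_mono mult_left_mono) auto
      then have "ennreal (exp (s\<^sup>2 * (\<Sum>i=1..n. (4 * m * c i)\<^sup>2) / 2)) \<le> ennreal (?E j)"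
        by (intro ennreal_leI) simp
      then show "(\<integral>\<^sup>+e. ennreal (exp (\<Sum>i=1..n. (4 * m * c i) * e i)) \<partial>PiM {1..n} (\<lambda>_. \<mu>)) \<le> ennreal (?E j)"
        by (intro order_trans[OF sub_gaussian_mgf_linear[OF \<mu>]]) auto
    next
      fix i assume i: "i \<in> {1..n}"
      show "(\<integral>\<^sup>+e. ennreal (exp (4 * m * R j * e i)) \<partial>PiM {1..n} (\<lambda>_. \<mu>)) \<le> ennreal (?E j)"
        by (rule sub_gaussian_mgf_coordinate[OF \<mu> _ i]) simp
      show "(\<integral>\<^sup>+e. ennreal (exp (- (4 * m * R j) * e i)) \<partial>PiM {1..n} (\<lambda>_. \<mu>)) \<le> ennreal (?E j)"
        using sub_gaussian_mgf_coordinate[OF \<mu> _ i, of "- (4 * m * R j)"] by simp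
    qed
    also have "\<dots> = ennreal (?E j + (\<Sum>i=1..n. ?E j + ?E j))"
      by (simp add: sum_ennreal sum_nonneg flip: ennreal_plus del: sum_constant)
    also have "?E j + (\<Sum>i=1..n. ?E j + ?E j) = (2 * real n + 1) * ?E j"
      by (simp add: algebra_simps)
    finally show ?thesis .
  qed
  have qE: "q j * ?E j \<le> 3 * (1 / 2) ^ j" for j
  proof -
    have *: "- m * ((R j)\<^sup>2 - (R 0)\<^sup>2) / 16 = 1 - 4 ^ j"
      unfolding R2 m_def using s by (simp add: field_simps)
    have **: "s\<^sup>2 * (4 * m * R j)\<^sup>2 / 2 = 4 ^ j / 2"
      unfolding power_mult_distrib[of "4 * m"] R2 unfolding m_def using s
      by (simp add: field_simps power2_eq_square)
    have "q j * ?E j = exp (1 - 4 ^ j / 2)"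
      unfolding q_def * ** by (simp flip: exp_add)
    then show ?thesis using exp_1_minus_le[of j] by simp
  qed
  let ?N = "real n powr (3 * \<kappa> * D)"
  have int_shell: "(\<integral>\<^sup>+e. (\<Sum>c\<in>C j. ennreal (q j * h j c e)) \<partial>PiM {1..n} (\<lambda>_. \<mu>))
      \<le> ennreal (?N * (2 * real n + 1) * 3 * (1 / 2) ^ j)" for j
  proof -
    have "(\<integral>\<^sup>+e. (\<Sum>c\<in>C j. ennreal (q j * h j c e)) \<partial>PiM {1..n} (\<lambda>_. \<mu>))
       = (\<integral>\<^sup>+e. (\<Sum>c\<in>C j. ennreal (q j) * ennreal (h j c e)) \<partial>PiM {1..n} (\<lambda>_. \<mu>))"
      by (simp add: ennreal_mult h_nonneg q_def)
    also have "\<dots> = (\<Sum>c\<in>C j. \<integral>\<^sup>+e. ennreal (q j) * ennreal (h j c e) \<partial>PiM {1..n} (\<lambda>_. \<mu>))"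
      by (rule nn_integral_sum) measurable
    also have "\<dots> = (\<Sum>c\<in>C j. ennreal (q j) * (\<integral>\<^sup>+e. ennreal (h j c e) \<partial>PiM {1..n} (\<lambda>_. \<mu>)))"
      by (intro sum.cong refl nn_integral_cmult) measurable
    also have "\<dots> \<le> (\<Sum>c\<in>C j. ennreal (q j) * ennreal ((2 * real n + 1) * ?E j))"
      using int_h by (intro sum_mono mult_left_mono) auto
    also have "\<dots> = ennreal (real (card (C j)) * ((2 * real n + 1) * (q j * ?E j)))"
      by (simp add: q_def ennreal_mult ennreal_of_nat_eq_real_of_nat mult_ac)
    also have "\<dots> \<le> ennreal (?N * ((2 * real n + 1) * (3 * (1 / 2) ^ j)))"
      by (rule ennreal_leI, rule mult_mono[OF C(3) mult_left_mono[OF qE]]) (auto simp: q_def)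
    finally show ?thesis by (simp add: mult_ac)
  qed
  have "(\<integral>\<^sup>+e. ennreal (exp (m * (2 * (\<Sum>i=1..n. e i * (w e i - v0 i)) - (\<Sum>i=1..n. (w e i - v0 i)\<^sup>2) / 4)))
          \<partial>PiM {1..n} (\<lambda>_. \<mu>))
     \<le> (\<integral>\<^sup>+e. (\<Sum>j. \<Sum>c\<in>C j. ennreal (q j * h j c e)) \<partial>PiM {1..n} (\<lambda>_. \<mu>))"
    by (rule nn_integral_mono) (rule pointwise)
  also have "\<dots> = (\<Sum>j. \<integral>\<^sup>+e. (\<Sum>c\<in>C j. ennreal (q j * h j c e)) \<partial>PiM {1..n} (\<lambda>_. \<mu>))"
    by (rule nn_integral_suminf) measurable
  also have "\<dots> \<le> (\<Sum>j. ennreal (?N * (2 * real n + 1) * 3 * (1 / 2) ^ j))"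
    by (intro suminf_le int_shell) auto
  also have "\<dots> = ennreal (?N * (2 * real n + 1) * 3 * 2)"
  proof (rule suminf_ennreal_eq)
    have "(\<lambda>j. (1 / 2 :: real) ^ j) sums 2" using geometric_sums[of "1 / 2 :: real"] by simp
    then show "(\<lambda>j. ?N * (2 * real n + 1) * 3 * (1 / 2) ^ j) sums (?N * (2 * real n + 1) * 3 * 2)"
      by (rule sums_mult)
  qed simp
  \<comment> \<open>Summing the shells costs \<open>6 * (2 * n + 1)\<close>, which for
    \<open>n \<ge> 7\<close> is below \<open>n ^ 3\<close> and hence below a second copy of the
    bound on the cover size.\<close>
  also have "\<dots> \<le> ennreal (?N * real n powr (3 * \<kappa> * D))"
  proof (rule ennreal_leI)
    have "(2 * real n + 1) * 6 \<le> real n ^ 3"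
    proof -
      have "49 * real n \<le> (real n * real n) * real n"
        using n mult_mono[of 7 "real n" 7 "real n"] by (intro mult_right_mono) auto
      moreover have "7 \<le> real n" using n by simp
      ultimately show ?thesis unfolding power3_eq_cube by argo
    qed
    also have "\<dots> = real n powr 3" using n by simp
    also have "\<dots> \<le> real n powr (3 * \<kappa> * D)"
      using n D(2) entropy_constant_ge_1[OF \<kappa>] mult_mono[of 1 \<kappa> 1 D] by (intro powr_mono) auto
    finally have "?N * ((2 * real n + 1) * 6) \<le> ?N * real n powr (3 * \<kappa> * D)"
      by (intro mult_left_mono) auto
    then show "?N * (2 * real n + 1) * 3 * 2 \<le> ?N * real n powr (3 * \<kappa> * D)"
      by (simp only: mult.assoc numeral_times_numeral) simp
  qed
  also have "?N * real n powr (3 * \<kappa> * D) = real n powr (6 * \<kappa> * D)"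
    by (simp add: mult_ac flip: powr_add)
  finally show ?thesis by (simp add: m_def)
qed

text \<open>Here \<open>v\<close> is the fit, \<open>w\<close> a competitor and
  \<open>\<theta>\<close> the truth. The negative multiple of the squared distance from
  \<open>v\<close> to \<open>w\<close> is the drift that peeling needs. Coordinatewise, the deficit
  is the perfect square \<open>(v + w - 2 * \<theta>)^2 / 2\<close>.\<close>

lemma least_squares_basic_inequality:
  fixes e v w \<theta> :: "'i \<Rightarrow> real"
  assumes "(\<Sum>i\<in>I. (\<theta> i + e i - v i)\<^sup>2) \<le> (\<Sum>i\<in>I. (\<theta> i + e i - w i)\<^sup>2)"
  shows "(\<Sum>i\<in>I. (v i - \<theta> i)\<^sup>2) - 3 * (\<Sum>i\<in>I. (w i - \<theta> i)\<^sup>2)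
     \<le> 2 * (2 * (\<Sum>i\<in>I. e i * (v i - w i)) - (\<Sum>i\<in>I. (v i - w i)\<^sup>2) / 4)"
proof -
  have "(v i - \<theta> i)\<^sup>2 - 3 * (w i - \<theta> i)\<^sup>2 - 4 * (e i * (v i - w i)) + (v i - w i)\<^sup>2 / 2
      \<le> 2 * ((\<theta> i + e i - v i)\<^sup>2 - (\<theta> i + e i - w i)\<^sup>2)" for i
  proof -
    have "2 * ((\<theta> i + e i - v i)\<^sup>2 - (\<theta> i + e i - w i)\<^sup>2) -
        ((v i - \<theta> i)\<^sup>2 - 3 * (w i - \<theta> i)\<^sup>2 - 4 * (e i * (v i - w i)) + (v i - w i)\<^sup>2 / 2)
      = (v i + w i - 2 * \<theta> i)\<^sup>2 / 2"
      by (simp add: field_simps power2_eq_square)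
    then show ?thesis using zero_le_power2[of "v i + w i - 2 * \<theta> i"] by linarith
  qed
  then have "(\<Sum>i\<in>I. (v i - \<theta> i)\<^sup>2 - 3 * (w i - \<theta> i)\<^sup>2 - 4 * (e i * (v i - w i)) + (v i - w i)\<^sup>2 / 2)
      \<le> (\<Sum>i\<in>I. 2 * ((\<theta> i + e i - v i)\<^sup>2 - (\<theta> i + e i - w i)\<^sup>2))"
    by (intro sum_mono)
  also have "\<dots> \<le> 0"
    using assms by (simp add: sum_subtractf flip: sum_distrib_left)
  finally show ?thesis
    by (simp add: sum.distrib sum_subtractf sum_divide_distrib[symmetric] flip: sum_distrib_left)
qed

lemma fixed_design_mgf:
  fixes \<mu> :: "real measure" and f0 :: "'a \<Rightarrow> real"
  assumes \<kappa>: "entropy_constant \<kappa>" and n: "7 \<le> n"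
    and \<mu>: "prob_space \<mu>" "sets \<mu> = sets borel" "sub_gaussian \<mu> (s\<^sup>2) (\<lambda>z. z)" and s: "0 < s"
    and D: "real (pdim n (trace_set n x G)) \<le> D" "1 \<le> D"
    and est: "\<And>e. e \<in> space (PiM {1..n} (\<lambda>_. \<mu>)) \<Longrightarrow> est e \<in> G"
    and min: "\<And>e. e \<in> space (PiM {1..n} (\<lambda>_. \<mu>)) \<Longrightarrow>
      (\<Sum>i=1..n. (f0 (x i) + e i - est e (x i))\<^sup>2) \<le> (\<Sum>i=1..n. (f0 (x i) + e i - g (x i))\<^sup>2)"
  shows "(\<integral>\<^sup>+e. ennreal (exp (1 / (512 * s\<^sup>2) *
            ((\<Sum>i=1..n. (est e (x i) - f0 (x i))\<^sup>2) - 3 * (\<Sum>i=1..n. (g (x i) - f0 (x i))\<^sup>2))))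
          \<partial>PiM {1..n} (\<lambda>_. \<mu>)) \<le> ennreal (real n powr (6 * \<kappa> * D))"
proof -
  let ?w = "\<lambda>e. \<lambda>i\<in>{1..n}. est e (x i)"
  \<comment> \<open>The factor 2 of the basic inequality turns the denominator \<open>256\<close>
    into \<open>512\<close>.\<close>
  have half: "1 / (512 * a) * (2 * y) = 1 / (256 * a) * y" for a y :: real by simp
  have "(\<integral>\<^sup>+e. ennreal (exp (1 / (512 * s\<^sup>2) *
            ((\<Sum>i=1..n. (est e (x i) - f0 (x i))\<^sup>2) - 3 * (\<Sum>i=1..n. (g (x i) - f0 (x i))\<^sup>2))))
          \<partial>PiM {1..n} (\<lambda>_. \<mu>))
     \<le> (\<integral>\<^sup>+e. ennreal (exp (1 / (256 * s\<^sup>2) *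
            (2 * (\<Sum>i=1..n. e i * (?w e i - g (x i))) - (\<Sum>i=1..n. (?w e i - g (x i))\<^sup>2) / 4)))
          \<partial>PiM {1..n} (\<lambda>_. \<mu>))"
  proof (intro nn_integral_mono ennreal_leI)
    fix e assume e: "e \<in> space (PiM {1..n} (\<lambda>_. \<mu>))"
    have "1 / (512 * s\<^sup>2) * ((\<Sum>i=1..n. (est e (x i) - f0 (x i))\<^sup>2) - 3 * (\<Sum>i=1..n. (g (x i) - f0 (x i))\<^sup>2))
      \<le> 1 / (512 * s\<^sup>2) * (2 * (2 * (\<Sum>i=1..n. e i * (est e (x i) - g (x i))) - (\<Sum>i=1..n. (est e (x i) - g (x i))\<^sup>2) / 4))"
      by (intro mult_left_mono least_squares_basic_inequality min[OF e]) auto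
    also have "\<dots> = 1 / (256 * s\<^sup>2) * (2 * (\<Sum>i=1..n. e i * (?w e i - g (x i))) - (\<Sum>i=1..n. (?w e i - g (x i))\<^sup>2) / 4)"
      unfolding half by simp
    finally show "exp (1 / (512 * s\<^sup>2) * ((\<Sum>i=1..n. (est e (x i) - f0 (x i))\<^sup>2) - 3 * (\<Sum>i=1..n. (g (x i) - f0 (x i))\<^sup>2)))
      \<le> exp (1 / (256 * s\<^sup>2) * (2 * (\<Sum>i=1..n. e i * (?w e i - g (x i))) - (\<Sum>i=1..n. (?w e i - g (x i))\<^sup>2) / 4))"
      by simp
  qed
  also have "\<dots> \<le> ennreal (real n powr (6 * \<kappa> * D))"
  proof (rule noise_process_mgf[OF \<kappa> n \<mu> s _ D])
    show "trace_set n x G \<subseteq> {1..n} \<rightarrow>\<^sub>E UNIV" by (auto simp: trace_set_def)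
    show "?w e \<in> trace_set n x G" if "e \<in> space (PiM {1..n} (\<lambda>_. \<mu>))" for e
      unfolding trace_set_def by (rule imageI) (rule est[OF that])
  qed
  finally show ?thesis .
qed

section \<open>Comparison of the two norms\<close>

text \<open>The weight 2 against 1 is what makes interchanging free:
  \<open>exp (p - q) + exp (q - p)\<close> is never below 2, while here the drift absorbs the
  second-order term. For \<open>p \<le> q\<close> and \<open>r = exp (q - p)\<close> it is enough
  that \<open>1 / r^2 + r \<le> 2\<close>, which holds from 1 up to the golden ratio.\<close>

lemma exp_swap_le_2:
  fixes p q :: real
  assumes "0 \<le> p" "p \<le> 1 / 5" "0 \<le> q" "q \<le> 1 / 5"
  shows "exp (p - 2 * q) + exp (q - 2 * p) \<le> 2"
proof -
  have *: "exp (p - 2 * q) + exp (q - 2 * p) \<le> 2" if pq: "0 \<le> p" "p \<le> q" "q \<le> 1 / 5" for p q :: real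
  proof -
    define r where "r = exp (q - p)"
    have r: "1 \<le> r" "r \<le> 3 / 2"
    proof -
      show "1 \<le> r" using pq by (simp add: r_def)
      have "r \<le> exp (1 / 5)" using pq by (simp add: r_def)
      also have "\<dots> \<le> 1 + 1 / 5 + (1 / 5)\<^sup>2" by (rule exp_bound) auto
      finally show "r \<le> 3 / 2" by (simp add: power2_eq_square)
    qed
    have "exp (p - 2 * q) \<le> exp (- (2 * (q - p)))" using pq by simp
    also have "\<dots> = 1 / r\<^sup>2" by (simp only: r_def exp_minus exp_double inverse_eq_divide)
    finally have 1: "exp (p - 2 * q) \<le> 1 / r\<^sup>2" .
    have 2: "exp (q - 2 * p) \<le> r" using pq by (simp add: r_def)
    have "(r - 1) * (r\<^sup>2 - r - 1) \<le> 0"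
    proof (intro mult_nonneg_nonpos)
      have "r * (r - 1) \<le> 3 / 2 * (1 / 2)" using r by (intro mult_mono) auto
      then show "r\<^sup>2 - r - 1 \<le> 0" by (simp add: power2_eq_square algebra_simps)
    qed (use r in simp)
    then have "1 + r * r\<^sup>2 \<le> 2 * r\<^sup>2" by (simp add: power2_eq_square algebra_simps)
    then have "1 / r\<^sup>2 + r \<le> 2" using r by (simp add: field_simps)
    with 1 2 show ?thesis by linarith
  qed
  show ?thesis
  proof (cases "p \<le> q")
    case True then show ?thesis using * assms by blast
  next
    case False then show ?thesis using *[of q p] assms by simp
  qed
qed

lemma square_le_centre:
  fixes u c :: real
  shows "u\<^sup>2 \<le> 2 * c\<^sup>2 + 2 * (u - c)\<^sup>2" and "c\<^sup>2 / 2 - (u - c)\<^sup>2 \<le> u\<^sup>2"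
proof -
  have "2 * c\<^sup>2 + 2 * (u - c)\<^sup>2 - u\<^sup>2 = (u - 2 * c)\<^sup>2"
    "u\<^sup>2 - (c\<^sup>2 / 2 - (u - c)\<^sup>2) = (2 * u - c)\<^sup>2 / 2"
    by (simp_all add: field_simps power2_eq_square)
  then show "u\<^sup>2 \<le> 2 * c\<^sup>2 + 2 * (u - c)\<^sup>2" "c\<^sup>2 / 2 - (u - c)\<^sup>2 \<le> u\<^sup>2"
    using zero_le_power2[of "u - 2 * c"] zero_le_power2[of "2 * u - c"] by linarith+
qed

text \<open>
  The set \<open>S\<close> plays the role of the random signs: it contains the indices at which the
  two samples are interchanged.
\<close>
lemma swap_average_le:
  fixes u u' :: "'i set \<Rightarrow> 'i \<Rightarrow> real"
  assumes I: "finite I" and t: "0 \<le> t" "40 * t * s\<^sup>2 \<le> 1"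
    and C: "finite C" "\<And>c i. c \<in> C \<Longrightarrow> i \<in> I \<Longrightarrow> \<bar>c i\<bar> \<le> 2 * s"
      "\<And>S. S \<subseteq> I \<Longrightarrow> \<exists>c\<in>C. (\<Sum>i\<in>I. (u S i - c i)\<^sup>2) \<le> s\<^sup>2"
    and C': "finite C'" "\<And>c i. c \<in> C' \<Longrightarrow> i \<in> I \<Longrightarrow> \<bar>c i\<bar> \<le> 2 * s"
      "\<And>S. S \<subseteq> I \<Longrightarrow> \<exists>c\<in>C'. (\<Sum>i\<in>I. (u' S i - c i)\<^sup>2) \<le> s\<^sup>2"
  shows "(\<Sum>S\<in>Pow I. exp (t * (\<Sum>i\<in>I. if i \<in> S then (u S i)\<^sup>2 - 8 * (u' S i)\<^sup>2
                                            else (u' S i)\<^sup>2 - 8 * (u S i)\<^sup>2)))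
      \<le> 2 ^ card I * (2 * real (card C) * real (card C'))"
proof -
  \<comment> \<open>Passing to cover centres doubles the weight 1 and halves the weight 8, which
    leaves the ratio 2 against 4 that the swap inequality asks for.\<close>
  define h where "h c c' S = exp (t * (\<Sum>i\<in>I. if i \<in> S then 2 * (c i)\<^sup>2 - 4 * (c' i)\<^sup>2
      else 2 * (c' i)\<^sup>2 - 4 * (c i)\<^sup>2))" for c c' :: "'i \<Rightarrow> real" and S
  \<comment> \<open>The total cost of moving to the centres, with exponent
    \<open>t * (8 * s^2)\<close> for each of the two samples.\<close>
  have e2: "exp (t * (16 * s\<^sup>2)) \<le> 2"
  proof -
    have "exp (t * (16 * s\<^sup>2)) \<le> exp (1 / 2)" using t(2) by simp
    also have "\<dots> \<le> 1 + 1 / 2 + (1 / 2)\<^sup>2" by (rule exp_bound) auto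
    finally show ?thesis by (simp add: power2_eq_square)
  qed
  have "exp (t * (\<Sum>i\<in>I. if i \<in> S then (u S i)\<^sup>2 - 8 * (u' S i)\<^sup>2 else (u' S i)\<^sup>2 - 8 * (u S i)\<^sup>2))
     \<le> 2 * (\<Sum>c\<in>C. \<Sum>c'\<in>C'. h c c' S)" (is "exp (t * ?A) \<le> _") if S: "S \<subseteq> I" for S
  proof -
    obtain c where c: "c \<in> C" "(\<Sum>i\<in>I. (u S i - c i)\<^sup>2) \<le> s\<^sup>2" using C(3)[OF S] by blast
    obtain c' where c': "c' \<in> C'" "(\<Sum>i\<in>I. (u' S i - c' i)\<^sup>2) \<le> s\<^sup>2" using C'(3)[OF S] by blast
    have "?A \<le> (\<Sum>i\<in>I. (if i \<in> S then 2 * (c i)\<^sup>2 - 4 * (c' i)\<^sup>2 else 2 * (c' i)\<^sup>2 - 4 * (c i)\<^sup>2)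
          + (8 * (u S i - c i)\<^sup>2 + 8 * (u' S i - c' i)\<^sup>2))"
    proof (intro sum_mono)
      fix i
      have "(u S i)\<^sup>2 - 8 * (u' S i)\<^sup>2 \<le> 2 * (c i)\<^sup>2 - 4 * (c' i)\<^sup>2 + (8 * (u S i - c i)\<^sup>2 + 8 * (u' S i - c' i)\<^sup>2)"
        using square_le_centre(1)[of "u S i" "c i"] square_le_centre(2)[of "c' i" "u' S i"]
          zero_le_power2[of "u S i - c i"] by argo
      moreover have "(u' S i)\<^sup>2 - 8 * (u S i)\<^sup>2 \<le> 2 * (c' i)\<^sup>2 - 4 * (c i)\<^sup>2 + (8 * (u S i - c i)\<^sup>2 + 8 * (u' S i - c' i)\<^sup>2)"
        using square_le_centre(1)[of "u' S i" "c' i"] square_le_centre(2)[of "c i" "u S i"]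
          zero_le_power2[of "u' S i - c' i"] by argo
      ultimately show "(if i \<in> S then (u S i)\<^sup>2 - 8 * (u' S i)\<^sup>2 else (u' S i)\<^sup>2 - 8 * (u S i)\<^sup>2)
         \<le> (if i \<in> S then 2 * (c i)\<^sup>2 - 4 * (c' i)\<^sup>2 else 2 * (c' i)\<^sup>2 - 4 * (c i)\<^sup>2)
          + (8 * (u S i - c i)\<^sup>2 + 8 * (u' S i - c' i)\<^sup>2)" by auto
    qed
    also have "\<dots> = (\<Sum>i\<in>I. if i \<in> S then 2 * (c i)\<^sup>2 - 4 * (c' i)\<^sup>2 else 2 * (c' i)\<^sup>2 - 4 * (c i)\<^sup>2)
         + (8 * (\<Sum>i\<in>I. (u S i - c i)\<^sup>2) + 8 * (\<Sum>i\<in>I. (u' S i - c' i)\<^sup>2))"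
      by (simp add: sum.distrib flip: sum_distrib_left)
    also have "\<dots> \<le> (\<Sum>i\<in>I. if i \<in> S then 2 * (c i)\<^sup>2 - 4 * (c' i)\<^sup>2 else 2 * (c' i)\<^sup>2 - 4 * (c i)\<^sup>2) + 16 * s\<^sup>2"
      using c(2) c'(2) by simp
    finally have "t * ?A \<le> t * (\<Sum>i\<in>I. if i \<in> S then 2 * (c i)\<^sup>2 - 4 * (c' i)\<^sup>2 else 2 * (c' i)\<^sup>2 - 4 * (c i)\<^sup>2) + t * (16 * s\<^sup>2)"
      using t(1) by (simp add: mult_left_mono flip: distrib_left)
    then have "exp (t * ?A) \<le> h c c' S * exp (t * (16 * s\<^sup>2))"
      by (simp add: h_def flip: exp_add)
    also have "\<dots> \<le> h c c' S * 2"
      using e2 by (intro mult_left_mono) (auto simp: h_def)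
    also have "h c c' S \<le> (\<Sum>c'\<in>C'. h c c' S)"
      using C'(1) c'(1) by (intro member_le_sum) (auto simp: h_def)
    also have "\<dots> \<le> (\<Sum>c\<in>C. \<Sum>c'\<in>C'. h c c' S)"
      using C(1) c(1) by (intro member_le_sum[of c C "\<lambda>c. \<Sum>c'\<in>C'. h c c' S"]) (auto simp: h_def sum_nonneg)
    finally show ?thesis by simp
  qed
  then have "(\<Sum>S\<in>Pow I. exp (t * (\<Sum>i\<in>I. if i \<in> S then (u S i)\<^sup>2 - 8 * (u' S i)\<^sup>2
                                            else (u' S i)\<^sup>2 - 8 * (u S i)\<^sup>2)))
     \<le> (\<Sum>S\<in>Pow I. 2 * (\<Sum>c\<in>C. \<Sum>c'\<in>C'. h c c' S))"
    by (intro sum_mono) auto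
  also have "\<dots> = 2 * (\<Sum>S\<in>Pow I. \<Sum>c\<in>C. \<Sum>c'\<in>C'. h c c' S)"
    by (simp add: sum_distrib_left)
  also have "(\<Sum>S\<in>Pow I. \<Sum>c\<in>C. \<Sum>c'\<in>C'. h c c' S) = (\<Sum>c\<in>C. \<Sum>S\<in>Pow I. \<Sum>c'\<in>C'. h c c' S)"
    by (rule sum.swap)
  also have "\<dots> = (\<Sum>c\<in>C. \<Sum>c'\<in>C'. \<Sum>S\<in>Pow I. h c c' S)"
    by (intro sum.cong refl sum.swap)
  also have "\<dots> \<le> (\<Sum>c\<in>C. \<Sum>c'\<in>C'. 2 ^ card I)"
  proof (intro sum_mono)
    fix c c' assume c: "c \<in> C" and c': "c' \<in> C'"
    define p where "p i = 2 * t * (c i)\<^sup>2" for i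
    define q where "q i = 2 * t * (c' i)\<^sup>2" for i
    \<comment> \<open>From \<open>2 * t * (2 * s)^2 = 8 * t * s^2\<close> and
      \<open>40 * t * s^2 \<le> 1\<close> one gets exactly the range \<open>1 / 5\<close> of the
      swap inequality.\<close>
    have small: "2 * t * y\<^sup>2 \<le> 1 / 5" if "\<bar>y\<bar> \<le> 2 * s" for y
    proof -
      have "y\<^sup>2 \<le> (2 * s)\<^sup>2" using that by (metis abs_ge_zero power2_abs power_mono)
      then have "2 * t * y\<^sup>2 \<le> 2 * t * (2 * s)\<^sup>2" using t(1) by (intro mult_left_mono) auto
      then show ?thesis using t(2) by (simp add: power_mult_distrib)
    qed
    \<comment> \<open>The centres do not depend on \<open>S\<close>, so the sum over all interchange
      sets factorises over the indices.\<close>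
    have "(\<Sum>S\<in>Pow I. h c c' S) = (\<Sum>S\<in>Pow I. (\<Prod>i\<in>S. exp (p i - 2 * q i)) * (\<Prod>i\<in>I - S. exp (q i - 2 * p i)))"
    proof (intro sum.cong refl)
      fix S assume "S \<in> Pow I"
      then have S: "S \<subseteq> I" by simp
      have "h c c' S = (\<Prod>i\<in>I. if i \<in> S then exp (p i - 2 * q i) else exp (q i - 2 * p i))"
        unfolding h_def sum_distrib_left exp_sum[OF I]
        by (intro prod.cong refl) (simp add: p_def q_def algebra_simps)
      also have "\<dots> = (\<Prod>i\<in>I \<inter> {i. i \<in> S}. exp (p i - 2 * q i)) * (\<Prod>i\<in>I \<inter> - {i. i \<in> S}. exp (q i - 2 * p i))"
        by (rule prod.If_cases[OF I])
      also have "I \<inter> {i. i \<in> S} = S" using S by auto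
      also have "I \<inter> - {i. i \<in> S} = I - S" by auto
      finally show "h c c' S = (\<Prod>i\<in>S. exp (p i - 2 * q i)) * (\<Prod>i\<in>I - S. exp (q i - 2 * p i))" .
    qed
    also have "\<dots> = (\<Prod>i\<in>I. exp (p i - 2 * q i) + exp (q i - 2 * p i))"
      by (rule prod_add[OF I, symmetric])
    also have "\<dots> \<le> (\<Prod>i\<in>I. 2)"
    proof (intro prod_mono conjI)
      fix i assume "i \<in> I"
      then show "exp (p i - 2 * q i) + exp (q i - 2 * p i) \<le> 2"
        using C(2)[OF c] C'(2)[OF c'] t(1) small
        by (intro exp_swap_le_2) (auto simp: p_def q_def)
    qed (simp add: add_nonneg_nonneg)
    finally show "(\<Sum>S\<in>Pow I. h c c' S) \<le> 2 ^ card I" by simp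
  qed
  finally show ?thesis by (simp add: mult_ac)
qed

section \<open>Jensen's inequality and the interchange of two samples\<close>

lemma exp_integral_le:
  assumes "prob_space \<nu>" and h: "integrable \<nu> h"
  shows "ennreal (exp (\<integral>z. h z \<partial>\<nu>)) \<le> (\<integral>\<^sup>+z. ennreal (exp (h z)) \<partial>\<nu>)"
proof -
  interpret prob_space \<nu> by fact
  have [measurable]: "h \<in> borel_measurable \<nu>" using h by auto
  show ?thesis
  proof (cases "integrable \<nu> (\<lambda>z. exp (h z))")
    case True
    define a where "a = (\<integral>z. h z \<partial>\<nu>)"
    \<comment> \<open>The tangent line of \<open>exp\<close> at the mean, whose integral is
      \<open>exp a\<close>.\<close>
    have "exp a * (1 + (h z - a)) \<le> exp (h z)" for z
      using mult_left_mono[OF exp_ge_add_one_self[of "h z - a"], of "exp a"] by (simp flip: exp_add)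
    then have "(\<integral>z. exp a * (1 + (h z - a)) \<partial>\<nu>) \<le> (\<integral>z. exp (h z) \<partial>\<nu>)"
      using h True by (intro integral_mono) auto
    moreover have "(\<integral>z. exp a * (1 + (h z - a)) \<partial>\<nu>) = exp a"
      using h by (simp add: a_def prob_space)
    ultimately show ?thesis
      using True by (simp add: nn_integral_eq_integral a_def)
  next
    case False
    then have "(\<integral>\<^sup>+z. ennreal (exp (h z)) \<partial>\<nu>) = \<top>"
      by (simp add: integrable_iff_bounded less_top[symmetric])
    then show ?thesis by simp
  qed
qed

text \<open>Positions \<open>k\<close> and \<open>n + k\<close> hold a pair of observations, one
  from each sample. The interchange is encoded as a map of positions so that invariance of the law
  becomes reindexing of a product measure.\<close>

definition swap_index :: "nat \<Rightarrow> nat set \<Rightarrow> nat \<Rightarrow> nat" where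
  "swap_index n S k = (if k \<in> S then n + k else if n < k \<and> k - n \<in> S then k - n else k)"

lemma swap_index:
  assumes "S \<subseteq> {1..n}"
  shows "inj_on (swap_index n S) {1..2 * n}" "swap_index n S \<in> {1..2 * n} \<rightarrow> {1..2 * n}"
    "\<And>i. i \<in> {1..n} \<Longrightarrow> swap_index n S i = (if i \<in> S then n + i else i)"
    "\<And>i. i \<in> {1..n} \<Longrightarrow> swap_index n S (n + i) = (if i \<in> S then i else n + i)"
proof -
  have S: "1 \<le> k \<and> k \<le> n" if "k \<in> S" for k using assms that by auto
  have fst: "swap_index n S i = (if i \<in> S then n + i else i)" if "i \<in> {1..n}" for i
    using that by (auto simp: swap_index_def)
  have snd: "swap_index n S (n + i) = (if i \<in> S then i else n + i)" if "i \<in> {1..n}" for i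
    using that S[of "n + i"] by (auto simp: swap_index_def)
  have cases: "k \<in> {1..n} \<or> (\<exists>i\<in>{1..n}. k = n + i)" if "k \<in> {1..2 * n}" for k
    using that by (cases "k \<le> n") (auto intro!: bexI[of _ "k - n"])
  have "swap_index n S (swap_index n S k) = k" if "k \<in> {1..2 * n}" for k
    using cases[OF that] fst snd by auto
  then show "inj_on (swap_index n S) {1..2 * n}" by (rule inj_on_inverseI)
  show "swap_index n S \<in> {1..2 * n} \<rightarrow> {1..2 * n}"
  proof
    fix k assume "k \<in> {1..2 * n}"
    from cases[OF this] show "swap_index n S k \<in> {1..2 * n}" using fst snd by auto
  qed
  show "\<And>i. i \<in> {1..n} \<Longrightarrow> swap_index n S i = (if i \<in> S then n + i else i)" by (rule fst)
  show "\<And>i. i \<in> {1..n} \<Longrightarrow> swap_index n S (n + i) = (if i \<in> S then i else n + i)" by (rule snd)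
qed

text \<open>Radius \<open>s\<close> is fine enough here, because the squared error is multiplied by
  \<open>t\<close> and \<open>t * s^2\<close> is bounded by a constant. The centres come from the
  model, so they stay within \<open>2 * s\<close> of zero after subtracting
  \<open>f0\<close>.\<close>

lemma centred_trace_cover:
  fixes x :: "nat \<Rightarrow> 'a"
  assumes \<kappa>: "entropy_constant \<kappa>" and n: "7 \<le> n" and s: "0 < s" and x: "\<forall>i\<in>{1..n}. x i \<in> A"
    and G: "\<forall>g\<in>G. \<forall>z\<in>A. \<bar>g z\<bar> \<le> s" and f0: "\<forall>z\<in>A. \<bar>f0 z\<bar> \<le> s"
    and D: "real (pdim n (trace_set n x G)) \<le> D" "1 \<le> D"
  shows "\<exists>C. finite C \<and> real (card C) \<le> real n powr (2 * \<kappa> * D) \<and>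
     (\<forall>c\<in>C. \<forall>i\<in>{1..n}. \<bar>c i\<bar> \<le> 2 * s) \<and>
     (\<forall>g\<in>G. \<exists>c\<in>C. (\<Sum>i=1..n. (g (x i) - f0 (x i) - c i)\<^sup>2) \<le> s\<^sup>2)"
proof -
  have bound: "\<forall>v\<in>trace_set n x G. \<forall>i\<in>{1..n}. \<bar>v i\<bar> \<le> s"
    using G x by (auto simp: trace_set_def)
  have ext: "trace_set n x G \<subseteq> {1..n} \<rightarrow>\<^sub>E UNIV" by (auto simp: trace_set_def)
  have pos: "1 \<le> n" "0 \<le> s" using n s by auto
  obtain C where C: "C \<subseteq> trace_set n x G" "finite C"
    "real (card C) \<le> (4 + 4 * s * sqrt (real n) / s) powr (\<kappa> * D)"
    "\<And>v. v \<in> trace_set n x G \<Longrightarrow> \<exists>c\<in>C. L2_set (\<lambda>i. v i - c i) {1..n} \<le> s"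
    using entropy_constant_internal_cover[OF \<kappa> pos(1) ext pos(2) bound D(1) s] by blast
  define C' where "C' = (\<lambda>c i. c i - f0 (x i)) ` C"
  show ?thesis
  proof (intro exI[of _ C'] conjI ballI)
    show "finite C'" using C(2) by (simp add: C'_def)
    have "real (card C') \<le> real (card C)"
      using card_image_le[OF C(2)] by (simp add: C'_def)
    also note C(3)
    also have "4 + 4 * s * sqrt (real n) / s = 4 + 4 * sqrt (real n)" using s by simp
    also have "\<dots> powr (\<kappa> * D) \<le> (real n ^ 2) powr (\<kappa> * D)"
    proof (rule powr_mono2)
      have "(sqrt (real n) - 2)\<^sup>2 \<ge> 0" by simp
      then have "4 * sqrt (real n) \<le> real n + 4" using n by (simp add: power2_eq_square algebra_simps)
      moreover have "7 * real n \<le> real n * real n" using n by (intro mult_right_mono) auto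
      moreover have "7 \<le> real n" using n by simp
      ultimately show "4 + 4 * sqrt (real n) \<le> real n ^ 2" unfolding power2_eq_square by argo
    qed (use D(2) entropy_constant_ge_1[OF \<kappa>] in auto)
    also have "\<dots> = real n powr (2 * \<kappa> * D)"
      using n by (simp add: powr_powr powr_numeral[symmetric] mult.assoc del: powr_numeral)
    finally show "real (card C') \<le> real n powr (2 * \<kappa> * D)" .
  next
    fix c i assume "c \<in> C'" and i: "i \<in> {1..n}"
    then obtain v where v: "v \<in> trace_set n x G" "c = (\<lambda>i. v i - f0 (x i))" using C(1) by (auto simp: C'_def)
    have "\<bar>v i\<bar> \<le> s" using bound v(1) i by blast
    moreover have "\<bar>f0 (x i)\<bar> \<le> s" using f0 x i by blast
    ultimately show "\<bar>c i\<bar> \<le> 2 * s" unfolding v(2) by linarith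
  next
    fix g assume "g \<in> G"
    then have "(\<lambda>i\<in>{1..n}. g (x i)) \<in> trace_set n x G" by (simp add: trace_set_def)
    then obtain c where c: "c \<in> C" "L2_set (\<lambda>i. (\<lambda>i\<in>{1..n}. g (x i)) i - c i) {1..n} \<le> s"
      using C(4) by blast
    have "L2_set (\<lambda>i. (\<lambda>i\<in>{1..n}. g (x i)) i - c i) {1..n} = L2_set (\<lambda>i. g (x i) - f0 (x i) - (c i - f0 (x i))) {1..n}"
      by (intro L2_set_cong) auto
    with c have "(\<Sum>i=1..n. (g (x i) - f0 (x i) - (c i - f0 (x i)))\<^sup>2) \<le> s\<^sup>2"
      using s by (simp only: L2_set_le_iff)
    then show "\<exists>c\<in>C'. (\<Sum>i=1..n. (g (x i) - f0 (x i) - c i)\<^sup>2) \<le> s\<^sup>2"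
      unfolding C'_def using c(1) by (intro bexI[OF _ imageI]) auto
  qed
qed

text \<open>The pseudo-dimension is bounded almost surely for one sample of size \<open>n\<close>;
  this carries the bound to each half of a sample of size \<open>2 * n\<close>.\<close>

lemma AE_PiM_subsample:
  assumes \<nu>: "prob_space \<nu>" and t: "inj_on t I" "t \<in> I \<rightarrow> K"
    and P: "AE x in PiM I (\<lambda>_. \<nu>). P x"
  shows "AE \<omega> in PiM K (\<lambda>_. \<nu>). P (\<lambda>i\<in>I. \<omega> (t i))"
proof -
  have "distr (PiM K (\<lambda>_. \<nu>)) (PiM I (\<lambda>_. \<nu>)) (\<lambda>\<omega>. \<lambda>i\<in>I. \<omega> (t i)) = PiM I (\<lambda>_. \<nu>)"
    by (rule distr_PiM_reindex[OF \<nu> t])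
  moreover have "(\<lambda>\<omega>. \<lambda>i\<in>I. \<omega> (t i)) \<in> measurable (PiM K (\<lambda>_. \<nu>)) (PiM I (\<lambda>_. \<nu>))"
    using t(2) by (intro measurable_restrict measurable_component_singleton) auto
  ultimately show ?thesis
    using P by (metis AE_distrD)
qed

text \<open>Each interchange preserves the product measure, so the integral of \<open>\<Phi>\<close>
  equals the integral of its average over all \<open>2 ^ n\<close> interchanges. Only this average
  has to be bounded pointwise.\<close>

lemma nn_integral_swap_average:
  fixes \<Phi> :: "(nat \<Rightarrow> 'a) \<Rightarrow> ennreal"
  assumes \<nu>: "prob_space \<nu>" and \<Phi>: "\<Phi> \<in> borel_measurable (PiM {1..2 * n} (\<lambda>_. \<nu>))"
    and K: "AE \<omega> in PiM {1..2 * n} (\<lambda>_. \<nu>).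
      (\<Sum>S\<in>Pow {1..n}. \<Phi> (\<lambda>k\<in>{1..2 * n}. \<omega> (swap_index n S k))) \<le> 2 ^ n * ennreal K"
  shows "(\<integral>\<^sup>+\<omega>. \<Phi> \<omega> \<partial>PiM {1..2 * n} (\<lambda>_. \<nu>)) \<le> ennreal K"
proof -
  let ?P = "PiM {1..2 * n} (\<lambda>_. \<nu>)"
  let ?r = "\<lambda>S \<omega>. \<lambda>k\<in>{1..2 * n}. \<omega> (swap_index n S k)"
  interpret P: prob_space ?P by (intro prob_space_PiM \<nu>)
  have r: "?r S \<in> measurable ?P ?P" if "S \<subseteq> {1..n}" for S
    using swap_index(2)[OF that] by (intro measurable_restrict measurable_component_singleton) auto
  have eq: "(\<integral>\<^sup>+\<omega>. \<Phi> \<omega> \<partial>?P) = (\<integral>\<^sup>+\<omega>. \<Phi> (?r S \<omega>) \<partial>?P)" if S: "S \<subseteq> {1..n}" for S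
  proof -
    have "distr ?P ?P (?r S) = ?P"
      by (rule distr_PiM_reindex[OF \<nu> swap_index(1,2)[OF S]])
    then have "(\<integral>\<^sup>+\<omega>. \<Phi> \<omega> \<partial>?P) = (\<integral>\<^sup>+\<omega>. \<Phi> \<omega> \<partial>distr ?P ?P (?r S))" by simp
    also have "\<dots> = (\<integral>\<^sup>+\<omega>. \<Phi> (?r S \<omega>) \<partial>?P)"
      by (rule nn_integral_distr[OF r[OF S]]) (use \<Phi> in simp)
    finally show ?thesis .
  qed
  have "2 ^ n * (\<integral>\<^sup>+\<omega>. \<Phi> \<omega> \<partial>?P) = (\<Sum>S\<in>Pow {1..n}. \<integral>\<^sup>+\<omega>. \<Phi> \<omega> \<partial>?P)"
    by (simp add: card_Pow)
  also have "\<dots> = (\<Sum>S\<in>Pow {1..n}. \<integral>\<^sup>+\<omega>. \<Phi> (?r S \<omega>) \<partial>?P)"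
    by (intro sum.cong refl eq) auto
  also have "\<dots> = (\<integral>\<^sup>+\<omega>. (\<Sum>S\<in>Pow {1..n}. \<Phi> (?r S \<omega>)) \<partial>?P)"
    by (rule nn_integral_sum[symmetric]) (use measurable_compose[OF r \<Phi>] in auto)
  also have "\<dots> \<le> (\<integral>\<^sup>+\<omega>. 2 ^ n * ennreal K \<partial>?P)"
    by (rule nn_integral_mono_AE[OF K])
  also have "\<dots> = 2 ^ n * ennreal K"
    by (simp only: nn_integral_const P.emeasure_space_1 mult_1_right)
  finally show ?thesis
    by (subst (asm) ennreal_mult_le_mult_iff) (auto simp: power_eq_top_ennreal)
qed

text \<open>
  Jensen's inequality replaces \<open>\<nu>\<close> by the empirical measure of an independent second sample; the
  pair is then invariant under the coordinatewise interchanges. Averaging over these inside the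
  integral avoids measurability questions about suprema over \<open>G\<close>.
\<close>
lemma ghost_sample_mgf:
  fixes \<nu> :: "'a measure" and f0 :: "'a \<Rightarrow> real"
  assumes \<nu>: "prob_space \<nu>" and \<kappa>: "entropy_constant \<kappa>" and n: "7 \<le> n" and s: "0 < s"
    and G: "\<And>g z. g \<in> G \<Longrightarrow> z \<in> space \<nu> \<Longrightarrow> \<bar>g z\<bar> \<le> s" "\<And>g. g \<in> G \<Longrightarrow> g \<in> borel_measurable \<nu>"
    and f0: "\<And>z. z \<in> space \<nu> \<Longrightarrow> \<bar>f0 z\<bar> \<le> s" "f0 \<in> borel_measurable \<nu>"
    and D: "AE x in PiM {1..n} (\<lambda>_. \<nu>). real (pdim n (trace_set n x G)) \<le> D" "1 \<le> D"
    and T: "\<And>x. x \<in> space (PiM {1..n} (\<lambda>_. \<nu>)) \<Longrightarrow> T x \<in> G"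
      "(\<lambda>(x, z). T x z) \<in> borel_measurable (PiM {1..n} (\<lambda>_. \<nu>) \<Otimes>\<^sub>M \<nu>)"
    and t: "0 \<le> t" "40 * t * s\<^sup>2 \<le> 1"
  shows "(\<integral>\<^sup>+x. ennreal (exp (t * (real n * (\<integral>z. (T x z - f0 z)\<^sup>2 \<partial>\<nu>)
             - 8 * (\<Sum>i=1..n. (T x (x i) - f0 (x i))\<^sup>2)))) \<partial>PiM {1..n} (\<lambda>_. \<nu>))
      \<le> ennreal (2 * real n powr (4 * \<kappa> * D))"
proof -
  interpret prob_space \<nu> by fact
  interpret product_sigma_finite "\<lambda>_. \<nu>" ..
  let ?I = "{1..n}" and ?J = "{n + 1..2 * n}" and ?K = "{1..2 * n}"
  note [measurable] = f0(2)
  \<comment> \<open>The fit is computed from the first half only; the second half is the ghost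
    sample and carries weight 1.\<close>
  define \<Phi> where "\<Phi> \<omega> = ennreal (exp (t * (\<Sum>i=1..n. (T (restrict \<omega> ?I) (\<omega> (n + i)) - f0 (\<omega> (n + i)))\<^sup>2
      - 8 * (T (restrict \<omega> ?I) (\<omega> i) - f0 (\<omega> i))\<^sup>2)))" for \<omega>
  have IJ: "?I \<union> ?J = ?K" "?I \<inter> ?J = {}" by auto
  have T_meas: "(\<lambda>\<omega>. T (restrict \<omega> ?I) (\<omega> k)) \<in> borel_measurable (PiM ?K (\<lambda>_. \<nu>))" if "k \<in> ?K" for k
  proof -
    have "(\<lambda>\<omega>. (restrict \<omega> ?I, \<omega> k)) \<in> measurable (PiM ?K (\<lambda>_. \<nu>)) (PiM ?I (\<lambda>_. \<nu>) \<Otimes>\<^sub>M \<nu>)"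
      using that by (intro measurable_Pair measurable_restrict_subset measurable_component_singleton) auto
    from measurable_compose[OF this T(2)] show ?thesis by simp
  qed
  have f0_meas: "(\<lambda>\<omega>. f0 (\<omega> k)) \<in> borel_measurable (PiM ?K (\<lambda>_. \<nu>))" if "k \<in> ?K" for k
    using measurable_compose[OF measurable_component_singleton[OF that] f0(2)] .
  have \<Phi>_meas: "\<Phi> \<in> borel_measurable (PiM ?K (\<lambda>_. \<nu>))"
    unfolding \<Phi>_def
    by (intro measurable_compose[OF _ measurable_ennreal] borel_measurable_exp[THEN measurable_compose[rotated]]
        borel_measurable_times borel_measurable_const borel_measurable_sum borel_measurable_diff
        borel_measurable_power T_meas f0_meas) auto
  \<comment> \<open>The factor \<open>n\<close> in front of the integral becomes an
    \<open>n\<close>-th power, matched by the \<open>n\<close> independent ghost points.\<close>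
  have jensen: "ennreal (exp (t * (real n * (\<integral>z. (T x z - f0 z)\<^sup>2 \<partial>\<nu>) - 8 * (\<Sum>i=1..n. (T x (x i) - f0 (x i))\<^sup>2))))
      \<le> (\<integral>\<^sup>+y. \<Phi> (merge ?I ?J (x, y)) \<partial>PiM ?J (\<lambda>_. \<nu>))" if x: "x \<in> space (PiM ?I (\<lambda>_. \<nu>))" for x
  proof -
    let ?h = "\<lambda>z. t * (T x z - f0 z)\<^sup>2"
    have [measurable]: "T x \<in> borel_measurable \<nu>" using G(2) T(1)[OF x] by blast
    have int: "integrable \<nu> ?h"
    proof (rule integrable_const_bound[where B = "t * (2 * s)\<^sup>2"])
      show "AE z in \<nu>. norm (?h z) \<le> t * (2 * s)\<^sup>2"
      proof (rule AE_I2)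
        fix z assume z: "z \<in> space \<nu>"
        have "\<bar>T x z - f0 z\<bar> \<le> 2 * s" using G(1)[OF T(1)[OF x] z] f0(1)[OF z] by linarith
        then have "(T x z - f0 z)\<^sup>2 \<le> (2 * s)\<^sup>2" by (metis abs_ge_zero power2_abs power_mono)
        then show "norm (?h z) \<le> t * (2 * s)\<^sup>2" using t(1) by (simp add: mult_left_mono)
      qed
    qed measurable
    define b where "b = exp (t * (- 8 * (\<Sum>i=1..n. (T x (x i) - f0 (x i))\<^sup>2)))"
    have "ennreal (exp (t * (real n * (\<integral>z. (T x z - f0 z)\<^sup>2 \<partial>\<nu>) - 8 * (\<Sum>i=1..n. (T x (x i) - f0 (x i))\<^sup>2))))
       = ennreal b * ennreal (exp (\<integral>z. ?h z \<partial>\<nu>)) ^ n"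
      by (simp add: b_def ennreal_power exp_of_nat_mult[symmetric] algebra_simps flip: exp_add ennreal_mult)
    also have "\<dots> \<le> ennreal b * (\<integral>\<^sup>+z. ennreal (exp (?h z)) \<partial>\<nu>) ^ n"
      by (intro mult_left_mono power_mono exp_integral_le[OF \<nu> int]) auto
    also have "(\<integral>\<^sup>+z. ennreal (exp (?h z)) \<partial>\<nu>) ^ n = (\<Prod>j\<in>?J. \<integral>\<^sup>+z. ennreal (exp (?h z)) \<partial>\<nu>)"
      by simp
    also have "\<dots> = (\<integral>\<^sup>+y. (\<Prod>j\<in>?J. ennreal (exp (?h (y j)))) \<partial>PiM ?J (\<lambda>_. \<nu>))"
      by (rule product_nn_integral_prod[symmetric]) auto
    also have "ennreal b * \<dots> = (\<integral>\<^sup>+y. ennreal b * (\<Prod>j\<in>?J. ennreal (exp (?h (y j)))) \<partial>PiM ?J (\<lambda>_. \<nu>))"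
      by (rule nn_integral_cmult[symmetric]) measurable
    also have "\<dots> = (\<integral>\<^sup>+y. \<Phi> (merge ?I ?J (x, y)) \<partial>PiM ?J (\<lambda>_. \<nu>))"
    proof (intro nn_integral_cong)
      fix y assume "y \<in> space (PiM ?J (\<lambda>_. \<nu>))"
      have rx: "restrict (merge ?I ?J (x, y)) ?I = x"
        using x by (auto simp: space_PiM merge_def fun_eq_iff PiE_def extensional_def restrict_def)
      have m1: "merge ?I ?J (x, y) i = x i" "merge ?I ?J (x, y) (n + i) = y (n + i)" if "i \<in> ?I" for i
        using that by (auto simp: merge_def)
      have "(\<Sum>j\<in>?J. ?h (y j)) = (\<Sum>i=1..n. ?h (y (n + i)))"
        by (rule sum.reindex_bij_witness[of _ "\<lambda>i. n + i" "\<lambda>j. j - n"]) auto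
      then have "(\<Prod>j\<in>?J. ennreal (exp (?h (y j)))) = ennreal (exp (\<Sum>i=1..n. ?h (y (n + i))))"
        by (simp only: prod_ennreal exp_ge_zero exp_sum[OF finite_atLeastAtMost, symmetric])
      then have "ennreal b * (\<Prod>j\<in>?J. ennreal (exp (?h (y j)))) = ennreal (exp (t * (- 8 * (\<Sum>i=1..n. (T x (x i) - f0 (x i))\<^sup>2)) + (\<Sum>i=1..n. ?h (y (n + i)))))"
        by (simp only: b_def exp_add ennreal_mult[OF exp_ge_zero exp_ge_zero])
      also have "\<dots> = \<Phi> (merge ?I ?J (x, y))"
        unfolding \<Phi>_def rx by (simp add: m1 sum_subtractf algebra_simps flip: sum_distrib_left)
      finally show "ennreal b * (\<Prod>j\<in>?J. ennreal (exp (?h (y j)))) = \<Phi> (merge ?I ?J (x, y))" .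
    qed
    finally show ?thesis .
  qed
  let ?N = "real n powr (2 * \<kappa> * D)"
  have average: "(\<Sum>S\<in>Pow ?I. \<Phi> (\<lambda>k\<in>?K. \<omega> (swap_index n S k))) \<le> 2 ^ n * ennreal (2 * real n powr (4 * \<kappa> * D))"
    if \<omega>: "\<omega> \<in> space (PiM ?K (\<lambda>_. \<nu>))"
      and D1: "real (pdim n (trace_set n (\<lambda>i\<in>?I. \<omega> i) G)) \<le> D"
      and D2: "real (pdim n (trace_set n (\<lambda>i\<in>?I. \<omega> (n + i)) G)) \<le> D" for \<omega>
  proof -
    have in_space: "\<omega> k \<in> space \<nu>" if "k \<in> ?K" for k using \<omega> that by (auto simp: space_PiM PiE_def)
    define r where "r S = (\<lambda>k\<in>?K. \<omega> (swap_index n S k))" for S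
    \<comment> \<open>The fit changes with \<open>S\<close>, being computed from the interchanged
      first half. The covers below must therefore serve the whole model on each of the two original
      halves.\<close>
    define g where "g S = T (restrict (r S) ?I)" for S
    have g: "g S \<in> G" if "S \<subseteq> ?I" for S
    proof -
      have "\<omega> (swap_index n S k) \<in> space \<nu>" if "k \<in> ?K" for k
        using in_space swap_index(2)[OF \<open>S \<subseteq> ?I\<close>] that by blast
      then have "restrict (r S) ?I \<in> space (PiM ?I (\<lambda>_. \<nu>))"
        by (auto simp: r_def space_PiM)
      then show ?thesis unfolding g_def by (rule T(1))
    qed
    have sp1: "\<forall>i\<in>?I. (\<lambda>i\<in>?I. \<omega> i) i \<in> space \<nu>"
      and sp2: "\<forall>i\<in>?I. (\<lambda>i\<in>?I. \<omega> (n + i)) i \<in> space \<nu>"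
      using in_space by auto
    have bG: "\<forall>g\<in>G. \<forall>z\<in>space \<nu>. \<bar>g z\<bar> \<le> s" and bf0: "\<forall>z\<in>space \<nu>. \<bar>f0 z\<bar> \<le> s"
      using G(1) f0(1) by auto
    obtain C where C: "finite C" "real (card C) \<le> ?N" "\<forall>c\<in>C. \<forall>i\<in>?I. \<bar>c i\<bar> \<le> 2 * s"
      "\<forall>g\<in>G. \<exists>c\<in>C. (\<Sum>i=1..n. (g ((\<lambda>i\<in>?I. \<omega> i) i) - f0 ((\<lambda>i\<in>?I. \<omega> i) i) - c i)\<^sup>2) \<le> s\<^sup>2"
      using centred_trace_cover[OF \<kappa> n s sp1 bG bf0 D1 D(2)] by blast
    obtain C' where C': "finite C'" "real (card C') \<le> ?N" "\<forall>c\<in>C'. \<forall>i\<in>?I. \<bar>c i\<bar> \<le> 2 * s"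
      "\<forall>g\<in>G. \<exists>c\<in>C'. (\<Sum>i=1..n. (g ((\<lambda>i\<in>?I. \<omega> (n + i)) i) - f0 ((\<lambda>i\<in>?I. \<omega> (n + i)) i) - c i)\<^sup>2) \<le> s\<^sup>2"
      using centred_trace_cover[OF \<kappa> n s sp2 bG bf0 D2 D(2)] by blast
    define u where "u S i = g S (\<omega> i) - f0 (\<omega> i)" for S i
    define u' where "u' S i = g S (\<omega> (n + i)) - f0 (\<omega> (n + i))" for S i
    have cov: "\<exists>c\<in>C. (\<Sum>i=1..n. (u S i - c i)\<^sup>2) \<le> s\<^sup>2" if S: "S \<subseteq> ?I" for S
    proof -
      obtain c where c: "c \<in> C"
        "(\<Sum>i=1..n. (g S ((\<lambda>i\<in>?I. \<omega> i) i) - f0 ((\<lambda>i\<in>?I. \<omega> i) i) - c i)\<^sup>2) \<le> s\<^sup>2"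
        using C(4) g[OF S] by blast
      note c(2)
      also have "(\<Sum>i=1..n. (g S ((\<lambda>i\<in>?I. \<omega> i) i) - f0 ((\<lambda>i\<in>?I. \<omega> i) i) - c i)\<^sup>2) = (\<Sum>i=1..n. (u S i - c i)\<^sup>2)"
        by (intro sum.cong refl) (simp add: u_def)
      finally show ?thesis using c(1) by blast
    qed
    have cov': "\<exists>c\<in>C'. (\<Sum>i=1..n. (u' S i - c i)\<^sup>2) \<le> s\<^sup>2" if S: "S \<subseteq> ?I" for S
    proof -
      obtain c where c: "c \<in> C'"
        "(\<Sum>i=1..n. (g S ((\<lambda>i\<in>?I. \<omega> (n + i)) i) - f0 ((\<lambda>i\<in>?I. \<omega> (n + i)) i) - c i)\<^sup>2) \<le> s\<^sup>2"
        using C'(4) g[OF S] by blast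
      note c(2)
      also have "(\<Sum>i=1..n. (g S ((\<lambda>i\<in>?I. \<omega> (n + i)) i) - f0 ((\<lambda>i\<in>?I. \<omega> (n + i)) i) - c i)\<^sup>2) = (\<Sum>i=1..n. (u' S i - c i)\<^sup>2)"
        by (intro sum.cong refl) (simp add: u'_def)
      finally show ?thesis using c(1) by blast
    qed
    have "(\<Sum>S\<in>Pow ?I. \<Phi> (r S)) = (\<Sum>S\<in>Pow ?I. ennreal (exp (t * (\<Sum>i=1..n. if i \<in> S then (u S i)\<^sup>2 - 8 * (u' S i)\<^sup>2
                                            else (u' S i)\<^sup>2 - 8 * (u S i)\<^sup>2))))"
    proof (intro sum.cong refl)
      fix S assume "S \<in> Pow ?I"
      then have S: "S \<subseteq> ?I" by simp
      have "r S i = (if i \<in> S then \<omega> (n + i) else \<omega> i)" "r S (n + i) = (if i \<in> S then \<omega> i else \<omega> (n + i))"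
        if "i \<in> ?I" for i
        using that swap_index(3,4)[OF S that] by (auto simp: r_def)
      then show "\<Phi> (r S) = ennreal (exp (t * (\<Sum>i=1..n. if i \<in> S then (u S i)\<^sup>2 - 8 * (u' S i)\<^sup>2
                                            else (u' S i)\<^sup>2 - 8 * (u S i)\<^sup>2)))"
        unfolding \<Phi>_def g_def[symmetric] u_def u'_def
        by (intro arg_cong[where f = "\<lambda>y. ennreal (exp (t * y))"] sum.cong refl) auto
    qed
    also have "\<dots> = ennreal (\<Sum>S\<in>Pow ?I. exp (t * (\<Sum>i=1..n. if i \<in> S then (u S i)\<^sup>2 - 8 * (u' S i)\<^sup>2
                                            else (u' S i)\<^sup>2 - 8 * (u S i)\<^sup>2)))"
      by (rule sum_ennreal) simp
    also have "\<dots> \<le> ennreal (2 ^ card ?I * (2 * real (card C) * real (card C')))"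
      using C(1,3) C'(1,3) cov cov' by (intro ennreal_leI swap_average_le[OF _ t]) auto
    also have "\<dots> \<le> ennreal (2 ^ n * (2 * ?N * ?N))"
      using C(2) C'(2) by (intro ennreal_leI mult_mono) auto
    also have "\<dots> = 2 ^ n * ennreal (2 * real n powr (4 * \<kappa> * D))"
      by (simp add: ennreal_mult ennreal_power[symmetric] mult_ac flip: powr_add)
    finally show ?thesis by (simp add: r_def)
  qed
  have "(\<integral>\<^sup>+x. ennreal (exp (t * (real n * (\<integral>z. (T x z - f0 z)\<^sup>2 \<partial>\<nu>)
             - 8 * (\<Sum>i=1..n. (T x (x i) - f0 (x i))\<^sup>2)))) \<partial>PiM ?I (\<lambda>_. \<nu>))
    \<le> (\<integral>\<^sup>+x. (\<integral>\<^sup>+y. \<Phi> (merge ?I ?J (x, y)) \<partial>PiM ?J (\<lambda>_. \<nu>)) \<partial>PiM ?I (\<lambda>_. \<nu>))"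
    by (intro nn_integral_mono jensen)
  also have "\<dots> = (\<integral>\<^sup>+\<omega>. \<Phi> \<omega> \<partial>PiM (?I \<union> ?J) (\<lambda>_. \<nu>))"
    by (rule product_nn_integral_fold[symmetric]) (use \<Phi>_meas IJ in auto)
  also have "\<dots> \<le> ennreal (2 * real n powr (4 * \<kappa> * D))"
    unfolding IJ(1)
  proof (rule nn_integral_swap_average[OF \<nu> \<Phi>_meas])
    have "AE \<omega> in PiM ?K (\<lambda>_. \<nu>). real (pdim n (trace_set n (\<lambda>i\<in>?I. \<omega> i) G)) \<le> D"
      by (rule AE_PiM_subsample[OF \<nu> _ _ D(1), of "\<lambda>i. i"]) auto
    moreover have "AE \<omega> in PiM ?K (\<lambda>_. \<nu>). real (pdim n (trace_set n (\<lambda>i\<in>?I. \<omega> (n + i)) G)) \<le> D"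
      by (rule AE_PiM_subsample[OF \<nu> _ _ D(1), of "\<lambda>i. n + i"]) auto
    ultimately show "AE \<omega> in PiM ?K (\<lambda>_. \<nu>).
      (\<Sum>S\<in>Pow ?I. \<Phi> (\<lambda>k\<in>?K. \<omega> (swap_index n S k))) \<le> 2 ^ n * ennreal (2 * real n powr (4 * \<kappa> * D))"
      using AE_space
    proof eventually_elim
      case (elim \<omega>)
      show ?case by (rule average[OF elim(3,1,2)])
    qed
  qed
  finally show ?thesis .
qed

section \<open>Risk of a single least squares estimator\<close>

lemma sub_gaussian_mono: "sub_gaussian M v Z \<Longrightarrow> v \<le> v' \<Longrightarrow> sub_gaussian M v' Z"
  unfolding sub_gaussian_def
  by (meson divide_right_mono ennreal_leI exp_le_cancel_iff mult_right_mono order_trans zero_le_numeral zero_le_power2)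

text \<open>The canonical experiment: design and noise are the coordinates of two independent
  product spaces, so that one can be integrated with the other held fixed. The given probability
  space is mapped to it only at the end.\<close>

locale random_design =
  fixes \<nu> :: "'a measure" and \<mu> :: "real measure" and \<kappa> :: real and n :: nat and f0 :: "'a \<Rightarrow> real"
  assumes design: "prob_space \<nu>" and noise: "prob_space \<mu>" "sets \<mu> = sets borel"
    and entropy: "entropy_constant \<kappa>" and n: "7 \<le> n" and f0: "f0 \<in> l2_fun \<nu>"
begin

abbreviation "PX \<equiv> PiM {1..n} (\<lambda>_. \<nu>)"
abbreviation "PE \<equiv> PiM {1..n} (\<lambda>_. \<mu>)"

definition response :: "(nat \<Rightarrow> 'a) \<Rightarrow> (nat \<Rightarrow> real) \<Rightarrow> nat \<Rightarrow> real" where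
  "response x e = (\<lambda>i\<in>{1..n}. f0 (x i) + e i)"

abbreviation loss :: "norm_kind \<Rightarrow> ((nat \<Rightarrow> 'a) \<Rightarrow> (nat \<Rightarrow> real) \<Rightarrow> 'a \<Rightarrow> real) \<Rightarrow>
    (nat \<Rightarrow> 'a) \<Rightarrow> (nat \<Rightarrow> real) \<Rightarrow> real" where
  "loss h fh x e \<equiv> sqdist h \<nu> n x (fh x (response x e)) f0"

sublocale PX: prob_space PX by (intro prob_space_PiM design)
sublocale PE: prob_space PE by (intro prob_space_PiM noise(1))
sublocale PXE: pair_prob_space PX PE ..
sublocale \<nu>: prob_space \<nu> by (rule design)

lemma kappa_ge_1: "1 \<le> \<kappa>"
  using entropy by (rule entropy_constant_ge_1)

lemma f0_measurable [measurable]: "f0 \<in> borel_measurable \<nu>"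
  using f0 by (simp add: l2_fun_def)

lemma sets_noise [measurable_cong]: "sets \<mu> = sets borel"
  by (rule noise(2))

lemma response_space: "response x e \<in> {1..n} \<rightarrow>\<^sub>E UNIV"
  by (simp add: response_def)

section \<open>Least squares fits as functions of design and noise\<close>

lemma fit_in_model:
  assumes "least_squares_estimator \<nu> n G fh" "x \<in> space PX"
  shows "fh x (response x e) \<in> G"
  using assms response_space
  by (auto simp: least_squares_estimator_def is_arg_min_def space_PiM)

lemma fit_minimal:
  assumes "least_squares_estimator \<nu> n G fh" "x \<in> space PX" "g \<in> G"
  shows "(\<Sum>i=1..n. (f0 (x i) + e i - fh x (response x e) (x i))\<^sup>2) \<le> (\<Sum>i=1..n. (f0 (x i) + e i - g (x i))\<^sup>2)"
proof -
  have "\<not> (1 / real n) * (\<Sum>i=1..n. (response x e i - g (x i))\<^sup>2)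
      < (1 / real n) * (\<Sum>i=1..n. (response x e i - fh x (response x e) (x i))\<^sup>2)"
    using assms response_space[of x e]
    by (auto simp: least_squares_estimator_def is_arg_min_def space_PiM)
  then have "(\<Sum>i=1..n. (response x e i - fh x (response x e) (x i))\<^sup>2) \<le> (\<Sum>i=1..n. (response x e i - g (x i))\<^sup>2)"
    using n by (simp add: field_simps)
  moreover have "(\<Sum>i=1..n. (response x e i - v i)\<^sup>2) = (\<Sum>i=1..n. (f0 (x i) + e i - v i)\<^sup>2)" for v
    by (intro sum.cong refl) (simp add: response_def)
  ultimately show ?thesis by (simp only:)
qed

lemma fit_measurable:
  assumes "least_squares_estimator \<nu> n G fh"
  shows "(\<lambda>((x, e), z). fh x (response x e) z) \<in> borel_measurable ((PX \<Otimes>\<^sub>M PE) \<Otimes>\<^sub>M \<nu>)"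
proof -
  have m: "(\<lambda>((x, y), z). fh x y z) \<in> borel_measurable ((PX \<Otimes>\<^sub>M PiM {1..n} (\<lambda>_. borel)) \<Otimes>\<^sub>M \<nu>)"
    using assms by (simp add: least_squares_estimator_def)
  have "(\<lambda>((x, e), z). ((x, response x e), z)) \<in> measurable ((PX \<Otimes>\<^sub>M PE) \<Otimes>\<^sub>M \<nu>) ((PX \<Otimes>\<^sub>M PiM {1..n} (\<lambda>_. borel)) \<Otimes>\<^sub>M \<nu>)"
    unfolding response_def split_beta' by measurable
  from measurable_compose[OF this m] show ?thesis by (simp add: split_beta')
qed

lemma loss_measurable:
  assumes lse: "least_squares_estimator \<nu> n G fh"
  shows "(\<lambda>(x, e). loss h fh x e) \<in> borel_measurable (PX \<Otimes>\<^sub>M PE)"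
proof (cases h)
  case Cont
  have [measurable]: "(\<lambda>(w, z). fh (fst w) (response (fst w) (snd w)) z) \<in> borel_measurable ((PX \<Otimes>\<^sub>M PE) \<Otimes>\<^sub>M \<nu>)"
    using fit_measurable[OF lse] by (simp add: split_beta')
  have "(\<lambda>w. \<integral>z. (fh (fst w) (response (fst w) (snd w)) z - f0 z)\<^sup>2 \<partial>\<nu>) \<in> borel_measurable (PX \<Otimes>\<^sub>M PE)"
    by measurable
  then show ?thesis by (simp add: Cont split_beta')
next
  case Disc
  have "(\<lambda>w. fh (fst w) (response (fst w) (snd w)) (fst w i)) \<in> borel_measurable (PX \<Otimes>\<^sub>M PE)" if "i \<in> {1..n}" for i
  proof -
    have "(\<lambda>w. (w, fst w i)) \<in> measurable (PX \<Otimes>\<^sub>M PE) ((PX \<Otimes>\<^sub>M PE) \<Otimes>\<^sub>M \<nu>)"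
      using that by measurable
    from measurable_compose[OF this fit_measurable[OF lse]] show ?thesis by (simp add: split_beta')
  qed
  moreover have "(\<lambda>w. f0 (fst w i)) \<in> borel_measurable (PX \<Otimes>\<^sub>M PE)" if "i \<in> {1..n}" for i
    using that by measurable
  ultimately have "(\<lambda>w. 1 / real n * (\<Sum>i=1..n. (fh (fst w) (response (fst w) (snd w)) (fst w i) - f0 (fst w i))\<^sup>2)) \<in> borel_measurable (PX \<Otimes>\<^sub>M PE)"
    by (intro borel_measurable_times borel_measurable_const borel_measurable_sum borel_measurable_power borel_measurable_diff)
  then show ?thesis by (simp add: Disc split_beta')
qed

section \<open>The two squared distances\<close>

lemma sqdist_nonneg: "0 \<le> sqdist h \<nu> n x f g"
  by (cases h) (auto intro!: sum_nonneg divide_nonneg_nonneg)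

lemma integrable_sq_diff:
  assumes "f \<in> l2_fun \<nu>" "g \<in> l2_fun \<nu>"
  shows "integrable \<nu> (\<lambda>z. (f z - g z)\<^sup>2)"
proof (rule Bochner_Integration.integrable_bound)
  show "integrable \<nu> (\<lambda>z. 2 * (f z)\<^sup>2 + 2 * (g z)\<^sup>2)"
    using assms by (simp add: l2_fun_def)
  have [measurable]: "f \<in> borel_measurable \<nu>" "g \<in> borel_measurable \<nu>"
    using assms by (auto simp: l2_fun_def)
  show "(\<lambda>z. (f z - g z)\<^sup>2) \<in> borel_measurable \<nu>"
    by measurable
  have "(f z - g z)\<^sup>2 \<le> 2 * (f z)\<^sup>2 + 2 * (g z)\<^sup>2" for z
    using zero_le_power2[of "f z + g z"] by (simp add: power2_eq_square algebra_simps)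
  then show "AE z in \<nu>. norm ((f z - g z)\<^sup>2) \<le> norm (2 * (f z)\<^sup>2 + 2 * (g z)\<^sup>2)"
    by simp
qed

lemma sqdist_triangle:
  assumes "f \<in> l2_fun \<nu>" "f' \<in> l2_fun \<nu>" "g \<in> l2_fun \<nu>"
  shows "sqdist h \<nu> n x f g \<le> 2 * sqdist h \<nu> n x f f' + 2 * sqdist h \<nu> n x f' g"
proof -
  have *: "(a - c)\<^sup>2 \<le> 2 * (a - b)\<^sup>2 + 2 * (b - c)\<^sup>2" for a b c :: real
    using zero_le_power2[of "a - 2 * b + c"] by (simp add: power2_eq_square algebra_simps)
  show ?thesis
  proof (cases h)
    case Cont
    have "(\<integral>z. (f z - g z)\<^sup>2 \<partial>\<nu>) \<le> (\<integral>z. 2 * (f z - f' z)\<^sup>2 + 2 * (f' z - g z)\<^sup>2 \<partial>\<nu>)"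
      by (intro integral_mono Bochner_Integration.integrable_add integrable_mult_right integrable_sq_diff assms *)
    then show ?thesis using Cont integrable_sq_diff assms by simp
  next
    case Disc
    have "(\<Sum>i=1..n. (f (x i) - g (x i))\<^sup>2) \<le> (\<Sum>i=1..n. 2 * (f (x i) - f' (x i))\<^sup>2 + 2 * (f' (x i) - g (x i))\<^sup>2)"
      by (intro sum_mono *)
    also have "\<dots> = 2 * (\<Sum>i=1..n. (f (x i) - f' (x i))\<^sup>2) + 2 * (\<Sum>i=1..n. (f' (x i) - g (x i))\<^sup>2)"
      by (simp add: sum.distrib sum_distrib_left)
    finally show ?thesis using Disc n by (simp add: field_simps)
  qed
qed

lemma sqdist_refl: "sqdist h \<nu> n x f f = 0"
  by (cases h) auto

text \<open>Moment bounds compare the loss with the empirical distance of a fixed competitor; taking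
  the mean turns this into the bias with respect to \<open>\<nu>\<close>, for both norms.\<close>

lemma empirical_mean:
  assumes "g \<in> l2_fun \<nu>"
  shows "(\<integral>\<^sup>+x. ennreal (sqdist Disc \<nu> n x g f0) \<partial>PX) = ennreal (\<integral>z. (f0 z - g z)\<^sup>2 \<partial>\<nu>)"
proof -
  have [measurable]: "g \<in> borel_measurable \<nu>" using assms by (simp add: l2_fun_def)
  have coord: "(\<integral>\<^sup>+x. ennreal ((g (x i) - f0 (x i))\<^sup>2) \<partial>PX) = ennreal (\<integral>z. (f0 z - g z)\<^sup>2 \<partial>\<nu>)"
    if i: "i \<in> {1..n}" for i
  proof -
    have "(\<integral>\<^sup>+x. ennreal ((g (x i) - f0 (x i))\<^sup>2) \<partial>PX) = (\<integral>\<^sup>+z. ennreal ((g z - f0 z)\<^sup>2) \<partial>distr PX \<nu> (\<lambda>x. x i))"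
      using i by (subst nn_integral_distr) (auto intro!: measurable_component_singleton)
    also have "distr PX \<nu> (\<lambda>x. x i) = \<nu>"
      using distr_PiM_component[of "{1..n}" "\<lambda>_. \<nu>" i] i design by auto
    also have "(\<integral>\<^sup>+z. ennreal ((g z - f0 z)\<^sup>2) \<partial>\<nu>) = ennreal (\<integral>z. (g z - f0 z)\<^sup>2 \<partial>\<nu>)"
      by (rule nn_integral_eq_integral) (use integrable_sq_diff[OF assms f0] in auto)
    also have "(\<integral>z. (g z - f0 z)\<^sup>2 \<partial>\<nu>) = (\<integral>z. (f0 z - g z)\<^sup>2 \<partial>\<nu>)"
      by (simp add: power2_commute)
    finally show ?thesis .
  qed
  have meas: "(\<lambda>x. ennreal ((g (x i) - f0 (x i))\<^sup>2)) \<in> borel_measurable PX" if "i \<in> {1..n}" for i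
    using that by measurable
  have "(\<integral>\<^sup>+x. ennreal (sqdist Disc \<nu> n x g f0) \<partial>PX)
     = (\<integral>\<^sup>+x. ennreal (1 / real n) * (\<Sum>i=1..n. ennreal ((g (x i) - f0 (x i))\<^sup>2)) \<partial>PX)"
    by (simp add: ennreal_mult[symmetric] sum_nonneg)
  also have "\<dots> = ennreal (1 / real n) * (\<integral>\<^sup>+x. (\<Sum>i=1..n. ennreal ((g (x i) - f0 (x i))\<^sup>2)) \<partial>PX)"
    by (rule nn_integral_cmult) (intro borel_measurable_sum meas)
  also have "(\<integral>\<^sup>+x. (\<Sum>i=1..n. ennreal ((g (x i) - f0 (x i))\<^sup>2)) \<partial>PX) = (\<Sum>i=1..n. \<integral>\<^sup>+x. ennreal ((g (x i) - f0 (x i))\<^sup>2) \<partial>PX)"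
    by (rule nn_integral_sum) (rule meas)
  also have "(\<Sum>i=1..n. \<integral>\<^sup>+x. ennreal ((g (x i) - f0 (x i))\<^sup>2) \<partial>PX) = (\<Sum>i=1..n. ennreal (\<integral>z. (f0 z - g z)\<^sup>2 \<partial>\<nu>))"
    by (intro sum.cong refl coord)
  also have "ennreal (1 / real n) * \<dots> = ennreal (\<integral>z. (f0 z - g z)\<^sup>2 \<partial>\<nu>)"
    using n by (simp add: ennreal_of_nat_eq_real_of_nat ennreal_mult[symmetric])
  finally show ?thesis .
qed

lemma empirical_mgf:
  assumes lse: "least_squares_estimator \<nu> n G fh" and g: "g \<in> G" and D: "1 \<le> D"
    and pd: "real (pdim n (trace_set n x G)) \<le> D" and x: "x \<in> space PX"
    and s: "0 < s" "sub_gaussian \<mu> (s\<^sup>2) (\<lambda>z. z)"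
  shows "(\<integral>\<^sup>+e. ennreal (exp (real n / (512 * s\<^sup>2) * (loss Disc fh x e - 3 * sqdist Disc \<nu> n x g f0))) \<partial>PE)
      \<le> ennreal (real n powr (6 * \<kappa> * D))"
proof -
  have eq: "real n / (512 * s\<^sup>2) * (loss Disc fh x e - 3 * sqdist Disc \<nu> n x g f0)
     = 1 / (512 * s\<^sup>2) * ((\<Sum>i=1..n. (fh x (response x e) (x i) - f0 (x i))\<^sup>2) - 3 * (\<Sum>i=1..n. (g (x i) - f0 (x i))\<^sup>2))" for e
  proof -
    have "real n / a * (1 / real n * b - 3 * (1 / real n * c)) = 1 / a * (b - 3 * c)" for a b c :: real
      using n by (simp add: right_diff_distrib diff_divide_distrib)
    then show ?thesis by simp
  qed
  show ?thesis
    unfolding eq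
    by (intro fixed_design_mgf[OF entropy n noise s(2,1) pd D] fit_in_model[OF lse x] fit_minimal[OF lse x g])
qed

end

declare sqdist.simps [simp del]

context random_design
begin

text \<open>For the continuous norm the loss is split into its excess over eight times the empirical
  loss and the empirical loss itself. The first is handled by the ghost sample with the noise held
  fixed, the second by peeling with the design held fixed.\<close>

lemma risk_mgf:
  assumes lse: "least_squares_estimator \<nu> n G fh" and G: "G \<subseteq> l2_fun \<nu>" and g: "g \<in> G" and D: "1 \<le> D"
    and pd: "AE x in PX. real (pdim n (trace_set n x G)) \<le> D"
    and s: "0 < s" "sub_gaussian \<mu> (s\<^sup>2) (\<lambda>z. z)"
    and bounded: "h = Cont \<Longrightarrow> \<forall>f\<in>insert f0 G. \<forall>z\<in>space \<nu>. \<bar>f z\<bar> \<le> s"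
  shows "(\<integral>\<^sup>+x. \<integral>\<^sup>+e. ennreal (exp (real n / (8192 * s\<^sup>2) *
            (loss h fh x e - c_bar h * sqdist Disc \<nu> n x g f0))) \<partial>PE \<partial>PX)
      \<le> ennreal (real n powr (7 * \<kappa> * D))"
proof (cases h)
  case Disc
  have "AE x in PX. (\<integral>\<^sup>+e. ennreal (exp (real n / (8192 * s\<^sup>2) *
            (loss h fh x e - c_bar h * sqdist Disc \<nu> n x g f0))) \<partial>PE) \<le> ennreal (real n powr (7 * \<kappa> * D))"
    using pd AE_space
  proof eventually_elim
    case (elim x)
    \<comment> \<open>Since \<open>8192 = 512 * 4^2\<close>, enlarging the noise parameter reaches
      the scale used for the continuous norm.\<close>
    have s4: "0 < 4 * s" "sub_gaussian \<mu> ((4 * s)\<^sup>2) (\<lambda>z. z)"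
      using s by (auto intro: sub_gaussian_mono simp: power_mult_distrib)
    have "(\<integral>\<^sup>+e. ennreal (exp (real n / (8192 * s\<^sup>2) *
            (loss h fh x e - c_bar h * sqdist Disc \<nu> n x g f0))) \<partial>PE)
       \<le> (\<integral>\<^sup>+e. ennreal (exp (real n / (512 * (4 * s)\<^sup>2) * (loss Disc fh x e - 3 * sqdist Disc \<nu> n x g f0))) \<partial>PE)"
    proof (intro nn_integral_mono ennreal_leI)
      fix e
      have "real n / (8192 * s\<^sup>2) * (loss h fh x e - c_bar h * sqdist Disc \<nu> n x g f0)
        \<le> real n / (8192 * s\<^sup>2) * (loss Disc fh x e - 3 * sqdist Disc \<nu> n x g f0)"
        unfolding Disc using sqdist_nonneg[of Disc x g f0]
        by (intro mult_left_mono diff_left_mono mult_right_mono) auto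
      moreover have "8192 * s\<^sup>2 = 512 * (4 * s)\<^sup>2" by (simp add: power_mult_distrib)
      ultimately show "exp (real n / (8192 * s\<^sup>2) * (loss h fh x e - c_bar h * sqdist Disc \<nu> n x g f0))
         \<le> exp (real n / (512 * (4 * s)\<^sup>2) * (loss Disc fh x e - 3 * sqdist Disc \<nu> n x g f0))"
        by (simp only: exp_le_cancel_iff)
    qed
    also have "\<dots> \<le> ennreal (real n powr (6 * \<kappa> * D))"
      by (rule empirical_mgf[OF lse g D elim s4])
    also have "\<dots> \<le> ennreal (real n powr (7 * \<kappa> * D))"
      using n D kappa_ge_1 by (intro ennreal_leI powr_mono mult_right_mono) auto
    finally show ?case .
  qed
  then have "(\<integral>\<^sup>+x. \<integral>\<^sup>+e. ennreal (exp (real n / (8192 * s\<^sup>2) *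
            (loss h fh x e - c_bar h * sqdist Disc \<nu> n x g f0))) \<partial>PE \<partial>PX)
     \<le> (\<integral>\<^sup>+x. ennreal (real n powr (7 * \<kappa> * D)) \<partial>PX)"
    by (rule nn_integral_mono_AE)
  then show ?thesis by (simp only: nn_integral_const PX.emeasure_space_1 mult_1_right)
next
  case Cont
  define A where "A x e = exp (1 / (4096 * s\<^sup>2) * (real n * loss Cont fh x e
      - 8 * (\<Sum>i=1..n. (fh x (response x e) (x i) - f0 (x i))\<^sup>2)))" for x e
  define B where "B x e = exp (real n / (512 * s\<^sup>2) * (loss Disc fh x e - 3 * sqdist Disc \<nu> n x g f0))" for x e
  let ?N = "real n powr (\<kappa> * D)"
  have split: "exp (real n / (8192 * s\<^sup>2) * (loss h fh x e - c_bar h * sqdist Disc \<nu> n x g f0)) \<le> A x e + B x e" for x e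
  proof -
    define a where "a = 1 / (8192 * s\<^sup>2) * (real n * loss Cont fh x e - 8 * (\<Sum>i=1..n. (fh x (response x e) (x i) - f0 (x i))\<^sup>2))"
    define b where "b = real n / (1024 * s\<^sup>2) * (loss Disc fh x e - 3 * sqdist Disc \<nu> n x g f0)"
    \<comment> \<open>The denominator \<open>1024 = 8192 / 8\<close> makes the empirical losses
      \<open>w\<close> cancel. What remains in front of \<open>q\<close> is
      \<open>8 * 3 = 24\<close> against \<open>144\<close>.\<close>
    have arith: "real n / (8192 * y) * (l - 144 * q) \<le> 1 / (8192 * y) * (real n * l - 8 * w) + real n / (1024 * y) * (1 / real n * w - 3 * q)"
      if "0 \<le> q" "0 < y" for l q w y :: real
    proof -
      have "1 / (8192 * y) * (real n * l - 8 * w) + real n / (1024 * y) * (1 / real n * w - 3 * q)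
         - real n / (8192 * y) * (l - 144 * q) = real n * 15 * q / (1024 * y)"
        using that n by (simp add: field_simps)
      moreover have "0 \<le> real n * 15 * q / (1024 * y)" using that by simp
      ultimately show ?thesis by linarith
    qed
    have Disc_eq: "loss Disc fh x e = 1 / real n * (\<Sum>i=1..n. (fh x (response x e) (x i) - f0 (x i))\<^sup>2)"
      by (simp add: sqdist.simps)
    have "real n / (8192 * s\<^sup>2) * (loss h fh x e - c_bar h * sqdist Disc \<nu> n x g f0) \<le> a + b"
      unfolding a_def b_def Cont Disc_eq c_bar.simps by (rule arith) (use s(1) sqdist_nonneg in auto)
    then have "exp (real n / (8192 * s\<^sup>2) * (loss h fh x e - c_bar h * sqdist Disc \<nu> n x g f0)) \<le> exp (a + b)" by simp
    also have "\<dots> \<le> exp (2 * a) + exp (2 * b)" by (rule exp_add_le)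
    also have "exp (2 * a) = A x e"
    proof -
      have "2 * (1 / (8192 * y) * z) = 1 / (4096 * y) * z" for y z :: real by simp
      then show ?thesis unfolding A_def a_def by (simp only:)
    qed
    also have "exp (2 * b) = B x e"
    proof -
      have "2 * (real n / (1024 * y) * z) = real n / (512 * y) * z" for y z :: real by simp
      then show ?thesis unfolding B_def b_def by (simp only:)
    qed
    finally show ?thesis .
  qed
  have lossD: "(\<lambda>(x, e). (\<Sum>i=1..n. (fh x (response x e) (x i) - f0 (x i))\<^sup>2)) \<in> borel_measurable (PX \<Otimes>\<^sub>M PE)"
  proof -
    have "(\<Sum>i=1..n. (fh x (response x e) (x i) - f0 (x i))\<^sup>2) = real n * loss Disc fh x e" for x e
      using n by (simp add: sqdist.simps)
    then show ?thesis using loss_measurable[OF lse, of Disc] by (simp add: split_beta')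
  qed
  have A_meas: "(\<lambda>(x, e). ennreal (A x e)) \<in> borel_measurable (PX \<Otimes>\<^sub>M PE)"
  proof -
    have [measurable]: "(\<lambda>w. loss Cont fh (fst w) (snd w)) \<in> borel_measurable (PX \<Otimes>\<^sub>M PE)"
        "(\<lambda>w. \<Sum>i=1..n. (fh (fst w) (response (fst w) (snd w)) (fst w i) - f0 (fst w i))\<^sup>2) \<in> borel_measurable (PX \<Otimes>\<^sub>M PE)"
      using loss_measurable[OF lse, of Cont] lossD by (simp_all add: split_beta')
    show ?thesis unfolding A_def split_beta' by measurable
  qed
  have [measurable]: "g \<in> borel_measurable \<nu>" using g G by (auto simp: l2_fun_def)
  have B_meas: "(\<lambda>(x, e). ennreal (B x e)) \<in> borel_measurable (PX \<Otimes>\<^sub>M PE)"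
  proof -
    have [measurable]: "(\<lambda>w. sqdist Disc \<nu> n (fst w) g f0) \<in> borel_measurable (PX \<Otimes>\<^sub>M PE)"
      unfolding sqdist.simps by measurable
    have [measurable]: "(\<lambda>w. loss Disc fh (fst w) (snd w)) \<in> borel_measurable (PX \<Otimes>\<^sub>M PE)"
      using loss_measurable[OF lse, of Disc] by (simp add: split_beta')
    show ?thesis unfolding B_def split_beta' by measurable
  qed
  have intA: "(\<integral>\<^sup>+x. \<integral>\<^sup>+e. ennreal (A x e) \<partial>PE \<partial>PX) \<le> ennreal (2 * real n powr (4 * \<kappa> * D))"
  proof -
    \<comment> \<open>With the noise fixed, the fit is a function of the design alone with values in
      the model, as the ghost sample bound requires.\<close>
    have "(\<integral>\<^sup>+x. \<integral>\<^sup>+e. ennreal (A x e) \<partial>PE \<partial>PX) = (\<integral>\<^sup>+e. \<integral>\<^sup>+x. ennreal (A x e) \<partial>PX \<partial>PE)"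
      using PXE.Fubini'[OF A_meas] by simp
    also have "\<dots> \<le> (\<integral>\<^sup>+e. ennreal (2 * real n powr (4 * \<kappa> * D)) \<partial>PE)"
    proof (rule nn_integral_mono)
      fix e assume e: "e \<in> space PE"
      have joint: "(\<lambda>(x, z). fh x (response x e) z) \<in> borel_measurable (PX \<Otimes>\<^sub>M \<nu>)"
      proof -
        have "(\<lambda>w. ((fst w, e), snd w)) \<in> measurable (PX \<Otimes>\<^sub>M \<nu>) ((PX \<Otimes>\<^sub>M PE) \<Otimes>\<^sub>M \<nu>)"
          using e by measurable
        from measurable_compose[OF this fit_measurable[OF lse]] show ?thesis by (simp add: split_beta')
      qed
      show "(\<integral>\<^sup>+x. ennreal (A x e) \<partial>PX) \<le> ennreal (2 * real n powr (4 * \<kappa> * D))"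
        unfolding A_def sqdist.simps(1)
        using bounded[OF Cont] G s(1)
        by (intro ghost_sample_mgf[OF design entropy n s(1) _ _ _ f0_measurable pd D fit_in_model[OF lse] joint])
          (auto simp: l2_fun_def)
    qed
    also have "\<dots> = ennreal (2 * real n powr (4 * \<kappa> * D))"
      by (simp only: nn_integral_const PE.emeasure_space_1 mult_1_right)
    finally show ?thesis .
  qed
  have intB: "(\<integral>\<^sup>+x. \<integral>\<^sup>+e. ennreal (B x e) \<partial>PE \<partial>PX) \<le> ennreal (real n powr (6 * \<kappa> * D))"
  proof -
    have "AE x in PX. (\<integral>\<^sup>+e. ennreal (B x e) \<partial>PE) \<le> ennreal (real n powr (6 * \<kappa> * D))"
      using pd AE_space unfolding B_def
      by eventually_elim (rule empirical_mgf[OF lse g D _ _ s])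
    then have "(\<integral>\<^sup>+x. \<integral>\<^sup>+e. ennreal (B x e) \<partial>PE \<partial>PX) \<le> (\<integral>\<^sup>+x. ennreal (real n powr (6 * \<kappa> * D)) \<partial>PX)"
      by (rule nn_integral_mono_AE)
    then show ?thesis by (simp only: nn_integral_const PX.emeasure_space_1 mult_1_right)
  qed
  have "(\<integral>\<^sup>+x. \<integral>\<^sup>+e. ennreal (exp (real n / (8192 * s\<^sup>2) *
            (loss h fh x e - c_bar h * sqdist Disc \<nu> n x g f0))) \<partial>PE \<partial>PX)
     \<le> (\<integral>\<^sup>+x. \<integral>\<^sup>+e. ennreal (A x e) + ennreal (B x e) \<partial>PE \<partial>PX)"
    using split by (intro nn_integral_mono) (simp add: A_def B_def flip: ennreal_plus)
  also have "\<dots> = (\<integral>\<^sup>+w. ennreal (A (fst w) (snd w)) + ennreal (B (fst w) (snd w)) \<partial>(PX \<Otimes>\<^sub>M PE))"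
    using PE.nn_integral_fst[of "\<lambda>w. ennreal (A (fst w) (snd w)) + ennreal (B (fst w) (snd w))" PX] A_meas B_meas
    by (simp add: split_beta')
  also have "\<dots> = (\<integral>\<^sup>+w. ennreal (A (fst w) (snd w)) \<partial>(PX \<Otimes>\<^sub>M PE)) + (\<integral>\<^sup>+w. ennreal (B (fst w) (snd w)) \<partial>(PX \<Otimes>\<^sub>M PE))"
    using A_meas B_meas by (intro nn_integral_add) (auto simp: split_beta')
  also have "\<dots> = (\<integral>\<^sup>+x. \<integral>\<^sup>+e. ennreal (A x e) \<partial>PE \<partial>PX) + (\<integral>\<^sup>+x. \<integral>\<^sup>+e. ennreal (B x e) \<partial>PE \<partial>PX)"
    using PE.nn_integral_fst[of "\<lambda>w. ennreal (A (fst w) (snd w))" PX]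
      PE.nn_integral_fst[of "\<lambda>w. ennreal (B (fst w) (snd w))" PX] A_meas B_meas
    by (simp add: split_beta')
  also have "\<dots> \<le> ennreal (2 * real n powr (4 * \<kappa> * D)) + ennreal (real n powr (6 * \<kappa> * D))"
    by (rule add_mono[OF intA intB])
  also have "\<dots> = ennreal (2 * real n powr (4 * \<kappa> * D) + real n powr (6 * \<kappa> * D))"
    by (simp add: ennreal_plus)
  also have "\<dots> \<le> ennreal (real n powr (7 * \<kappa> * D))"
  proof (rule ennreal_leI)
    have "real n powr (4 * \<kappa> * D) \<le> real n powr (6 * \<kappa> * D)"
      using n D kappa_ge_1 by (intro powr_mono mult_right_mono) auto
    then have "2 * real n powr (4 * \<kappa> * D) + real n powr (6 * \<kappa> * D) \<le> real n powr (6 * \<kappa> * D) * 3" by simp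
    also have "\<dots> \<le> real n powr (6 * \<kappa> * D) * ?N"
    proof (rule mult_left_mono)
      have "3 \<le> real n powr 1" using n by simp
      also have "\<dots> \<le> ?N" using n D kappa_ge_1 mult_mono[of 1 \<kappa> 1 D] by (intro powr_mono) auto
      finally show "3 \<le> ?N" .
    qed simp
    also have "\<dots> = real n powr (7 * \<kappa> * D)" by (simp add: algebra_simps flip: powr_add)
    finally show "2 * real n powr (4 * \<kappa> * D) + real n powr (6 * \<kappa> * D) \<le> real n powr (7 * \<kappa> * D)" .
  qed
  finally show ?thesis .
qed

section \<open>From the exponential moment to risk and tails\<close>

lemma ln_n_ge: "3 / 2 \<le> ln (real n)"
proof -
  have "(exp (3 / 2 :: real))\<^sup>2 = exp 1 ^ 3" by (simp flip: exp_of_nat_mult exp_double)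
  also have "\<dots> \<le> 3 ^ 3" using exp_le by (intro power_mono) auto
  also have "\<dots> \<le> (7 :: real)\<^sup>2" by simp
  finally have "exp (3 / 2 :: real) \<le> 7" by (rule power2_le_imp_le) simp
  also have "\<dots> \<le> real n" using n by simp
  finally show ?thesis using n by (subst ln_ge_iff) auto
qed

text \<open>This amounts to bounding the mean of \<open>Z\<close> by the logarithm of the mean of
  \<open>exp Z\<close>. It uses the tangent line of \<open>exp\<close> at \<open>ln K\<close>, so
  that only nonnegative integrals occur and integrability of the loss is not presupposed. The terms
  \<open>c * (ln K - 1)\<close> and \<open>c\<close> add up to \<open>c * ln K\<close>, that is
  \<open>7 * 8192\<close> penalties at level \<open>s^2\<close>.\<close>

lemma risk_expectation_pos:
  assumes lse: "least_squares_estimator \<nu> n G fh" and G: "G \<subseteq> l2_fun \<nu>" and g: "g \<in> G" and D: "1 \<le> D"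
    and pd: "AE x in PX. real (pdim n (trace_set n x G)) \<le> D"
    and s: "0 < s" "sub_gaussian \<mu> (s\<^sup>2) (\<lambda>z. z)"
    and bounded: "h = Cont \<Longrightarrow> \<forall>f\<in>insert f0 G. \<forall>z\<in>space \<nu>. \<bar>f z\<bar> \<le> s"
  shows "(\<integral>\<^sup>+x. \<integral>\<^sup>+e. ennreal (loss h fh x e) \<partial>PE \<partial>PX)
      \<le> ennreal (c_bar h * (\<integral>z. (f0 z - g z)\<^sup>2 \<partial>\<nu>) + 57344 * s\<^sup>2 * (\<kappa> * D * ln (real n) / real n))"
proof -
  define K where "K = real n powr (7 * \<kappa> * D)"
  define c where "c = 8192 * s\<^sup>2 / real n"
  define Z where "Z x e = real n / (8192 * s\<^sup>2) * (loss h fh x e - c_bar h * sqdist Disc \<nu> n x g f0)" for x e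
  have K: "0 < K" using n by (simp add: K_def)
  have lnK: "ln K = 7 * (\<kappa> * D) * ln (real n)" using n by (simp add: K_def ln_powr)
  have c: "0 < c" using s n by (simp add: c_def)
  have c_bar: "0 \<le> c_bar h" by (cases h) auto
  have kD: "1 \<le> \<kappa> * D" using kappa_ge_1 D mult_mono[of 1 \<kappa> 1 D] by simp
  \<comment> \<open>Keeps \<open>c * (ln K - 1)\<close> nonnegative, so that \<open>ennreal\<close>
    does not truncate it.\<close>
  have lnK1: "1 \<le> ln K"
  proof -
    have "7 * 1 * (3 / 2) \<le> 7 * (\<kappa> * D) * ln (real n)"
      using kD ln_n_ge by (intro mult_mono) auto
    then show ?thesis unfolding lnK by argo
  qed
  have pw: "loss h fh x e \<le> c_bar h * sqdist Disc \<nu> n x g f0 + c * (ln K - 1) + c / K * exp (Z x e)" for x e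
  proof -
    have "1 + (Z x e - ln K) \<le> exp (Z x e - ln K)" by (rule exp_ge_add_one_self)
    also have "\<dots> = exp (Z x e) / K" using K by (simp add: exp_diff)
    finally have "c * Z x e \<le> c * (ln K - 1 + exp (Z x e) / K)" using c by (intro mult_left_mono) auto
    moreover have "c * Z x e = loss h fh x e - c_bar h * sqdist Disc \<nu> n x g f0"
      using s n by (simp add: c_def Z_def)
    ultimately show ?thesis by (simp add: algebra_simps)
  qed
  have gl2: "g \<in> l2_fun \<nu>" using g G by blast
  have [measurable]: "g \<in> borel_measurable \<nu>" using gl2 by (auto simp: l2_fun_def)
  have q_meas: "(\<lambda>x. sqdist Disc \<nu> n x g f0) \<in> borel_measurable PX"
    unfolding sqdist.simps by measurable
  have Z_meas: "(\<lambda>(x, e). ennreal (exp (Z x e))) \<in> borel_measurable (PX \<Otimes>\<^sub>M PE)"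
  proof -
    have [measurable]: "(\<lambda>w. loss h fh (fst w) (snd w)) \<in> borel_measurable (PX \<Otimes>\<^sub>M PE)"
        "(\<lambda>w. sqdist Disc \<nu> n (fst w) g f0) \<in> borel_measurable (PX \<Otimes>\<^sub>M PE)"
      using loss_measurable[OF lse, of h] measurable_compose[OF measurable_fst q_meas] by (simp_all add: split_beta')
    show ?thesis unfolding Z_def split_beta' by measurable
  qed
  have "(\<integral>\<^sup>+x. \<integral>\<^sup>+e. ennreal (loss h fh x e) \<partial>PE \<partial>PX)
    \<le> (\<integral>\<^sup>+x. \<integral>\<^sup>+e. (ennreal (c_bar h) * ennreal (sqdist Disc \<nu> n x g f0) + ennreal (c * (ln K - 1))) + ennreal (c / K) * ennreal (exp (Z x e)) \<partial>PE \<partial>PX)"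
  proof (intro nn_integral_mono)
    fix x e
    have "ennreal (loss h fh x e) \<le> ennreal (c_bar h * sqdist Disc \<nu> n x g f0 + c * (ln K - 1) + c / K * exp (Z x e))"
      by (rule ennreal_leI[OF pw])
    also have "\<dots> = (ennreal (c_bar h) * ennreal (sqdist Disc \<nu> n x g f0) + ennreal (c * (ln K - 1))) + ennreal (c / K) * ennreal (exp (Z x e))"
      using c c_bar lnK1 K sqdist_nonneg[of Disc x g f0]
      by (simp add: ennreal_mult[symmetric] del: sqdist.simps flip: ennreal_plus)
    finally show "ennreal (loss h fh x e) \<le> \<dots>" .
  qed
  also have "\<dots> = (\<integral>\<^sup>+x. (ennreal (c_bar h) * ennreal (sqdist Disc \<nu> n x g f0) + ennreal (c * (ln K - 1))) + ennreal (c / K) * (\<integral>\<^sup>+e. ennreal (exp (Z x e)) \<partial>PE) \<partial>PX)"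
  proof (intro nn_integral_cong)
    fix x assume x: "x \<in> space PX"
    have m: "(\<lambda>e. ennreal (exp (Z x e))) \<in> borel_measurable PE"
      using measurable_compose[OF measurable_Pair1'[OF x] Z_meas] by simp
    show "(\<integral>\<^sup>+e. (ennreal (c_bar h) * ennreal (sqdist Disc \<nu> n x g f0) + ennreal (c * (ln K - 1))) + ennreal (c / K) * ennreal (exp (Z x e)) \<partial>PE)
      = (ennreal (c_bar h) * ennreal (sqdist Disc \<nu> n x g f0) + ennreal (c * (ln K - 1))) + ennreal (c / K) * (\<integral>\<^sup>+e. ennreal (exp (Z x e)) \<partial>PE)"
      using m by (subst nn_integral_add) (auto simp only: nn_integral_const PE.emeasure_space_1 mult_1_right nn_integral_cmult
          intro!: borel_measurable_const borel_measurable_times_ennreal)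
  qed
  also have "\<dots> = ennreal (c_bar h) * (\<integral>\<^sup>+x. ennreal (sqdist Disc \<nu> n x g f0) \<partial>PX) + ennreal (c * (ln K - 1))
     + ennreal (c / K) * (\<integral>\<^sup>+x. \<integral>\<^sup>+e. ennreal (exp (Z x e)) \<partial>PE \<partial>PX)"
  proof -
    have m1[measurable]: "(\<lambda>x. ennreal (sqdist Disc \<nu> n x g f0)) \<in> borel_measurable PX"
      using q_meas by (simp del: sqdist.simps)
    have m2[measurable]: "(\<lambda>x. \<integral>\<^sup>+e. ennreal (exp (Z x e)) \<partial>PE) \<in> borel_measurable PX"
      using PE.borel_measurable_nn_integral_fst[OF Z_meas] by simp
    show ?thesis
      by (subst nn_integral_add, measurable, subst nn_integral_add, measurable)
        (simp only: nn_integral_const PX.emeasure_space_1 mult_1_right nn_integral_cmult[OF m1] nn_integral_cmult[OF m2])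
  qed
  also have "\<dots> \<le> ennreal (c_bar h) * ennreal (\<integral>z. (f0 z - g z)\<^sup>2 \<partial>\<nu>) + ennreal (c * (ln K - 1)) + ennreal (c / K) * ennreal K"
    unfolding empirical_mean[OF gl2] Z_def K_def
    by (intro add_mono mult_left_mono risk_mgf[OF lse G g D pd s bounded]) auto
  also have "\<dots> = ennreal (c_bar h * (\<integral>z. (f0 z - g z)\<^sup>2 \<partial>\<nu>) + c * (ln K - 1) + c)"
    using c c_bar lnK1 K by (simp add: ennreal_mult[symmetric] flip: ennreal_plus)
  also have "c_bar h * (\<integral>z. (f0 z - g z)\<^sup>2 \<partial>\<nu>) + c * (ln K - 1) + c
     = c_bar h * (\<integral>z. (f0 z - g z)\<^sup>2 \<partial>\<nu>) + 57344 * s\<^sup>2 * (\<kappa> * D * ln (real n) / real n)"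
    by (simp add: c_def lnK algebra_simps diff_divide_distrib)
  finally show ?thesis .
qed

text \<open>The level is raised to \<open>L + \<delta> / a\<close>, which is positive even for
  \<open>L = 0\<close>. As \<open>a\<close> is the coefficient of the level in the bound, the bound
  grows by exactly \<open>\<delta>\<close>.\<close>

lemma risk_expectation:
  assumes lse: "least_squares_estimator \<nu> n G fh" and G: "G \<subseteq> l2_fun \<nu>" and g: "g \<in> G" and D: "1 \<le> D"
    and pd: "AE x in PX. real (pdim n (trace_set n x G)) \<le> D"
    and L: "0 \<le> L" "sub_gaussian \<mu> L (\<lambda>z. z)"
    and bounded: "h = Cont \<Longrightarrow> \<forall>f\<in>insert f0 G. \<forall>z\<in>space \<nu>. (f z)\<^sup>2 \<le> L"
  shows "(\<integral>\<^sup>+x. \<integral>\<^sup>+e. ennreal (loss h fh x e) \<partial>PE \<partial>PX)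
      \<le> ennreal (c_bar h * (\<integral>z. (f0 z - g z)\<^sup>2 \<partial>\<nu>) + 57344 * (L * \<kappa> * D * ln (real n) / real n))"
    (is "?l \<le> ennreal ?r")
proof (rule ennreal_le_epsilon)
  fix \<delta> :: real assume \<delta>: "0 < \<delta>"
  define a where "a = 57344 * (\<kappa> * D * ln (real n) / real n)"
  have a: "0 < a" using kappa_ge_1 D ln_n_ge n by (simp add: a_def)
  define s where "s = sqrt (L + \<delta> / a)"
  have s2: "s\<^sup>2 = L + \<delta> / a" and s: "0 < s" using L(1) \<delta> a by (simp_all add: s_def add_nonneg_pos)
  have "?l \<le> ennreal (c_bar h * (\<integral>z. (f0 z - g z)\<^sup>2 \<partial>\<nu>) + 57344 * s\<^sup>2 * (\<kappa> * D * ln (real n) / real n))"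
  proof (rule risk_expectation_pos[OF lse G g D pd s])
    show "sub_gaussian \<mu> (s\<^sup>2) (\<lambda>z. z)" using L(2) \<delta> a by (auto simp: s2 intro: sub_gaussian_mono)
    show "\<forall>f\<in>insert f0 G. \<forall>z\<in>space \<nu>. \<bar>f z\<bar> \<le> s" if "h = Cont"
    proof (intro ballI)
      fix f z assume "f \<in> insert f0 G" "z \<in> space \<nu>"
      with bounded[OF that] have "(f z)\<^sup>2 \<le> L" by blast
      also have "L \<le> L + \<delta> / a" using \<delta> a by simp
      finally have "sqrt ((f z)\<^sup>2) \<le> s" unfolding s_def by (rule real_sqrt_le_mono)
      then show "\<bar>f z\<bar> \<le> s" by simp
    qed
  qed
  also have "c_bar h * (\<integral>z. (f0 z - g z)\<^sup>2 \<partial>\<nu>) + 57344 * s\<^sup>2 * (\<kappa> * D * ln (real n) / real n) = ?r + \<delta>"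
  proof -
    have "57344 * s\<^sup>2 * (\<kappa> * D * ln (real n) / real n) = a * s\<^sup>2" by (simp add: a_def)
    also have "\<dots> = a * L + \<delta>" using a by (simp add: s2 distrib_left)
    also have "a * L = 57344 * (L * \<kappa> * D * ln (real n) / real n)" by (simp add: a_def)
    finally show ?thesis by simp
  qed
  also have "ennreal (?r + \<delta>) = ennreal ?r + ennreal \<delta>"
  proof (rule ennreal_plus)
    have "0 \<le> c_bar h" by (cases h) auto
    then show "0 \<le> ?r" using L(1) kappa_ge_1 D ln_n_ge by simp
  qed (use \<delta> in simp)
  finally show "?l \<le> ennreal ?r + ennreal \<delta>" .
qed

text \<open>Since \<open>f0\<close> lies in the model, it serves as competitor and the bias term
  vanishes. Markov's inequality at 11 units of \<open>8192\<close> penalties loses the exponent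
  \<open>7 * \<kappa> * D\<close> to the moment and keeps
  \<open>4 * \<kappa> * D \<ge> 4\<close>.\<close>

lemma risk_tail:
  assumes lse: "least_squares_estimator \<nu> n G fh" and G: "G \<subseteq> l2_fun \<nu>" and f0_G: "f0 \<in> G" and D: "1 \<le> D"
    and pd: "AE x in PX. real (pdim n (trace_set n x G)) \<le> D"
    and L: "0 < L" "sub_gaussian \<mu> L (\<lambda>z. z)"
    and bounded: "h = Cont \<Longrightarrow> \<forall>f\<in>insert f0 G. \<forall>z\<in>space \<nu>. (f z)\<^sup>2 \<le> L"
    and u: "90112 \<le> u"
  shows "emeasure (PX \<Otimes>\<^sub>M PE) {w \<in> space (PX \<Otimes>\<^sub>M PE). u * (L * \<kappa> * D * ln (real n) / real n) < loss h fh (fst w) (snd w)}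
      \<le> ennreal (1 / real n ^ 4)"
proof -
  define s where "s = sqrt L"
  have s: "0 < s" "s\<^sup>2 = L" using L by (auto simp: s_def)
  have sg: "sub_gaussian \<mu> (s\<^sup>2) (\<lambda>z. z)" using L s by simp
  have bounded': "\<forall>f\<in>insert f0 G. \<forall>z\<in>space \<nu>. \<bar>f z\<bar> \<le> s" if "h = Cont"
    using bounded[OF that] s by (metis abs_le_square_iff abs_of_pos power2_abs s_def real_sqrt_abs real_sqrt_le_mono)
  define E where "E = {w \<in> space (PX \<Otimes>\<^sub>M PE). u * (L * \<kappa> * D * ln (real n) / real n) < loss h fh (fst w) (snd w)}"
  have kD: "1 \<le> \<kappa> * D" using kappa_ge_1 D mult_mono[of 1 \<kappa> 1 D] by simp
  have lm [measurable]: "(\<lambda>w. loss h fh (fst w) (snd w)) \<in> borel_measurable (PX \<Otimes>\<^sub>M PE)"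
    using loss_measurable[OF lse, of h] by (simp add: split_beta')
  then have E: "E \<in> sets (PX \<Otimes>\<^sub>M PE)" unfolding E_def by measurable
  let ?Z = "\<lambda>w. real n / (8192 * s\<^sup>2) * (loss h fh (fst w) (snd w) - c_bar h * sqdist Disc \<nu> n (fst w) f0 f0)"
  have Z: "?Z w = real n / (8192 * s\<^sup>2) * loss h fh (fst w) (snd w)" for w by (simp add: sqdist_refl)
  have "emeasure (PX \<Otimes>\<^sub>M PE) E = (\<integral>\<^sup>+w. indicator E w \<partial>(PX \<Otimes>\<^sub>M PE))" using E by simp
  also have "\<dots> \<le> (\<integral>\<^sup>+w. ennreal (real n powr (- (11 * \<kappa> * D))) * ennreal (exp (?Z w)) \<partial>(PX \<Otimes>\<^sub>M PE))"
  proof (rule nn_integral_mono)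
    fix w assume "w \<in> space (PX \<Otimes>\<^sub>M PE)"
    show "indicator E w \<le> ennreal (real n powr (- (11 * \<kappa> * D))) * ennreal (exp (?Z w))"
    proof (cases "w \<in> E")
      case True
      have "11 * (\<kappa> * D * ln (real n)) \<le> u / 8192 * (\<kappa> * D * ln (real n))"
        using u kD ln_n_ge by (intro mult_right_mono) auto
      also have "\<dots> = real n / (8192 * L) * (u * (L * \<kappa> * D * ln (real n) / real n))"
        using L n by simp
      also have "\<dots> \<le> real n / (8192 * L) * loss h fh (fst w) (snd w)"
        using True L by (intro mult_left_mono) (auto simp: E_def)
      finally have "11 * (\<kappa> * D * ln (real n)) \<le> ?Z w" unfolding Z unfolding s(2) .
      moreover have "real n powr (- (11 * \<kappa> * D)) = exp (- (11 * (\<kappa> * D * ln (real n))))"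
        using n by (simp add: powr_def)
      ultimately have "1 \<le> real n powr (- (11 * \<kappa> * D)) * exp (?Z w)"
        by (simp only: exp_add[symmetric]) simp
      then have "ennreal 1 \<le> ennreal (real n powr (- (11 * \<kappa> * D)) * exp (?Z w))" by (rule ennreal_leI)
      then show ?thesis using True by (simp only: ennreal_mult[OF powr_ge_zero exp_ge_zero] indicator_simps ennreal_1)
    qed simp
  qed
  also have "\<dots> = ennreal (real n powr (- (11 * \<kappa> * D))) * (\<integral>\<^sup>+w. ennreal (exp (?Z w)) \<partial>(PX \<Otimes>\<^sub>M PE))"
    unfolding Z by (intro nn_integral_cmult) measurable
  also have "(\<integral>\<^sup>+w. ennreal (exp (?Z w)) \<partial>(PX \<Otimes>\<^sub>M PE)) = (\<integral>\<^sup>+x. \<integral>\<^sup>+e. ennreal (exp (?Z (x, e))) \<partial>PE \<partial>PX)"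
    unfolding Z by (intro PE.nn_integral_fst[symmetric]) measurable
  also have "\<dots> \<le> ennreal (real n powr (7 * \<kappa> * D))"
    using risk_mgf[OF lse G f0_G D pd s(1) sg bounded'] by (simp only: fst_conv snd_conv)
  also have "ennreal (real n powr (- (11 * \<kappa> * D))) * ennreal (real n powr (7 * \<kappa> * D)) = ennreal (real n powr (- 4 * (\<kappa> * D)))"
    by (simp add: ennreal_mult[symmetric] algebra_simps flip: powr_add)
  also have "\<dots> \<le> ennreal (real n powr (- 4))"
    using n kD by (intro ennreal_leI powr_mono) auto
  also have "real n powr (- 4) = 1 / real n ^ 4"
    using n by (simp add: powr_minus divide_inverse)
  finally show ?thesis by (simp add: E_def mult_left_mono)
qed

end

section \<open>The adaptive estimator\<close>

lemma fourth_power_le_exp: "y ^ 4 \<le> 64 * (exp y + exp (- y))" for y :: real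
proof -
  have "1 + \<bar>y\<bar> / 2 + (\<bar>y\<bar> / 2)\<^sup>2 / 2 \<le> exp (\<bar>y\<bar> / 2)"
    by (rule exp_lower_Taylor_quadratic) simp
  moreover have "(\<bar>y\<bar> / 2)\<^sup>2 / 2 = y\<^sup>2 / 8" by (simp add: power_divide)
  ultimately have "y\<^sup>2 / 8 \<le> exp (\<bar>y\<bar> / 2)" using abs_ge_zero[of y] by linarith
  then have "(y\<^sup>2 / 8)\<^sup>2 \<le> (exp (\<bar>y\<bar> / 2))\<^sup>2" by (intro power_mono) auto
  also have "\<dots> = exp \<bar>y\<bar>" by (simp flip: exp_double)
  also have "\<dots> \<le> exp y + exp (- y)" by (simp add: abs_if)
  finally show ?thesis by (simp add: power_divide flip: power_mult)
qed

text \<open>Used for the square of the crude loss bound, which involves fourth powers of the noise.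
  The choice \<open>t = 2 / sqrt L\<close> makes the exponent \<open>L * t^2 / 2\<close> equal to 2,
  and \<open>exp 2 \<le> 9\<close>.\<close>

lemma sub_gaussian_fourth_moment:
  fixes \<mu> :: "real measure"
  assumes sets: "sets \<mu> = sets borel" and sg: "sub_gaussian \<mu> L (\<lambda>z. z)" and L: "0 < L"
  shows "(\<integral>\<^sup>+z. ennreal (z ^ 4) \<partial>\<mu>) \<le> ennreal (72 * L\<^sup>2)"
proof -
  have [measurable_cong]: "sets \<mu> = sets borel" by (rule sets)
  define t where "t = 2 / sqrt L"
  have t: "0 < t" "t\<^sup>2 = 4 / L" "t ^ 4 = 16 / L\<^sup>2"
  proof -
    show "0 < t" "t\<^sup>2 = 4 / L" using L by (simp_all add: t_def power_divide)
    then show "t ^ 4 = 16 / L\<^sup>2" using power_mult[of t 2 2] by (simp add: power_divide)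
  qed
  have "(\<integral>\<^sup>+z. ennreal (z ^ 4) \<partial>\<mu>) \<le> (\<integral>\<^sup>+z. ennreal (4 * L\<^sup>2) * (ennreal (exp (t * z)) + ennreal (exp (- t * z))) \<partial>\<mu>)"
  proof (rule nn_integral_mono)
    fix z
    have "z ^ 4 = L\<^sup>2 / 16 * (t * z) ^ 4" using L by (simp add: power_mult_distrib t(3))
    also have "\<dots> \<le> L\<^sup>2 / 16 * (64 * (exp (t * z) + exp (- (t * z))))"
      by (intro mult_left_mono fourth_power_le_exp) auto
    also have "\<dots> = 4 * L\<^sup>2 * (exp (t * z) + exp (- t * z))" by simp
    finally have "z ^ 4 \<le> 4 * L\<^sup>2 * (exp (t * z) + exp (- t * z))" .
    then show "ennreal (z ^ 4) \<le> ennreal (4 * L\<^sup>2) * (ennreal (exp (t * z)) + ennreal (exp (- t * z)))"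
      by (simp add: ennreal_leI flip: ennreal_plus ennreal_mult)
  qed
  also have "\<dots> = ennreal (4 * L\<^sup>2) * ((\<integral>\<^sup>+z. ennreal (exp (t * z)) \<partial>\<mu>) + (\<integral>\<^sup>+z. ennreal (exp (- t * z)) \<partial>\<mu>))"
    by (subst nn_integral_cmult, measurable, subst nn_integral_add, measurable)
  also have "\<dots> \<le> ennreal (4 * L\<^sup>2) * (ennreal 9 + ennreal 9)"
  proof (intro mult_left_mono add_mono)
    have "exp (L * (a)\<^sup>2 / 2) \<le> 9" if "a\<^sup>2 = 4 / L" for a
    proof -
      have "exp (L * a\<^sup>2 / 2) = exp 1 ^ 2" using L that by (simp flip: exp_of_nat_mult)
      also have "\<dots> \<le> 3 ^ 2" using exp_le by (intro power_mono) auto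
      finally show ?thesis by simp
    qed
    then have *: "(\<integral>\<^sup>+z. ennreal (exp (a * z)) \<partial>\<mu>) \<le> ennreal 9" if "a\<^sup>2 = 4 / L" for a
      using sg[unfolded sub_gaussian_def, rule_format, of a] that by (meson ennreal_leI order_trans)
    show "(\<integral>\<^sup>+z. ennreal (exp (t * z)) \<partial>\<mu>) \<le> ennreal 9" by (rule *[OF t(2)])
    show "(\<integral>\<^sup>+z. ennreal (exp (- t * z)) \<partial>\<mu>) \<le> ennreal 9" by (rule *) (simp add: t(2))
  qed auto
  also have "\<dots> = ennreal (4 * L\<^sup>2) * ennreal 18" by simp
  also have "\<dots> = ennreal (72 * L\<^sup>2)" by (subst ennreal_mult[symmetric]) auto
  finally show ?thesis .
qed

text \<open>Index \<open>N\<close> always passes its own test, having distance 0 to itself, so the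
  minimum is taken over a nonempty set.\<close>

lemma adaptive_index_spec:
  assumes N: "1 \<le> N" and refl: "d (f N) (f N) = 0" and pen: "0 \<le> t * pen N"
  defines "k \<equiv> adaptive_index d pen t N f"
  shows "k \<in> {1..N}" "\<And>m. m \<in> {k..N} \<Longrightarrow> d (f k) (f m) \<le> t * pen m"
    "\<And>j. j \<in> {1..N} \<Longrightarrow> (\<And>m. m \<in> {j..N} \<Longrightarrow> d (f j) (f m) \<le> t * pen m) \<Longrightarrow> k \<le> j"
proof -
  let ?S = "{m \<in> {1..N}. \<forall>m'\<in>{m..N}. d (f m) (f m') \<le> t * pen m'}"
  have fin: "finite ?S" by simp
  have "N \<in> ?S" using N refl pen by auto
  then have "k \<in> ?S" unfolding k_def adaptive_index_def by (intro Min_in[OF fin]) auto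
  then show "k \<in> {1..N}" "\<And>m. m \<in> {k..N} \<Longrightarrow> d (f k) (f m) \<le> t * pen m" by auto
  show "k \<le> j" if "j \<in> {1..N}" "\<And>m. m \<in> {j..N} \<Longrightarrow> d (f j) (f m) \<le> t * pen m" for j
    unfolding k_def adaptive_index_def using that by (intro Min_le[OF fin]) auto
qed

text \<open>As \<open>360448 = 4 * 90112\<close>, a quarter of the selection threshold lies in the
  range of the tail bound.\<close>

lemma t_const_ge: "360448 \<le> t_const h"
  by (cases h) (auto simp: t_const_def v_const_def)

text \<open>One locale serves both norms: the level \<open>L\<close> bounds the noise and, for the
  continuous norm, also the squares of all functions. That \<open>N\<close> minimises the criterion
  enters only in the theorem.\<close>

locale adaptive_regression = random_design +
  fixes P :: "nat \<Rightarrow> ('a \<Rightarrow> real) set" and D :: "nat \<Rightarrow> real" and L :: real and h :: norm_kind and N :: nat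
    and fh :: "nat \<Rightarrow> (nat \<Rightarrow> 'a) \<Rightarrow> (nat \<Rightarrow> real) \<Rightarrow> 'a \<Rightarrow> real"
  assumes P_l2: "1 \<le> m \<Longrightarrow> P m \<subseteq> l2_fun \<nu>"
    and P_mono: "1 \<le> m \<Longrightarrow> m \<le> m' \<Longrightarrow> P m \<subseteq> P m'"
    and D_ge_1: "1 \<le> m \<Longrightarrow> 1 \<le> D m"
    and D_pdim: "1 \<le> m \<Longrightarrow> AE x in PiM {1..n} (\<lambda>_. \<nu>). real (pdim n (trace_set n x (P m))) \<le> D m"
    and lse: "1 \<le> m \<Longrightarrow> least_squares_estimator \<nu> n (P m) (fh m)"
    and L: "0 \<le> L" "sub_gaussian \<mu> L (\<lambda>z. z)"
    and bounded_Cont: "h = Cont \<Longrightarrow> 1 \<le> m \<Longrightarrow> \<forall>f\<in>insert f0 (P m). \<forall>z\<in>space \<nu>. (f z)\<^sup>2 \<le> L"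
    and N: "1 \<le> N" "N \<le> n"
begin

abbreviation "pen \<equiv> penalty L \<kappa> D n"
abbreviation "PXE \<equiv> PX \<Otimes>\<^sub>M PE"
abbreviation "loss_of m w \<equiv> loss h (fh m) (fst w) (snd w)"

lemma pen_nonneg: "1 \<le> m \<Longrightarrow> 0 \<le> pen m"
  using L(1) kappa_ge_1 D_ge_1[of m] ln_n_ge by (simp add: penalty_def)

lemma t_pen_nonneg: "1 \<le> m \<Longrightarrow> 0 \<le> t_const h * pen m"
  using pen_nonneg[of m] t_const_ge[of h] by simp

lemma fh_in: "1 \<le> m \<Longrightarrow> x \<in> space PX \<Longrightarrow> fh m x (response x e) \<in> P m"
  by (rule fit_in_model[OF lse])

lemma loss_of_measurable: "1 \<le> m \<Longrightarrow> loss_of m \<in> borel_measurable PXE"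
  using loss_measurable[OF lse, of m h] by (simp add: split_beta')

lemma loss_of_expectation:
  assumes m: "1 \<le> m" and g: "g \<in> P m"
  shows "(\<integral>\<^sup>+w. ennreal (loss_of m w) \<partial>PXE) \<le> ennreal (c_bar h * (\<integral>z. (f0 z - g z)\<^sup>2 \<partial>\<nu>) + 57344 * pen m)"
proof -
  have "(\<integral>\<^sup>+w. ennreal (loss_of m w) \<partial>PXE) = (\<integral>\<^sup>+x. \<integral>\<^sup>+e. ennreal (loss h (fh m) x e) \<partial>PE \<partial>PX)"
    using PE.nn_integral_fst[of "\<lambda>w. ennreal (loss_of m w)" PX] loss_of_measurable[OF m] by simp
  also have "\<dots> \<le> ennreal (c_bar h * (\<integral>z. (f0 z - g z)\<^sup>2 \<partial>\<nu>) + 57344 * pen m)"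
    unfolding penalty_def
    by (rule risk_expectation[OF lse[OF m] P_l2[OF m] g D_ge_1[OF m] D_pdim[OF m] L bounded_Cont[OF _ m]])
  finally show ?thesis .
qed

definition selected :: "(nat \<Rightarrow> 'a) \<Rightarrow> (nat \<Rightarrow> real) \<Rightarrow> nat" where
  "selected x e = adaptive_index (sqdist h \<nu> n x) pen (t_const h) N (\<lambda>m. fh m x (response x e))"

lemma adaptive_loss_eq:
  "adaptive_loss h \<nu> n L \<kappa> D N fh f0 x (response x e) = loss h (fh (selected x e)) x e"
  by (simp add: adaptive_loss_def selected_def)

lemma selected_spec:
  shows "selected x e \<in> {1..N}"
    "m \<in> {selected x e..N} \<Longrightarrow>
      sqdist h \<nu> n x (fh (selected x e) x (response x e)) (fh m x (response x e)) \<le> t_const h * pen m"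
    "j \<in> {1..N} \<Longrightarrow> (\<And>m. m \<in> {j..N} \<Longrightarrow>
        sqdist h \<nu> n x (fh j x (response x e)) (fh m x (response x e)) \<le> t_const h * pen m) \<Longrightarrow> selected x e \<le> j"
  using adaptive_index_spec[of N "sqdist h \<nu> n x" "\<lambda>m. fh m x (response x e)" "t_const h" pen]
    N(1) sqdist_refl t_pen_nonneg[OF N(1)]
  unfolding selected_def by blast+

lemma adaptive_loss_le:
  assumes x: "x \<in> space PX" and m: "selected x e \<le> m" "m \<le> N"
  shows "loss h (fh (selected x e)) x e \<le> 2 * t_const h * pen m + 2 * loss h (fh m) x e"
proof -
  have s: "1 \<le> selected x e" using selected_spec(1)[of x e] by simp
  then have "loss h (fh (selected x e)) x e
     \<le> 2 * sqdist h \<nu> n x (fh (selected x e) x (response x e)) (fh m x (response x e)) + 2 * loss h (fh m) x e"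
    using m fh_in[OF _ x] P_l2 f0 by (intro sqdist_triangle) (meson order_trans subsetD)+
  moreover have "sqdist h \<nu> n x (fh (selected x e) x (response x e)) (fh m x (response x e)) \<le> t_const h * pen m"
    using m by (intro selected_spec(2)) auto
  ultimately show ?thesis by linarith
qed

text \<open>The selected index never exceeds \<open>N\<close>, so the selected fit can always be
  compared with the fit of index \<open>N\<close>. The majorant \<open>U\<close> involves this fixed
  index only and is therefore measurable, as an outer expectation requires.\<close>

lemma adaptive_oracle_bound:
  assumes g: "g \<in> P N"
  shows "\<exists>U\<in>borel_measurable PXE.
    (\<forall>w\<in>space PXE. ennreal (adaptive_loss h \<nu> n L \<kappa> D N fh f0 (fst w) (response (fst w) (snd w))) \<le> U w) \<and>
    (\<integral>\<^sup>+w. U w \<partial>PXE) \<le> ennreal (2 * (c_bar h * (\<integral>z. (f0 z - g z)\<^sup>2 \<partial>\<nu>) + (57344 + t_const h) * pen N))"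
proof (intro bexI conjI ballI)
  let ?U = "\<lambda>w. ennreal (2 * t_const h * pen N) + ennreal 2 * ennreal (loss_of N w)"
  note [measurable] = loss_of_measurable[OF N(1)]
  show "?U \<in> borel_measurable PXE" by measurable
  fix w assume "w \<in> space PXE"
  then have "fst w \<in> space PX" by (auto simp: space_pair_measure)
  from adaptive_loss_le[OF this, of "snd w" N] selected_spec(1)[of "fst w" "snd w"]
  have "loss h (fh (selected (fst w) (snd w))) (fst w) (snd w) \<le> 2 * t_const h * pen N + 2 * loss_of N w"
    by simp
  then have "ennreal (loss_of (selected (fst w) (snd w)) w) \<le> ennreal (2 * t_const h * pen N + 2 * loss_of N w)"
    by (rule ennreal_leI)
  also have "\<dots> = ?U w"
    using t_pen_nonneg[OF N(1)] sqdist_nonneg[of h "fst w" _ f0] by (simp add: ennreal_plus ennreal_mult)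
  finally show "ennreal (adaptive_loss h \<nu> n L \<kappa> D N fh f0 (fst w) (response (fst w) (snd w))) \<le> ?U w"
    by (simp add: adaptive_loss_eq)
next
  note [measurable] = loss_of_measurable[OF N(1)]
  have "(\<integral>\<^sup>+w. ennreal (2 * t_const h * pen N) + ennreal 2 * ennreal (loss_of N w) \<partial>PXE)
     = ennreal (2 * t_const h * pen N) + ennreal 2 * (\<integral>\<^sup>+w. ennreal (loss_of N w) \<partial>PXE)"
    by (subst nn_integral_add, measurable, subst nn_integral_cmult, measurable)
      (simp only: nn_integral_const PXE.P.emeasure_space_1 mult_1_right)
  also have "\<dots> \<le> ennreal (2 * t_const h * pen N) + ennreal 2 * ennreal (c_bar h * (\<integral>z. (f0 z - g z)\<^sup>2 \<partial>\<nu>) + 57344 * pen N)"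
    by (intro add_left_mono mult_left_mono loss_of_expectation[OF N(1) g]) auto
  also have "\<dots> = ennreal (2 * (c_bar h * (\<integral>z. (f0 z - g z)\<^sup>2 \<partial>\<nu>) + (57344 + t_const h) * pen N))"
  proof -
    have "0 \<le> c_bar h" by (cases h) auto
    then have nonneg: "0 \<le> c_bar h * (\<integral>z. (f0 z - g z)\<^sup>2 \<partial>\<nu>) + 57344 * pen N" (is "0 \<le> ?b")
      using pen_nonneg[OF N(1)] by simp
    have "ennreal (2 * t_const h * pen N) + ennreal 2 * ennreal ?b = ennreal (2 * t_const h * pen N) + ennreal (2 * ?b)"
      using nonneg by (simp only: ennreal_mult zero_le_numeral)
    also have "\<dots> = ennreal (2 * t_const h * pen N + 2 * ?b)"
      using nonneg t_pen_nonneg[OF N(1)] by (intro ennreal_plus[symmetric]) auto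
    also have "2 * t_const h * pen N + 2 * ?b = 2 * (c_bar h * (\<integral>z. (f0 z - g z)\<^sup>2 \<partial>\<nu>) + (57344 + t_const h) * pen N)"
      by (simp add: algebra_simps)
    finally show ?thesis .
  qed
  finally show "(\<integral>\<^sup>+w. ennreal (2 * t_const h * pen N) + ennreal 2 * ennreal (loss_of N w) \<partial>PXE)
    \<le> ennreal (2 * (c_bar h * (\<integral>z. (f0 z - g z)\<^sup>2 \<partial>\<nu>) + (57344 + t_const h) * pen N))" .
qed

text \<open>The penalties are not assumed monotone in the index, so the loss of \<open>fh m0\<close>
  is compared with every \<open>pen m\<close>. The factor \<open>1 / 4\<close> comes from the
  triangle inequality for squared distances, which gives twice the sum of two losses.\<close>

definition bad :: "nat \<Rightarrow> ((nat \<Rightarrow> 'a) \<times> (nat \<Rightarrow> real)) set" where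
  "bad m0 = (\<Union>m\<in>{m0..N}.
     {w \<in> space PXE. t_const h / 4 * pen m < loss_of m0 w} \<union>
     {w \<in> space PXE. t_const h / 4 * pen m < loss_of m w})"

lemma bad_sets:
  assumes "1 \<le> m0" shows "bad m0 \<in> sets PXE"
proof -
  have meas: "{w \<in> space PXE. a < loss_of m w} \<in> sets PXE" if "m0 \<le> m" for m a
  proof -
    have [measurable]: "loss_of m \<in> borel_measurable PXE"
      using assms that by (intro loss_of_measurable) simp
    show ?thesis by measurable
  qed
  show ?thesis
    unfolding bad_def
  proof (rule sets.finite_UN)
    fix m assume "m \<in> {m0..N}"
    then have m: "m0 \<le> m" by simp
    show "{w \<in> space PXE. t_const h / 4 * pen m < loss_of m0 w}
        \<union> {w \<in> space PXE. t_const h / 4 * pen m < loss_of m w} \<in> sets PXE"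
      by (rule sets.Un[OF meas[OF order_refl] meas[OF m]])
  qed simp
qed

lemma selected_le_if_not_bad:
  assumes m0: "m0 \<in> {1..N}" and w: "w \<in> space PXE" "w \<notin> bad m0"
  shows "selected (fst w) (snd w) \<le> m0"
proof (rule selected_spec(3)[OF m0])
  fix m assume m: "m \<in> {m0..N}"
  let ?x = "fst w" and ?e = "snd w"
  have x: "?x \<in> space PX" using w(1) by (auto simp: space_pair_measure)
  have le: "loss_of m0 w \<le> t_const h / 4 * pen m" "loss_of m w \<le> t_const h / 4 * pen m"
    using w m by (auto simp: bad_def not_less)
  have sym: "sqdist h \<nu> n ?x f0 (fh m ?x (response ?x ?e)) = loss_of m w"
    by (cases h) (simp_all add: sqdist.simps power2_commute)
  have "sqdist h \<nu> n ?x (fh m0 ?x (response ?x ?e)) (fh m ?x (response ?x ?e))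
    \<le> 2 * loss_of m0 w + 2 * sqdist h \<nu> n ?x f0 (fh m ?x (response ?x ?e))"
    using m m0 fh_in[OF _ x] P_l2 f0 by (intro sqdist_triangle) (meson atLeastAtMost_iff order_trans subsetD)+
  then show "sqdist h \<nu> n ?x (fh m0 ?x (response ?x ?e)) (fh m ?x (response ?x ?e)) \<le> t_const h * pen m"
    unfolding sym using le by linarith
qed

text \<open>A union bound over at most \<open>n\<close> indices with two events each loses one power
  of \<open>n\<close>. The comparison of \<open>fh m0\<close> with \<open>pen m\<close> fits the
  tail bound because \<open>D m\<close> also dominates the pseudo-dimension of the smaller
  model.\<close>

lemma emeasure_bad:
  assumes m0: "m0 \<in> {1..N}" "f0 \<in> P m0" and L_pos: "0 < L"
  shows "emeasure PXE (bad m0) \<le> ennreal (2 / real n ^ 3)"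
proof -
  have u: "90112 \<le> t_const h / 4" using t_const_ge[of h] by simp
  let ?A = "\<lambda>m k. {w \<in> space PXE. t_const h / 4 * pen m < loss_of k w}"
  have A: "?A m k \<in> sets PXE" if "1 \<le> k" for m k
    using loss_of_measurable[OF that] by measurable
  have tail: "emeasure PXE (?A m k) \<le> ennreal (1 / real n ^ 4)" if m: "m \<in> {m0..N}" and k: "k \<in> {m0, m}" for m k
  proof -
    have k1: "1 \<le> k" and m1: "1 \<le> m" and sub: "P k \<subseteq> P m" "P m0 \<subseteq> P k" using m k m0 P_mono by auto
    have f0_k: "f0 \<in> P k" using sub m0 by auto
    have "AE x in PX. real (pdim n (trace_set n x (P k))) \<le> D m"
      using D_pdim[OF m1]
    proof eventually_elim
      case (elim x)
      moreover have "pdim n (trace_set n x (P k)) \<le> pdim n (trace_set n x (P m))"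
        using sub by (intro pdim_mono) (auto simp: trace_set_def)
      ultimately show ?case by linarith
    qed
    then show ?thesis
      unfolding penalty_def
      by (rule risk_tail[OF lse[OF k1] P_l2[OF k1] f0_k D_ge_1[OF m1] _ L_pos L(2) bounded_Cont[OF _ k1] u])
  qed
  have "emeasure PXE (bad m0) \<le> (\<Sum>m\<in>{m0..N}. emeasure PXE (?A m m0 \<union> ?A m m))"
    unfolding bad_def using m0 A by (intro emeasure_subadditive_finite) auto
  also have "\<dots> \<le> (\<Sum>m\<in>{m0..N}. ennreal (1 / real n ^ 4) + ennreal (1 / real n ^ 4))"
  proof (rule sum_mono)
    fix m assume m: "m \<in> {m0..N}"
    have "emeasure PXE (?A m m0 \<union> ?A m m) \<le> emeasure PXE (?A m m0) + emeasure PXE (?A m m)"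
      using m m0 by (intro emeasure_subadditive A) auto
    also have "\<dots> \<le> ennreal (1 / real n ^ 4) + ennreal (1 / real n ^ 4)"
      by (intro add_mono tail[OF m]) auto
    finally show "emeasure PXE (?A m m0 \<union> ?A m m) \<le> ennreal (1 / real n ^ 4) + ennreal (1 / real n ^ 4)" .
  qed
  also have "\<dots> = ennreal (real (card {m0..N}) * (2 / real n ^ 4))"
    by (simp add: ennreal_of_nat_eq_real_of_nat flip: ennreal_plus ennreal_mult)
  also have "\<dots> \<le> ennreal (real n * (2 / real n ^ 4))"
    using m0(1) N(2) by (intro ennreal_leI mult_right_mono) auto
  also have "real n * (2 / real n ^ 4) = 2 / real n ^ 3"
    using n by (simp add: power_eq_if)
  finally show ?thesis .
qed

text \<open>An additive form of Cauchy-Schwarz: \<open>R \<le> R^2 / c + c\<close> on the bad event.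
  With \<open>c = 16 * n * L\<close> the two terms are \<open>72 * L / n\<close> and
  \<open>32 * L / n^2\<close>, the latter at most \<open>5 * L / n\<close> for
  \<open>n \<ge> 7\<close>. For \<open>L = 0\<close> the losses in question have mean 0 and the
  event is null.\<close>

lemma bad_remainder:
  assumes m0: "m0 \<in> {1..N}" "f0 \<in> P m0"
    and R: "R \<in> borel_measurable PXE" "0 < L \<Longrightarrow> (\<integral>\<^sup>+w. ennreal ((R w)\<^sup>2) \<partial>PXE) \<le> ennreal (1152 * L\<^sup>2)"
  shows "(\<integral>\<^sup>+w. ennreal (R w) * indicator (bad m0) w \<partial>PXE) \<le> ennreal (77 * L / real n)"
proof (cases "L = 0")
  case True
  have pen0: "pen m = 0" for m by (simp add: penalty_def True)
  have "AE w in PXE. loss_of m w \<le> 0" if m: "m \<in> {m0..N}" for m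
  proof -
    have "f0 \<in> P m" using m m0 P_mono[of m0 m] by auto
    moreover have "1 \<le> m" using m m0 by auto
    ultimately have "(\<integral>\<^sup>+w. ennreal (loss_of m w) \<partial>PXE) \<le> 0"
      using loss_of_expectation[of m f0] by (simp add: pen0)
    then have "AE w in PXE. ennreal (loss_of m w) = 0"
      using nn_integral_0_iff_AE[of "\<lambda>w. ennreal (loss_of m w)" PXE] loss_of_measurable[OF \<open>1 \<le> m\<close>] by simp
    then show ?thesis by eventually_elim (simp add: ennreal_eq_0_iff)
  qed
  then have "AE w in PXE. \<forall>m\<in>{m0..N}. loss_of m w \<le> 0"
    by (intro AE_finite_allI) auto
  then have "AE w in PXE. w \<notin> bad m0"
    by eventually_elim (auto simp: bad_def pen0 not_less)
  then have "AE w in PXE. ennreal (R w) * indicator (bad m0) w \<le> 0"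
    by eventually_elim simp
  then have "(\<integral>\<^sup>+w. ennreal (R w) * indicator (bad m0) w \<partial>PXE) \<le> (\<integral>\<^sup>+w. 0 \<partial>PXE)"
    by (rule nn_integral_mono_AE)
  then show ?thesis by simp
next
  case False
  then have L_pos: "0 < L" using L(1) by simp
  define c where "c = 16 * real n * L"
  have c: "0 < c" using L_pos n by (simp add: c_def)
  have B [measurable]: "bad m0 \<in> sets PXE" using m0 by (intro bad_sets) auto
  note [measurable] = R(1)
  have "(\<integral>\<^sup>+w. ennreal (R w) * indicator (bad m0) w \<partial>PXE)
     \<le> (\<integral>\<^sup>+w. ennreal (1 / c) * ennreal ((R w)\<^sup>2) + ennreal c * indicator (bad m0) w \<partial>PXE)"
  proof (rule nn_integral_mono)
    fix w
    have "0 \<le> (R w - c / 2)\<^sup>2" by simp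
    then have "c * R w \<le> (R w)\<^sup>2 + c * c / 4"
      by (simp add: power2_eq_square algebra_simps)
    also have "\<dots> \<le> (R w)\<^sup>2 + c * c" using c by simp
    finally have "c * R w \<le> (R w)\<^sup>2 + c * c" .
    then have "R w \<le> 1 / c * (R w)\<^sup>2 + c" using c by (simp add: field_simps)
    then have "ennreal (R w) \<le> ennreal (1 / c) * ennreal ((R w)\<^sup>2) + ennreal c"
      using c by (simp add: ennreal_leI flip: ennreal_plus ennreal_mult)
    then show "ennreal (R w) * indicator (bad m0) w \<le> ennreal (1 / c) * ennreal ((R w)\<^sup>2) + ennreal c * indicator (bad m0) w"
      by (cases "w \<in> bad m0") auto
  qed
  also have "\<dots> = ennreal (1 / c) * (\<integral>\<^sup>+w. ennreal ((R w)\<^sup>2) \<partial>PXE) + ennreal c * emeasure PXE (bad m0)"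
    by (subst nn_integral_add, measurable, subst nn_integral_cmult, measurable, subst nn_integral_cmult, measurable)
      (simp only: nn_integral_indicator[OF B])
  also have "\<dots> \<le> ennreal (1 / c) * ennreal (1152 * L\<^sup>2) + ennreal c * ennreal (2 / real n ^ 3)"
    by (intro add_mono mult_left_mono R(2)[OF L_pos] emeasure_bad m0 L_pos) auto
  also have "\<dots> = ennreal (1 / c * (1152 * L\<^sup>2) + c * (2 / real n ^ 3))"
    using c by (simp flip: ennreal_plus ennreal_mult)
  also have "\<dots> \<le> ennreal (77 * L / real n)"
  proof (rule ennreal_leI)
    have "1 / c * (1152 * L\<^sup>2) = 72 * L / real n"
      using L_pos n by (simp add: c_def power2_eq_square)
    moreover have "c * (2 / real n ^ 3) = 32 * L / (real n * real n)"
      using n by (simp add: c_def power3_eq_cube)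
    moreover have "32 * L / (real n * real n) \<le> 5 * L / real n"
      using n L_pos by (simp add: field_simps)
    ultimately show "1 / c * (1152 * L\<^sup>2) + c * (2 / real n ^ 3) \<le> 77 * L / real n"
      by (simp add: add_divide_distrib[symmetric])
  qed
  finally show ?thesis .
qed

text \<open>Bounds the loss of every fit from a model containing \<open>f0\<close>, whatever its
  index. In the discrete norm the residual of the fit is then no larger than the noise; in the
  continuous norm both functions are bounded by \<open>sqrt L\<close>. In both cases the square of a
  difference costs the factor 4.\<close>

definition remainder :: "(nat \<Rightarrow> 'a) \<times> (nat \<Rightarrow> real) \<Rightarrow> real" where
  "remainder w = (case h of Cont \<Rightarrow> 4 * L | Disc \<Rightarrow> 4 * (1 / real n * (\<Sum>i=1..n. (snd w i)\<^sup>2)))"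

lemma remainder_Cont: "h = Cont \<Longrightarrow> remainder w = 4 * L"
  unfolding remainder_def by simp

lemma remainder_Disc: "h = Disc \<Longrightarrow> remainder w = 4 * (1 / real n * (\<Sum>i=1..n. (snd w i)\<^sup>2))"
  unfolding remainder_def by simp

lemma remainder_measurable [measurable]: "remainder \<in> borel_measurable PXE"
proof -
  have "(\<lambda>w. 4 * (1 / real n * (\<Sum>i=1..n. (snd w i)\<^sup>2))) \<in> borel_measurable PXE" by measurable
  then show ?thesis
    unfolding remainder_def[abs_def] by (cases h) auto
qed

lemma loss_le_remainder:
  assumes m: "1 \<le> m" "f0 \<in> P m" and w: "w \<in> space PXE"
  shows "loss_of m w \<le> remainder w"
proof -
  have x: "fst w \<in> space PX" using w by (auto simp: space_pair_measure)
  show ?thesis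
  proof (cases h)
    case Cont
    let ?f = "fh m (fst w) (response (fst w) (snd w))"
    have f: "?f \<in> P m" by (rule fh_in[OF m(1) x])
    have "loss_of m w = (\<integral>z. (?f z - f0 z)\<^sup>2 \<partial>\<nu>)" by (simp add: Cont sqdist.simps)
    also have "\<dots> \<le> (\<integral>z. 4 * L \<partial>\<nu>)"
    proof (rule integral_mono)
      show "integrable \<nu> (\<lambda>z. (?f z - f0 z)\<^sup>2)" using f P_l2[OF m(1)] f0 by (intro integrable_sq_diff) auto
      fix z assume z: "z \<in> space \<nu>"
      have "(?f z)\<^sup>2 \<le> L" "(f0 z)\<^sup>2 \<le> L" using bounded_Cont[OF Cont m(1)] f z by auto
      moreover have "(?f z - f0 z)\<^sup>2 \<le> 2 * (?f z)\<^sup>2 + 2 * (f0 z)\<^sup>2"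
        using zero_le_power2[of "?f z + f0 z"] by (simp add: power2_eq_square algebra_simps)
      ultimately show "(?f z - f0 z)\<^sup>2 \<le> 4 * L" by linarith
    qed simp
    also have "\<dots> = 4 * L" by (simp add: \<nu>.prob_space)
    finally show ?thesis unfolding remainder_Cont[OF Cont] .
  next
    case Disc
    let ?x = "fst w" and ?e = "snd w"
    let ?f = "fh m ?x (response ?x ?e)"
    have "(\<Sum>i=1..n. (?f (?x i) - f0 (?x i))\<^sup>2)
      \<le> (\<Sum>i=1..n. 2 * (f0 (?x i) + ?e i - ?f (?x i))\<^sup>2 + 2 * (?e i)\<^sup>2)"
    proof (rule sum_mono)
      fix i
      have "(a - b)\<^sup>2 \<le> 2 * (b + c - a)\<^sup>2 + 2 * c\<^sup>2" for a b c :: real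
        using zero_le_power2[of "b + 2 * c - a"] by (simp add: power2_eq_square algebra_simps)
      then show "(?f (?x i) - f0 (?x i))\<^sup>2 \<le> 2 * (f0 (?x i) + ?e i - ?f (?x i))\<^sup>2 + 2 * (?e i)\<^sup>2" .
    qed
    also have "\<dots> = 2 * (\<Sum>i=1..n. (f0 (?x i) + ?e i - ?f (?x i))\<^sup>2) + 2 * (\<Sum>i=1..n. (?e i)\<^sup>2)"
      by (simp add: sum.distrib sum_distrib_left)
    also have "\<dots> \<le> 2 * (\<Sum>i=1..n. (f0 (?x i) + ?e i - f0 (?x i))\<^sup>2) + 2 * (\<Sum>i=1..n. (?e i)\<^sup>2)"
      using fit_minimal[OF lse[OF m(1)] x m(2)] by simp
    also have "\<dots> = 4 * (\<Sum>i=1..n. (?e i)\<^sup>2)" by simp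
    finally have "1 / real n * (\<Sum>i=1..n. (?f (?x i) - f0 (?x i))\<^sup>2) \<le> 1 / real n * (4 * (\<Sum>i=1..n. (?e i)\<^sup>2))"
      by (intro mult_left_mono) auto
    then show ?thesis unfolding remainder_Disc[OF Disc] by (simp add: Disc sqdist.simps)
  qed
qed

lemma remainder_second_moment:
  assumes L_pos: "0 < L"
  shows "(\<integral>\<^sup>+w. ennreal ((remainder w)\<^sup>2) \<partial>PXE) \<le> ennreal (1152 * L\<^sup>2)"
proof (cases h)
  case Cont
  have "(\<integral>\<^sup>+w. ennreal ((remainder w)\<^sup>2) \<partial>PXE) = ennreal (16 * L\<^sup>2)"
    by (simp only: remainder_Cont[OF Cont] power_mult_distrib nn_integral_const PXE.P.emeasure_space_1 mult_1_right) simp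
  then show ?thesis by (simp add: ennreal_leI)
next
  case Disc
  have pw: "(4 * (1 / real n * (\<Sum>i=1..n. (e i)\<^sup>2)))\<^sup>2 \<le> 16 / real n * (\<Sum>i=1..n. (e i) ^ 4)" for e :: "nat \<Rightarrow> real"
  proof -
    have "(\<Sum>i=1..n. (e i)\<^sup>2)\<^sup>2 \<le> real n * (\<Sum>i=1..n. ((e i)\<^sup>2)\<^sup>2)"
      using sum_squared_le_sum_of_squares[of "\<lambda>i. (e i)\<^sup>2" "{1..n}"] by (simp add: mult.commute)
    then have "16 / (real n)\<^sup>2 * (\<Sum>i=1..n. (e i)\<^sup>2)\<^sup>2 \<le> 16 / (real n)\<^sup>2 * (real n * (\<Sum>i=1..n. ((e i)\<^sup>2)\<^sup>2))"
      by (intro mult_left_mono) auto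
    moreover have "(4 * (1 / real n * (\<Sum>i=1..n. (e i)\<^sup>2)))\<^sup>2 = 16 / (real n)\<^sup>2 * (\<Sum>i=1..n. (e i)\<^sup>2)\<^sup>2"
      by (simp add: power_mult_distrib power_divide)
    moreover have "16 / (real n)\<^sup>2 * (real n * (\<Sum>i=1..n. ((e i)\<^sup>2)\<^sup>2)) = 16 / real n * (\<Sum>i=1..n. (e i) ^ 4)"
      by (simp add: power2_eq_square[of "real n"] flip: power_mult)
    ultimately show ?thesis by (simp only:)
  qed
  have coord: "(\<integral>\<^sup>+w. ennreal ((snd w i) ^ 4) \<partial>PXE) \<le> ennreal (72 * L\<^sup>2)" if i: "i \<in> {1..n}" for i
  proof -
    have m: "(\<lambda>w. snd w i) \<in> measurable PXE \<mu>" using i by measurable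
    have "(\<integral>\<^sup>+w. ennreal ((snd w i) ^ 4) \<partial>PXE) = (\<integral>\<^sup>+x. \<integral>\<^sup>+e. ennreal (e i ^ 4) \<partial>PE \<partial>PX)"
      using PE.nn_integral_fst[of "\<lambda>w. ennreal ((snd w i) ^ 4)" PX] i by simp
    also have "\<dots> = (\<integral>\<^sup>+e. ennreal (e i ^ 4) \<partial>PE)"
      by (simp only: nn_integral_const PX.emeasure_space_1 mult_1_right)
    also have "\<dots> = (\<integral>\<^sup>+z. ennreal (z ^ 4) \<partial>distr PE \<mu> (\<lambda>e. e i))"
      using i by (subst nn_integral_distr) auto
    also have "distr PE \<mu> (\<lambda>e. e i) = \<mu>"
      using distr_PiM_component[of "{1..n}" "\<lambda>_. \<mu>" i] i noise(1) by auto
    also have "(\<integral>\<^sup>+z. ennreal (z ^ 4) \<partial>\<mu>) \<le> ennreal (72 * L\<^sup>2)"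
      by (rule sub_gaussian_fourth_moment[OF noise(2) L(2) L_pos])
    finally show ?thesis .
  qed
  have meas: "(\<lambda>w. ennreal ((snd w i) ^ 4)) \<in> borel_measurable PXE" if "i \<in> {1..n}" for i
    using that by measurable
  have "(\<integral>\<^sup>+w. ennreal ((remainder w)\<^sup>2) \<partial>PXE)
     \<le> (\<integral>\<^sup>+w. ennreal (16 / real n) * (\<Sum>i=1..n. ennreal ((snd w i) ^ 4)) \<partial>PXE)"
  proof (rule nn_integral_mono)
    fix w :: "(nat \<Rightarrow> 'a) \<times> (nat \<Rightarrow> real)"
    have "ennreal ((remainder w)\<^sup>2) \<le> ennreal (16 / real n * (\<Sum>i=1..n. (snd w i) ^ 4))"
      unfolding remainder_Disc[OF Disc] by (rule ennreal_leI[OF pw])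
    also have "\<dots> = ennreal (16 / real n) * ennreal (\<Sum>i=1..n. (snd w i) ^ 4)"
      by (rule ennreal_mult) (auto intro: sum_nonneg)
    also have "ennreal (\<Sum>i=1..n. (snd w i) ^ 4) = (\<Sum>i=1..n. ennreal ((snd w i) ^ 4))"
      by simp
    finally show "ennreal ((remainder w)\<^sup>2) \<le> ennreal (16 / real n) * (\<Sum>i=1..n. ennreal ((snd w i) ^ 4))" .
  qed
  also have "\<dots> = ennreal (16 / real n) * (\<integral>\<^sup>+w. (\<Sum>i=1..n. ennreal ((snd w i) ^ 4)) \<partial>PXE)"
    by (rule nn_integral_cmult) (intro borel_measurable_sum meas)
  also have "(\<integral>\<^sup>+w. (\<Sum>i=1..n. ennreal ((snd w i) ^ 4)) \<partial>PXE) = (\<Sum>i=1..n. \<integral>\<^sup>+w. ennreal ((snd w i) ^ 4) \<partial>PXE)"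
    by (rule nn_integral_sum) (rule meas)
  also have "\<dots> \<le> (\<Sum>i=1..n. ennreal (72 * L\<^sup>2))"
    by (intro sum_mono coord)
  also have "ennreal (16 / real n) * \<dots> = ennreal (1152 * L\<^sup>2)"
    using n by (simp add: ennreal_of_nat_eq_real_of_nat flip: ennreal_mult)
  finally show ?thesis by (simp add: mult_left_mono)
qed

lemma adaptive_parametric_bound:
  assumes m0: "m0 \<in> {1..N}" "f0 \<in> P m0"
  shows "\<exists>U\<in>borel_measurable PXE.
    (\<forall>w\<in>space PXE. ennreal (adaptive_loss h \<nu> n L \<kappa> D N fh f0 (fst w) (response (fst w) (snd w))) \<le> U w) \<and>
    (\<integral>\<^sup>+w. U w \<partial>PXE) \<le> ennreal (2 * (t_const h + 57344 + 44) * pen m0)"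
proof (intro bexI conjI ballI)
  let ?U = "\<lambda>w. (ennreal (2 * t_const h * pen m0) + ennreal 2 * ennreal (loss_of m0 w)) + ennreal (remainder w) * indicator (bad m0) w"
  have m01: "1 \<le> m0" using m0 by simp
  note [measurable] = loss_of_measurable[OF m01] bad_sets[OF m01]
  show "?U \<in> borel_measurable PXE" by measurable
  fix w assume w: "w \<in> space PXE"
  then have x: "fst w \<in> space PX" by (auto simp: space_pair_measure)
  let ?s = "selected (fst w) (snd w)"
  show "ennreal (adaptive_loss h \<nu> n L \<kappa> D N fh f0 (fst w) (response (fst w) (snd w))) \<le> ?U w"
  proof (cases "?s \<le> m0")
    case True
    have "ennreal (loss_of ?s w) \<le> ennreal (2 * t_const h * pen m0 + 2 * loss_of m0 w)"
      using m0 by (intro ennreal_leI adaptive_loss_le[OF x True]) auto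
    also have "\<dots> = ennreal (2 * t_const h * pen m0) + ennreal 2 * ennreal (loss_of m0 w)"
      using t_pen_nonneg[OF m01] sqdist_nonneg[of h "fst w" _ f0] by (simp add: ennreal_plus ennreal_mult)
    also have "\<dots> \<le> ?U w" by simp
    finally show ?thesis by (simp add: adaptive_loss_eq)
  next
    case False
    then have "w \<in> bad m0" using selected_le_if_not_bad[OF m0(1) w] by blast
    \<comment> \<open>The models are nested, so \<open>f0\<close> also lies in the model of the
      selected index.\<close>
    moreover have "loss_of ?s w \<le> remainder w"
      using False m0 P_mono[OF m01, of ?s] by (intro loss_le_remainder w) auto
    ultimately show ?thesis by (simp add: adaptive_loss_eq add_increasing ennreal_leI)
  qed
next
  have m01: "1 \<le> m0" using m0 by simp
  note [measurable] = loss_of_measurable[OF m01] bad_sets[OF m01]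
  have pen: "0 \<le> pen m0" by (rule pen_nonneg[OF m01])
  have kD: "1 \<le> \<kappa> * D m0" using kappa_ge_1 D_ge_1[OF m01] mult_mono[of 1 \<kappa> 1 "D m0"] by simp
  have "(\<integral>\<^sup>+w. (ennreal (2 * t_const h * pen m0) + ennreal 2 * ennreal (loss_of m0 w)) + ennreal (remainder w) * indicator (bad m0) w \<partial>PXE)
    = ennreal (2 * t_const h * pen m0) + ennreal 2 * (\<integral>\<^sup>+w. ennreal (loss_of m0 w) \<partial>PXE)
      + (\<integral>\<^sup>+w. ennreal (remainder w) * indicator (bad m0) w \<partial>PXE)"
    by (subst nn_integral_add, measurable, subst nn_integral_add, measurable, subst nn_integral_cmult, measurable)
      (simp only: nn_integral_const PXE.P.emeasure_space_1 mult_1_right)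
  also have "\<dots> \<le> ennreal (2 * t_const h * pen m0) + ennreal 2 * ennreal (57344 * pen m0) + ennreal (77 * L / real n)"
  proof (intro add_mono mult_left_mono order_refl)
    show "(\<integral>\<^sup>+w. ennreal (loss_of m0 w) \<partial>PXE) \<le> ennreal (57344 * pen m0)"
      using loss_of_expectation[OF m01 m0(2)] by simp
    show "(\<integral>\<^sup>+w. ennreal (remainder w) * indicator (bad m0) w \<partial>PXE) \<le> ennreal (77 * L / real n)"
      by (intro bad_remainder m0 remainder_measurable remainder_second_moment)
  qed simp
  also have "\<dots> = ennreal (2 * t_const h * pen m0 + 2 * (57344 * pen m0) + 77 * L / real n)"
    using pen t_pen_nonneg[OF m01] L(1) by (simp add: ennreal_plus ennreal_mult mult.assoc)
  also have "\<dots> \<le> ennreal (2 * (t_const h + 57344 + 44) * pen m0)"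
  proof (rule ennreal_leI)
    \<comment> \<open>The remainder costs less than one unit of \<open>88 = 2 * 44\<close>
      penalties, because \<open>\<kappa> * D m0 * ln n\<close> is at least
      \<open>3 / 2\<close>.\<close>
    have "77 \<le> 88 * ((\<kappa> * D m0) * ln (real n))"
      using mult_mono[OF kD ln_n_ge] kD by simp
    then have "L / real n * 77 \<le> L / real n * (88 * ((\<kappa> * D m0) * ln (real n)))"
      using L(1) by (intro mult_left_mono) auto
    then have "77 * L / real n \<le> 88 * pen m0"
      by (simp add: penalty_def mult_ac)
    then show "2 * t_const h * pen m0 + 2 * (57344 * pen m0) + 77 * L / real n \<le> 2 * (t_const h + 57344 + 44) * pen m0"
      by (simp add: algebra_simps)
  qed
  finally show "(\<integral>\<^sup>+w. (ennreal (2 * t_const h * pen m0) + ennreal 2 * ennreal (loss_of m0 w)) + ennreal (remainder w) * indicator (bad m0) w \<partial>PXE)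
    \<le> ennreal (2 * (t_const h + 57344 + 44) * pen m0)" .
qed

end

section \<open>The regression experiment\<close>

lemma iid_sample_law:
  assumes "prob_space M" "iid_sample M S \<mu> n Z" "1 \<le> n"
  shows "distr M (PiM {1..n} (\<lambda>_. S)) (sample n Z) = PiM {1..n} (\<lambda>_. \<mu>)"
proof -
  interpret prob_space M by fact
  have indep: "indep_vars (\<lambda>_. S) Z {1..n}" and law: "\<And>i. i \<in> {1..n} \<Longrightarrow> distr M S (Z i) = \<mu>"
    using assms(2) by (auto simp: iid_sample_def)
  have "distr M (PiM {1..n} (\<lambda>_. S)) (\<lambda>\<omega>. \<lambda>i\<in>{1..n}. Z i \<omega>) = PiM {1..n} (\<lambda>i. distr M S (Z i))"
    using indep assms(3) by (subst indep_vars_iff_distr_eq_PiM'[symmetric]) (auto simp: indep_vars_def)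
  also have "\<dots> = PiM {1..n} (\<lambda>_. \<mu>)"
    by (intro PiM_cong refl law)
  finally show ?thesis by (simp add: sample_def[abs_def])
qed

text \<open>The product of probability measures is determined by measurable rectangles, and on these
  independence is exactly multiplicativity.\<close>

lemma independent_rv_law:
  assumes "prob_space M" and ind: "independent_rv M S U T V"
  shows "distr M (S \<Otimes>\<^sub>M T) (\<lambda>\<omega>. (U \<omega>, V \<omega>)) = distr M S U \<Otimes>\<^sub>M distr M T V"
proof -
  interpret prob_space M by fact
  have [measurable]: "U \<in> measurable M S" "V \<in> measurable M T"
    and indep: "indep_set {U -` A \<inter> space M |A. A \<in> sets S} {V -` B \<inter> space M |B. B \<in> sets T}"
    using ind by (auto simp: independent_rv_def)
  have "distr M S U \<Otimes>\<^sub>M distr M T V = distr M (S \<Otimes>\<^sub>M T) (\<lambda>\<omega>. (U \<omega>, V \<omega>))"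
  proof (rule pair_measure_eqI)
    show "sigma_finite_measure (distr M S U)" "sigma_finite_measure (distr M T V)"
      by (auto intro!: prob_space_imp_sigma_finite prob_space_distr)
    show "sets (distr M S U \<Otimes>\<^sub>M distr M T V) = sets (distr M (S \<Otimes>\<^sub>M T) (\<lambda>\<omega>. (U \<omega>, V \<omega>)))"
      by (simp cong: sets_pair_measure_cong)
    fix A B assume "A \<in> sets (distr M S U)" "B \<in> sets (distr M T V)"
    then have A [measurable]: "A \<in> sets S" and B [measurable]: "B \<in> sets T" by auto
    have "prob ((U -` A \<inter> space M) \<inter> (V -` B \<inter> space M)) = prob (U -` A \<inter> space M) * prob (V -` B \<inter> space M)"
      by (rule indep_setD[OF indep]) (use A B in auto)
    moreover have "(\<lambda>\<omega>. (U \<omega>, V \<omega>)) -` (A \<times> B) \<inter> space M = (U -` A \<inter> space M) \<inter> (V -` B \<inter> space M)"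
      by auto
    ultimately show "emeasure (distr M S U) A * emeasure (distr M T V) B
        = emeasure (distr M (S \<Otimes>\<^sub>M T) (\<lambda>\<omega>. (U \<omega>, V \<omega>))) (A \<times> B)"
      by (simp add: emeasure_distr emeasure_eq_measure ennreal_mult)
  qed
  then show ?thesis by simp
qed

section \<open>Outer expectations, infima and thresholds\<close>

lemma outer_expectation_le:
  assumes "U \<in> borel_measurable M" "\<And>\<omega>. \<omega> \<in> space M \<Longrightarrow> Z \<omega> \<le> U \<omega>"
  shows "outer_expectation M Z \<le> (\<integral>\<^sup>+\<omega>. U \<omega> \<partial>M)"
  unfolding outer_expectation_def using assms by (intro INF_lower2[of U]) auto

text \<open>No competitor has to attain the approximation error; one within \<open>e / c\<close> of
  the infimum replaces it.\<close>

lemma le_add_mult_INF: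
  fixes f :: "'i \<Rightarrow> ennreal"
  assumes c: "0 < c" and I: "I \<noteq> {}" and le: "\<And>i. i \<in> I \<Longrightarrow> x \<le> k + ennreal c * f i"
  shows "x \<le> k + ennreal c * (INF i\<in>I. f i)"
proof (rule ennreal_le_epsilon)
  fix e :: real assume fin: "k + ennreal c * (INF i\<in>I. f i) < \<top>" and e: "0 < e"
  have "(INF i\<in>I. f i) < \<top>"
    using fin c by (auto simp: ennreal_mult_less_top)
  then have "(INF i\<in>I. f i) < (INF i\<in>I. f i) + ennreal (e / c)"
    using e c by (cases "INF i\<in>I. f i" rule: ennreal_cases) (auto simp: ennreal_less_iff simp flip: ennreal_plus)
  then obtain i where i: "i \<in> I" "f i < (INF i\<in>I. f i) + ennreal (e / c)"
    by (auto simp: INF_less_iff)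
  have "x \<le> k + ennreal c * f i" by (rule le[OF i(1)])
  also have "\<dots> \<le> k + ennreal c * ((INF i\<in>I. f i) + ennreal (e / c))"
    using i(2) by (intro add_left_mono mult_left_mono) auto
  also have "\<dots> = k + ennreal c * (INF i\<in>I. f i) + ennreal (c * (e / c))"
    using c e by (simp add: distrib_left ennreal_mult[symmetric] add.assoc)
  finally show "x \<le> k + ennreal c * (INF i\<in>I. f i) + ennreal e" using c by simp
qed

text \<open>Divergence of \<open>\<MM>\<close> makes the set of candidate thresholds nonempty, so
  its infimum belongs to it.\<close>

lemma le_at_sample_threshold:
  assumes lim: "filterlim \<MM> at_top sequentially" and n: "sample_threshold \<MM> (enat m) \<le> n"
  shows "m \<le> \<MM> n"
proof -
  let ?K = "{N. \<forall>n\<ge>N. m \<le> \<MM> n}"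
  have "eventually (\<lambda>n. m \<le> \<MM> n) sequentially" using lim by (simp add: filterlim_at_top)
  then have "?K \<noteq> {}" by (auto simp: eventually_sequentially)
  then have "Inf ?K \<in> ?K" by (rule Inf_nat_def1)
  then show ?thesis using n by (simp add: sample_threshold_def)
qed

theorem theorem4p4:
  fixes \<Omega> :: "(real ^ 'd) set"
    and \<nu> :: "(real ^ 'd) measure"
    and M :: "'w measure"
    and X :: "nat \<Rightarrow> 'w \<Rightarrow> real ^ 'd"
    and \<epsilon> Y :: "nat \<Rightarrow> 'w \<Rightarrow> real"
    and \<mu> :: "real measure"
    and f0 :: "real ^ 'd \<Rightarrow> real"
    and F :: "(real ^ 'd \<Rightarrow> real) set"
    and P :: "nat \<Rightarrow> (real ^ 'd \<Rightarrow> real) set"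
    and D :: "nat \<Rightarrow> real"
    and fhat :: "nat \<Rightarrow> (nat \<Rightarrow> real ^ 'd) \<Rightarrow> (nat \<Rightarrow> real) \<Rightarrow> real ^ 'd \<Rightarrow> real"
    and \<sigma> \<Gamma> \<kappa> :: real
    and ast :: bias_kind
    and \<ee> :: "(real ^ 'd \<Rightarrow> real) \<Rightarrow> (real ^ 'd) set \<Rightarrow> real"
    and \<GG> :: "nat \<Rightarrow> real"
    and \<MM> :: "norm_kind \<Rightarrow> nat \<Rightarrow> nat"
    and n :: nat and m0 :: enat
  assumes nu: "prob_space \<nu>" "sets \<nu> = sets (restrict_space borel \<Omega>)"
    and M: "prob_space M"
    and X_iid: "iid_sample M \<nu> \<nu> n X"
    and eps_iid: "iid_sample M borel \<mu> n \<epsilon>"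
    and indep: "independent_rv M
                  (PiM {1..n} (\<lambda>_. \<nu>)) (sample n X) (PiM {1..n} (\<lambda>_. borel)) (sample n \<epsilon>)"
    and subgauss: "\<forall>i\<in>{1..n}. sub_gaussian M (\<sigma>\<^sup>2) (\<epsilon> i)"
    and Y: "\<forall>i\<in>{1..n}. \<forall>\<omega>\<in>space M. Y i \<omega> = f0 (X i \<omega>) + \<epsilon> i \<omega>"
    and kappa: "entropy_constant \<kappa>"
    and models: "F \<subseteq> l2_fun \<nu>" "\<forall>m\<ge>1. P m \<subseteq> F" "\<forall>m\<ge>1. P m \<subseteq> P (m + 1)"
    and D: "\<forall>m\<ge>1. 1 \<le> D m"
           "\<forall>m\<ge>1. AE x in PiM {1..n} (\<lambda>_. \<nu>). real (pdim n (trace_set n x (P m))) \<le> D m"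
    and fhat: "\<forall>m\<ge>1. least_squares_estimator \<nu> n (P m) (fhat m)"
    and nonneg: "0 \<le> \<ee> f0 \<Omega>" "\<forall>m\<ge>1. 0 \<le> \<GG> m"
    and up: "ast = Bias_up \<longrightarrow> (\<forall>m\<ge>1. approx_error \<nu> f0 (P m) \<le> ennreal (\<ee> f0 \<Omega> * \<GG> m))"
    and m0: "1 \<le> m0" "f0 \<in> submodel P F m0"
  shows
    "(oracle_index (bias ast \<nu> F P \<GG>) (noise_level Cont \<sigma> \<Gamma>) \<kappa> D (\<MM> Cont) \<and>
      \<MM> Cont n \<le> n \<and> filterlim (\<MM> Cont) at_top sequentially \<and>
      (\<forall>f\<in>F. \<forall>x\<in>\<Omega>. \<bar>f x\<bar> \<le> \<Gamma>) \<and>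
      n \<ge> max (sample_threshold (\<MM> Cont) m0) 7 \<longrightarrow>
      outer_expectation M
        (\<lambda>\<omega>. ennreal (adaptive_loss Cont \<nu> n (noise_level Cont \<sigma> \<Gamma>) \<kappa> D (\<MM> Cont n)
                        fhat f0 (sample n X \<omega>) (sample n Y \<omega>)))
      \<le> min (ennreal (2 * (t_const Cont + k_bar Cont + 44))
               * penalty_ext (max (\<sigma>\<^sup>2) (\<Gamma>\<^sup>2)) \<kappa> D n m0)
             (ennreal (2 * (c_bar Cont * bias_factor ast (\<ee> f0 \<Omega>) + k_bar Cont + t_const Cont))
               * (INF m\<in>{1..}. bias ast \<nu> F P \<GG> m
                               + ennreal (penalty (max (\<sigma>\<^sup>2) (\<Gamma>\<^sup>2)) \<kappa> D n m))))
   \<and>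
     (oracle_index (bias ast \<nu> F P \<GG>) (noise_level Disc \<sigma> \<Gamma>) \<kappa> D (\<MM> Disc) \<and>
      \<MM> Disc n \<le> n \<and> filterlim (\<MM> Disc) at_top sequentially \<and>
      bounded (f0 ` \<Omega>) \<and>
      n \<ge> max (sample_threshold (\<MM> Disc) m0) 7 \<longrightarrow>
      outer_expectation M
        (\<lambda>\<omega>. ennreal (adaptive_loss Disc \<nu> n (noise_level Disc \<sigma> \<Gamma>) \<kappa> D (\<MM> Disc n)
                        fhat f0 (sample n X \<omega>) (sample n Y \<omega>)))
      \<le> min (ennreal (2 * (t_const Disc + k_bar Disc + 84))
               * penalty_ext (max (\<sigma>\<^sup>2) ((SUP x\<in>\<Omega>. \<bar>f0 x\<bar>)\<^sup>2)) \<kappa> D n m0)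
             (ennreal (2 * (c_bar Disc * bias_factor ast (\<ee> f0 \<Omega>) + k_bar Disc + t_const Disc))
               * (INF m\<in>{1..}. bias ast \<nu> F P \<GG> m + ennreal (penalty (\<sigma>\<^sup>2) \<kappa> D n m))))"
proof -
  interpret M: prob_space M by (rule M)
  have space_nu: "space \<nu> = \<Omega>"
    using sets_eq_imp_space_eq[OF nu(2)] by (simp add: space_restrict_space)
  have P_F: "P m \<subseteq> F" if "1 \<le> m" for m using models(2) that by blast
  have P_mono: "P m \<subseteq> P m'" if "1 \<le> m" "m \<le> m'" for m m'
    using that(2)
  proof (induction m' rule: dec_induct)
    case (step k)
    have "P k \<subseteq> P (Suc k)" using models(3) step(1) that(1) by simp
    with step show ?case by blast
  qed simp
  have f0_F: "f0 \<in> F"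
    using m0 P_F by (cases m0) (auto simp: submodel_def one_enat_def)
  \<comment> \<open>Both norms are instances. The parameters \<open>L'\<close> and \<open>c\<close>
    make room for the larger level and constant in the first bound for the discrete norm.\<close>
  have main: "outer_expectation M
        (\<lambda>\<omega>. ennreal (adaptive_loss h \<nu> n L \<kappa> D N fhat f0 (sample n X \<omega>) (sample n Y \<omega>)))
      \<le> min (ennreal (2 * (t_const h + k_bar h + c)) * penalty_ext L' \<kappa> D n m0)
             (ennreal (2 * (c_bar h * bias_factor ast (\<ee> f0 \<Omega>) + k_bar h + t_const h))
               * (INF m\<in>{1..}. bias ast \<nu> F P \<GG> m + ennreal (penalty L \<kappa> D n m)))"
    if n: "7 \<le> n" and argmin: "is_arg_min (criterion (bias ast \<nu> F P \<GG>) L \<kappa> D n) (\<lambda>m. 1 \<le> m) N" and N: "N \<le> n"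
      and noise_le: "\<sigma>\<^sup>2 \<le> L" "L \<le> L'" and c: "44 \<le> c"
      and bounded: "h = Cont \<Longrightarrow> \<forall>f\<in>F. \<forall>z\<in>\<Omega>. (f z)\<^sup>2 \<le> L"
      and large: "\<And>m. m0 = enat m \<Longrightarrow> m \<le> N"
    for h L L' c N
  proof -
    let ?O = "outer_expectation M
        (\<lambda>\<omega>. ennreal (adaptive_loss h \<nu> n L \<kappa> D N fhat f0 (sample n X \<omega>) (sample n Y \<omega>)))"
    have n1: "1 \<le> n" using n by simp
    \<comment> \<open>As \<open>n \<ge> 1\<close>, there is at least one error variable; from it
      \<open>\<mu>\<close> inherits being a probability measure and being sub-Gaussian.\<close>
    have eps1: "\<epsilon> 1 \<in> borel_measurable M" "distr M borel (\<epsilon> 1) = \<mu>"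
      using eps_iid n1 by (auto simp: iid_sample_def M.indep_vars_def)
    have mu: "prob_space \<mu>" "sets \<mu> = sets borel"
      using eps1 M.prob_space_distr[OF eps1(1)] by auto
    have "sub_gaussian \<mu> (\<sigma>\<^sup>2) (\<lambda>z. z)"
      using subgauss n1 eps1(1) unfolding sub_gaussian_def eps1(2)[symmetric]
      by (auto simp: nn_integral_distr)
    then have sg: "sub_gaussian \<mu> L (\<lambda>z. z)" using noise_le(1) by (rule sub_gaussian_mono)
    have L0: "0 \<le> L" using noise_le(1) zero_le_power2[of \<sigma>] by linarith
    have N1: "1 \<le> N" and N_min: "\<And>m. 1 \<le> m \<Longrightarrow>
        criterion (bias ast \<nu> F P \<GG>) L \<kappa> D n N \<le> criterion (bias ast \<nu> F P \<GG>) L \<kappa> D n m"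
      using argmin by (auto simp: is_arg_min_def not_less)
    have "f0 \<in> l2_fun \<nu>" using f0_F models(1) by blast
    then have design: "random_design \<nu> \<mu> \<kappa> n f0"
      by (rule random_design.intro[OF nu(1) mu kappa n])
    interpret adaptive_regression \<nu> \<mu> \<kappa> n f0 P D L h N fhat
    proof (rule adaptive_regression.intro[OF design adaptive_regression_axioms.intro])
      show "P m \<subseteq> l2_fun \<nu>" if "1 \<le> m" for m using P_F[OF that] models(1) by blast
      show "\<forall>f\<in>insert f0 (P m). \<forall>z\<in>space \<nu>. (f z)\<^sup>2 \<le> L" if "h = Cont" "1 \<le> m" for m
        using bounded[OF that(1)] f0_F P_F[OF that(2)] unfolding space_nu by blast
      show "P m \<subseteq> P m'" if "1 \<le> m" "m \<le> m'" for m m' by (rule P_mono[OF that])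
      show "1 \<le> D m" if "1 \<le> m" for m using D(1) that by blast
      show "AE x in PiM {1..n} (\<lambda>_. \<nu>). real (pdim n (trace_set n x (P m))) \<le> D m" if "1 \<le> m" for m
        using D(2) that by blast
      show "least_squares_estimator \<nu> n (P m) (fhat m)" if "1 \<le> m" for m using fhat that by blast
    qed (fact L0 sg N1 N)+
    \<comment> \<open>The two samples together have the law of the canonical experiment.\<close>
    have law: "distr M (PX \<Otimes>\<^sub>M PiM {1..n} (\<lambda>_. borel)) (\<lambda>\<omega>. (sample n X \<omega>, sample n \<epsilon> \<omega>)) = PX \<Otimes>\<^sub>M PE"
      using independent_rv_law[OF M indep] iid_sample_law[OF M X_iid n1] iid_sample_law[OF M eps_iid n1] by simp
    have meas: "(\<lambda>\<omega>. (sample n X \<omega>, sample n \<epsilon> \<omega>)) \<in> measurable M (PX \<Otimes>\<^sub>M PiM {1..n} (\<lambda>_. borel))"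
      using indep by (auto simp: independent_rv_def intro!: measurable_Pair)
    \<comment> \<open>The noise coordinates carry \<open>borel\<close> on one side and
      \<open>\<mu>\<close> on the other; the sigma-algebras coincide.\<close>
    have sets_eq: "sets (PX \<Otimes>\<^sub>M PE) = sets (PX \<Otimes>\<^sub>M PiM {1..n} (\<lambda>_. borel))"
      by (intro sets_pair_measure_cong sets_PiM_cong refl mu(2))
    have response_eq: "sample n Y \<omega> = response (sample n X \<omega>) (sample n \<epsilon> \<omega>)" if "\<omega> \<in> space M" for \<omega>
      using Y that by (auto simp: sample_def response_def fun_eq_iff)
    \<comment> \<open>The pullback of \<open>U\<close> along the two samples is measurable on
      \<open>M\<close>, hence an admissible majorant in the outer expectation.\<close>
    have transfer: "?O \<le> b"
      if ex: "\<exists>U\<in>borel_measurable PXE.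
        (\<forall>w\<in>space PXE. ennreal (adaptive_loss h \<nu> n L \<kappa> D N fhat f0 (fst w) (response (fst w) (snd w))) \<le> U w) \<and>
        (\<integral>\<^sup>+w. U w \<partial>PXE) \<le> b" for b
    proof -
      obtain U where U: "U \<in> borel_measurable PXE"
        "\<And>w. w \<in> space PXE \<Longrightarrow> ennreal (adaptive_loss h \<nu> n L \<kappa> D N fhat f0 (fst w) (response (fst w) (snd w))) \<le> U w"
        "(\<integral>\<^sup>+w. U w \<partial>PXE) \<le> b" using ex by blast
      have U': "U \<in> borel_measurable (PX \<Otimes>\<^sub>M PiM {1..n} (\<lambda>_. borel))"
        using U(1) measurable_cong_sets[OF sets_eq refl] by blast
      have "?O \<le> (\<integral>\<^sup>+\<omega>. U (sample n X \<omega>, sample n \<epsilon> \<omega>) \<partial>M)"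
      proof (rule outer_expectation_le)
        show "(\<lambda>\<omega>. U (sample n X \<omega>, sample n \<epsilon> \<omega>)) \<in> borel_measurable M"
          by (rule measurable_compose[OF meas U'])
        fix \<omega> assume \<omega>: "\<omega> \<in> space M"
        have "(sample n X \<omega>, sample n \<epsilon> \<omega>) \<in> space PXE"
          using measurable_space[OF meas \<omega>] sets_eq_imp_space_eq[OF sets_eq] by simp
        from U(2)[OF this] show "ennreal (adaptive_loss h \<nu> n L \<kappa> D N fhat f0 (sample n X \<omega>) (sample n Y \<omega>))
            \<le> U (sample n X \<omega>, sample n \<epsilon> \<omega>)"
          by (simp add: response_eq[OF \<omega>])
      qed
      also have "\<dots> = (\<integral>\<^sup>+w. U w \<partial>distr M (PX \<Otimes>\<^sub>M PiM {1..n} (\<lambda>_. borel)) (\<lambda>\<omega>. (sample n X \<omega>, sample n \<epsilon> \<omega>)))"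
        by (rule nn_integral_distr[OF meas, symmetric]) (use U' in simp)
      also have "\<dots> \<le> b" unfolding law by (rule U(3))
      finally show ?thesis .
    qed
    have k_bar: "57344 \<le> k_bar h" by (cases h) auto
    have t0: "0 \<le> t_const h" using t_const_ge[of h] by simp
    have "?O \<le> ennreal (2 * (t_const h + k_bar h + c)) * penalty_ext L' \<kappa> D n m0"
    proof (cases m0)
      case (enat m)
      have m: "m \<in> {1..N}" using m0(1) large[OF enat] by (simp add: enat one_enat_def)
      have "f0 \<in> P m" using m0(2) by (simp add: enat submodel_def)
      then have "?O \<le> ennreal (2 * (t_const h + 57344 + 44) * pen m)"
        by (intro transfer adaptive_parametric_bound m)
      also have "\<dots> \<le> ennreal (2 * (t_const h + k_bar h + c) * penalty L' \<kappa> D n m)"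
      proof (intro ennreal_leI mult_mono)
        show "pen m \<le> penalty L' \<kappa> D n m"
          unfolding penalty_def using noise_le(2) kappa_ge_1 D_ge_1[of m] m ln_n_ge
          by (intro divide_right_mono mult_right_mono) auto
      qed (use k_bar t0 c pen_nonneg[of m] m in auto)
      also have "\<dots> = ennreal (2 * (t_const h + k_bar h + c)) * penalty_ext L' \<kappa> D n m0"
        using k_bar t0 c by (simp add: enat penalty_ext_def ennreal_mult')
      finally show ?thesis .
    next
      \<comment> \<open>The factor is positive, so the right-hand side is
        \<open>\<top>\<close>.\<close>
      case infinity
      then show ?thesis using k_bar t0 c by (simp add: penalty_ext_def ennreal_mult_top)
    qed
    moreover have "?O \<le> ennreal (2 * (c_bar h * bias_factor ast (\<ee> f0 \<Omega>) + k_bar h + t_const h))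
               * (INF m\<in>{1..}. bias ast \<nu> F P \<GG> m + ennreal (penalty L \<kappa> D n m))"
    proof -
      let ?bf = "bias_factor ast (\<ee> f0 \<Omega>)"
      have c_bar: "0 < c_bar h" by (cases h) auto
      have bf: "0 \<le> ?bf" using nonneg(1) by (cases ast) auto
      \<comment> \<open>The passage to the infimum needs a nonempty model; a least squares fit
        supplies an element.\<close>
      have PN: "P N \<noteq> {}"
      proof -
        obtain x where "x \<in> space PX" using PX.not_empty by blast
        then show ?thesis using fh_in[OF N1, of x] by blast
      qed
      have approx: "approx_error \<nu> f0 (P N) \<le> ennreal ?bf * bias ast \<nu> F P \<GG> N"
      proof (cases ast)
        case Bias_up
        then show ?thesis using up N1 nonneg by (simp add: ennreal_mult)
      next
        case Bias_un
        then show ?thesis using f0_F by (auto intro: SUP_upper)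
      qed
      let ?K = "2 * ((57344 + t_const h) * pen N)"
      have "?O \<le> ennreal ?K + ennreal (2 * c_bar h) * approx_error \<nu> f0 (P N)"
        unfolding approx_error_def
      proof (rule le_add_mult_INF)
        fix g assume "g \<in> P N"
        then have "?O \<le> ennreal (2 * (c_bar h * (\<integral>z. (f0 z - g z)\<^sup>2 \<partial>\<nu>) + (57344 + t_const h) * pen N))"
          by (intro transfer adaptive_oracle_bound)
        also have "\<dots> = ennreal (?K + 2 * c_bar h * (\<integral>z. (f0 z - g z)\<^sup>2 \<partial>\<nu>))"
          by (simp add: algebra_simps)
        also have "\<dots> = ennreal ?K + ennreal (2 * c_bar h) * ennreal (\<integral>z. (f0 z - g z)\<^sup>2 \<partial>\<nu>)"
          using c_bar t0 pen_nonneg[OF N1] by (simp add: ennreal_plus ennreal_mult)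
        finally show "?O \<le> ennreal ?K + ennreal (2 * c_bar h) * ennreal (\<integral>z. (f0 z - g z)\<^sup>2 \<partial>\<nu>)" .
      qed (use c_bar PN in auto)
      also have "\<dots> \<le> ennreal (2 * (k_bar h + t_const h)) * ennreal (pen N) + ennreal (2 * c_bar h) * (ennreal ?bf * bias ast \<nu> F P \<GG> N)"
      proof (intro add_mono mult_left_mono approx)
        have "?K \<le> 2 * ((k_bar h + t_const h) * pen N)"
          using k_bar pen_nonneg[OF N1] by (intro mult_left_mono mult_right_mono) auto
        then have "ennreal ?K \<le> ennreal (2 * (k_bar h + t_const h) * pen N)"
          by (intro ennreal_leI) (simp only: mult.assoc)
        also have "\<dots> = ennreal (2 * (k_bar h + t_const h)) * ennreal (pen N)"
          using k_bar t0 pen_nonneg[OF N1] by (intro ennreal_mult) auto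
        finally show "ennreal ?K \<le> ennreal (2 * (k_bar h + t_const h)) * ennreal (pen N)" .
      qed simp
      also have "\<dots> = ennreal (2 * (k_bar h + t_const h)) * ennreal (pen N) + ennreal (2 * (c_bar h * ?bf)) * bias ast \<nu> F P \<GG> N"
      proof -
        have "ennreal (2 * c_bar h) * ennreal ?bf = ennreal (2 * (c_bar h * ?bf))"
          using c_bar bf by (subst ennreal_mult[symmetric]) (auto simp: mult.assoc)
        then show ?thesis by (simp only: mult.assoc[symmetric])
      qed
      \<comment> \<open>Giving bias and penalty the sum of both constants as common factor recovers
        the criterion at \<open>N\<close>, which is its minimum.\<close>
      also have "\<dots> \<le> ennreal (2 * (c_bar h * ?bf + k_bar h + t_const h)) * ennreal (pen N)
          + ennreal (2 * (c_bar h * ?bf + k_bar h + t_const h)) * bias ast \<nu> F P \<GG> N"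
        using c_bar bf k_bar t0 by (intro add_mono mult_right_mono ennreal_leI) auto
      also have "\<dots> = ennreal (2 * (c_bar h * ?bf + k_bar h + t_const h)) * criterion (bias ast \<nu> F P \<GG>) L \<kappa> D n N"
        by (simp add: criterion_def distrib_left add.commute)
      also have "\<dots> \<le> ennreal (2 * (c_bar h * ?bf + k_bar h + t_const h))
          * (INF m\<in>{1..}. bias ast \<nu> F P \<GG> m + ennreal (penalty L \<kappa> D n m))"
        using N_min by (intro mult_left_mono INF_greatest) (auto simp: criterion_def)
      finally show ?thesis .
    qed
    ultimately show ?thesis by simp
  qed
  show ?thesis
  proof (intro conjI impI)
    assume *: "oracle_index (bias ast \<nu> F P \<GG>) (noise_level Cont \<sigma> \<Gamma>) \<kappa> D (\<MM> Cont) \<and>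
      \<MM> Cont n \<le> n \<and> filterlim (\<MM> Cont) at_top sequentially \<and>
      (\<forall>f\<in>F. \<forall>x\<in>\<Omega>. \<bar>f x\<bar> \<le> \<Gamma>) \<and> n \<ge> max (sample_threshold (\<MM> Cont) m0) 7"
    have sq: "(f z)\<^sup>2 \<le> noise_level Cont \<sigma> \<Gamma>" if "f \<in> F" "z \<in> \<Omega>" for f z
    proof -
      have "\<bar>f z\<bar> \<le> \<Gamma>" using * that by blast
      then have "(f z)\<^sup>2 \<le> \<Gamma>\<^sup>2" by (metis abs_ge_zero power2_abs power_mono)
      then show ?thesis by simp
    qed
    show "outer_expectation M
        (\<lambda>\<omega>. ennreal (adaptive_loss Cont \<nu> n (noise_level Cont \<sigma> \<Gamma>) \<kappa> D (\<MM> Cont n)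
                        fhat f0 (sample n X \<omega>) (sample n Y \<omega>)))
      \<le> min (ennreal (2 * (t_const Cont + k_bar Cont + 44))
               * penalty_ext (max (\<sigma>\<^sup>2) (\<Gamma>\<^sup>2)) \<kappa> D n m0)
             (ennreal (2 * (c_bar Cont * bias_factor ast (\<ee> f0 \<Omega>) + k_bar Cont + t_const Cont))
               * (INF m\<in>{1..}. bias ast \<nu> F P \<GG> m
                               + ennreal (penalty (max (\<sigma>\<^sup>2) (\<Gamma>\<^sup>2)) \<kappa> D n m)))"
      unfolding noise_level.simps(1)
      using * sq le_at_sample_threshold[of "\<MM> Cont" _ n]
      by (intro main) (auto simp: oracle_index_def)
  next
    assume *: "oracle_index (bias ast \<nu> F P \<GG>) (noise_level Disc \<sigma> \<Gamma>) \<kappa> D (\<MM> Disc) \<and>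
      \<MM> Disc n \<le> n \<and> filterlim (\<MM> Disc) at_top sequentially \<and>
      bounded (f0 ` \<Omega>) \<and> n \<ge> max (sample_threshold (\<MM> Disc) m0) 7"
    show "outer_expectation M
        (\<lambda>\<omega>. ennreal (adaptive_loss Disc \<nu> n (noise_level Disc \<sigma> \<Gamma>) \<kappa> D (\<MM> Disc n)
                        fhat f0 (sample n X \<omega>) (sample n Y \<omega>)))
      \<le> min (ennreal (2 * (t_const Disc + k_bar Disc + 84))
               * penalty_ext (max (\<sigma>\<^sup>2) ((SUP x\<in>\<Omega>. \<bar>f0 x\<bar>)\<^sup>2)) \<kappa> D n m0)
             (ennreal (2 * (c_bar Disc * bias_factor ast (\<ee> f0 \<Omega>) + k_bar Disc + t_const Disc))
               * (INF m\<in>{1..}. bias ast \<nu> F P \<GG> m + ennreal (penalty (\<sigma>\<^sup>2) \<kappa> D n m)))"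
      unfolding noise_level.simps(2)
      using * le_at_sample_threshold[of "\<MM> Disc" _ n]
      by (intro main) (auto simp: oracle_index_def)
  qed
qed

end
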